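(* Suppose that the signal-to-noise condition $$\frac{n\,\gamma_p^{-2}}{p}\,\|\mu_1-\mu_2\|_2^2\to\infty\qquad (n\to\infty)$$ holds. Then the least squares change point estimator $\hat\tau_n$ satisfies $$n\,\gamma_p^{-2}\,\|\mu_1-\mu_2\|_2^2\,(\hat\tau_n-\tau_n)=O_{\mathrm P}(1)\qquad (n\to\infty).$$
   Context: Model. For each $n\ge 1$ let $p=p(n)$ be a dimension with $p(n)\to\infty$ as $n\to\infty$. Let $\{\eta_{kt}:k\ge 1,\,t\in\mathbb Z\}$ be i.i.d. real random variables with mean $0$, variance $1$ and finite fourth moment, and put $\eta_t=(\eta_{1t},\dots,\eta_{pt})'$. For each $n$ let $\{A_j=A_{j,p(n)}^{(n)}:j\ge 0\}$ be deterministic real $p\times p$ matrices and let $\mu_1,\mu_2\in\mathbb R^{p}$ be deterministic vectors (all allowed to depend on $n$). One observes $X_1,\dots,X_n\in\mathbb R^p$, $X_t=(X_{1t},\dots,X_{pt})'$, with $$X_t=\mu_1 I(t\le n\tau_n)+\mu_2 I(t>n\tau_n)+\varepsilon_t,\qquad \varepsilon_t=\sum_{j=0}^\infty A_j\eta_{t-j}.$$ Here $c^*\in(0,1/2)$ is a fixed constant, and the change point $\tau_n$ satisfies $\tau_n\in(c^*,1-c^* )$ and $n\tau_n\in\mathbb Z$. Norms. $\|\cdot\|_2$ is the Euclidean norm of a vector and the spectral norm of a matrix. $\gamma_p=\sum_{j=0}^\infty\|A_j\|_2$, assumed finite and positive. Estimator. $\hat\tau_n\in\arg\min L(b)$, the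 minimum being over $b\in(c^*,1-c^* )$ with $nb\in\mathbb Z$, where $$L(b)=\frac1n\sum_{k=1}^p\Big[\sum_{t=1}^{nb}(X_{kt}-\hat\mu_{1k}(b))^2+\sum_{t=nb+1}^{n}(X_{kt}-\hat\mu_{2k}(b))^2\Big],$$ $$\hat\mu_{1k}(b)=\frac1{nb}\sum_{t=1}^{nb}X_{kt},\qquad \hat\mu_{2k}(b)=\frac1{n(1-b)}\sum_{t=nb+1}^nX_{kt}.$$ Asymptotics are as $n\to\infty$; all parameters $p,\mu_1,\mu_2,A_j,\tau_n$ may depend on $n$. *)

theory Defs
  imports "HOL-Probability.Probability"
begin

text \<open>The dimension depends on the sample size, so vectors in \<open>\<real>\<^sup>d\<close> are functions
  \<^typ>\<open>nat \<Rightarrow> real\<close> and \<open>d \<times> d\<close> matrices are functions \<^typ>\<open>nat \<Rightarrow> nat \<Rightarrow> real\<close>, of which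
  only the entries with indices in \<open>{..<d}\<close> matter. Coordinates are numbered from 0,
  time points from 1.\<close>

definition vnorm :: "nat \<Rightarrow> (nat \<Rightarrow> real) \<Rightarrow> real" where
  "vnorm d v = L2_set v {..<d}"

definition mat_vec :: "nat \<Rightarrow> (nat \<Rightarrow> nat \<Rightarrow> real) \<Rightarrow> (nat \<Rightarrow> real) \<Rightarrow> nat \<Rightarrow> real" where
  "mat_vec d A v = (\<lambda>k. \<Sum>l<d. A k l * v l)"

definition spectral_norm :: "nat \<Rightarrow> (nat \<Rightarrow> nat \<Rightarrow> real) \<Rightarrow> real" where
  "spectral_norm d A = (SUP v\<in>{v. vnorm d v \<le> 1}. vnorm d (mat_vec d A v))"

text \<open>Meaningful only if the norms are summable, which has to be assumed separately.\<close>

definition coeff_norm_sum :: "nat \<Rightarrow> (nat \<Rightarrow> nat \<Rightarrow> nat \<Rightarrow> real) \<Rightarrow> real" where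
  "coeff_norm_sum d A = (\<Sum>j. spectral_norm d (A j))"

text \<open>If the spectral norms of the \<open>A j\<close> are summable and the \<open>\<eta> k t\<close> are bounded in
  $L^2$, the series below converges absolutely for almost every \<open>\<omega>\<close>; \<^const>\<open>suminf\<close>
  fixes some value on the remaining null set.\<close>

definition linear_process ::
    "nat \<Rightarrow> (nat \<Rightarrow> nat \<Rightarrow> nat \<Rightarrow> real) \<Rightarrow> (nat \<Rightarrow> int \<Rightarrow> 'a \<Rightarrow> real) \<Rightarrow> nat \<Rightarrow> int \<Rightarrow> 'a \<Rightarrow> real" where
  "linear_process d A \<eta> k t \<omega> = (\<Sum>j. mat_vec d (A j) (\<lambda>l. \<eta> l (t - int j) \<omega>) k)"

text \<open>The \<open>k\<close>-th coordinate of the observation at time \<open>t\<close>, for sample size \<open>n\<close> and change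
  point \<open>\<tau>\<close>.\<close>

definition observation ::
    "nat \<Rightarrow> nat \<Rightarrow> (nat \<Rightarrow> real) \<Rightarrow> (nat \<Rightarrow> real) \<Rightarrow> real \<Rightarrow> (nat \<Rightarrow> nat \<Rightarrow> nat \<Rightarrow> real)
      \<Rightarrow> (nat \<Rightarrow> int \<Rightarrow> 'a \<Rightarrow> real) \<Rightarrow> 'a \<Rightarrow> nat \<Rightarrow> nat \<Rightarrow> real" where
  "observation n d \<mu>1 \<mu>2 \<tau> A \<eta> \<omega> k t =
     (if real t \<le> real n * \<tau> then \<mu>1 k else \<mu>2 k) + linear_process d A \<eta> k (int t) \<omega>"

definition change_candidates :: "real \<Rightarrow> nat \<Rightarrow> real set" where
  "change_candidates c n = {b. c < b \<and> b < 1 - c \<and> real n * b \<in> \<int>}"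

text \<open>On \<^const>\<open>change_candidates\<close> the floor below is exact.\<close>

definition split_time :: "nat \<Rightarrow> real \<Rightarrow> nat" where
  "split_time n b = nat \<lfloor>real n * b\<rfloor>"

definition mean_before :: "nat \<Rightarrow> (nat \<Rightarrow> real) \<Rightarrow> real \<Rightarrow> real" where
  "mean_before n x b = 1 / (real n * b) * (\<Sum>t=1..split_time n b. x t)"

definition mean_after :: "nat \<Rightarrow> (nat \<Rightarrow> real) \<Rightarrow> real \<Rightarrow> real" where
  "mean_after n x b = 1 / (real n * (1 - b)) * (\<Sum>t=split_time n b + 1..n. x t)"

definition ls_criterion :: "nat \<Rightarrow> nat \<Rightarrow> (nat \<Rightarrow> nat \<Rightarrow> real) \<Rightarrow> real \<Rightarrow> real" where
  "ls_criterion n d x b = 1 / real n * (\<Sum>k<d.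
     (\<Sum>t=1..split_time n b. (x k t - mean_before n (x k) b)\<^sup>2) +
     (\<Sum>t=split_time n b + 1..n. (x k t - mean_after n (x k) b)\<^sup>2))"

text \<open>$Y_n = O_{\mathrm P}(1)$, for a sequence of random variables: the event has to be
  measurable, as \<^const>\<open>measure\<close> is 0 on non-measurable sets.\<close>

definition bounded_in_prob :: "'a measure \<Rightarrow> (nat \<Rightarrow> 'a \<Rightarrow> real) \<Rightarrow> bool" where
  "bounded_in_prob M Y \<longleftrightarrow> (\<forall>n. Y n \<in> borel_measurable M) \<and>
     (\<forall>e>0. \<exists>C. \<forall>\<^sub>F n in sequentially. measure M {\<omega> \<in> space M. \<bar>Y n \<omega>\<bar> > C} < e)"

end

theory Submission imports Defs begin

text \<open>Let \<open>m0\<close> be the true and \<open>m\<close> the estimated split time, \<open>\<theta> = \<mu>1 - \<mu>2\<close>, \<open>D = |\<theta>|\<^sup>2\<close>, and let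
  \<open>T\<close> be the block of the \<open>k = |m - m0|\<close> time points between them. Compared with the true
  split, the split at \<open>m\<close> moves \<open>T\<close> from the side where it belongs to the other one. Let \<open>a\<close>
  and \<open>a'\<close> be the means which the split at \<open>m\<close> assigns to these two sides. Means minimise
  sums of squares, so the true split does at least as well as if it had to use \<open>a\<close> and \<open>a'\<close>
  too; the criterion at \<open>m\<close> can therefore be minimal only if \<open>a'\<close> fits \<open>T\<close> at least as well as
  \<open>a\<close>, that is, if the inner product of (mean of \<open>T\<close>) \<open>- (a + a') / 2\<close> with \<open>a - a'\<close> is not
  positive. Without noise this inner product is \<open>\<rho>\<^sup>2 D / 2\<close>, where \<open>\<rho>\<close>, the share of genuine
  members among the points on the other side, is at least \<open>c\<close>. The noise enters through
  \<open>\<langle>\<theta>, U\<rangle>\<close>, \<open>|U|\<^sup>2\<close> and \<open>\<langle>U, S\<rangle>\<close>, where \<open>U\<close> is the sum of the noise over \<open>T\<close> and \<open>S\<close> its sum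
  over all points left, or right, of \<open>m0\<close>. With \<open>\<epsilon> = c\<^sup>4 / 16\<close>, bounds \<open>k \<epsilon> D\<close> for the first and
  \<open>k \<epsilon> n D\<close> for the others leave the inner product positive (\<open>split_gap\<close>,
  \<open>distant_split_is_worse\<close>).

  It remains to have these bounds, with probability close to 1, for all \<open>k \<ge> k0\<close> at once,
  where \<open>k0\<close> is about \<open>K \<gamma>\<^sup>2 / D\<close>. With second moments only, a union bound over \<open>k\<close> is
  too costly, and bounding \<open>\<langle>U, S\<rangle>\<close> by \<open>|U| |S|\<close> would cost a factor \<open>\<surd>p\<close> that the signal-to-noise
  condition does not pay for. Both losses are avoided by a Hajek-Renyi inequality for martingales (\<open>hajek_renyi\<close>), applied to
  scalar processes indexed by \<open>k\<close>. Write each coefficient matrix as its spectral norm times a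
  contraction. The noise quantities are then weighted sums, with weights of total mass at most
  \<open>\<gamma>\<close> or \<open>\<gamma>\<^sup>2\<close>, of the same quantities for pure innovations, and a weighted Cauchy-Schwarz
  inequality transfers second moment bounds for suprema from the latter to the former without
  any rate of decay of the coefficients. For pure innovations, \<open>\<langle>\<theta>, U\<rangle>\<close> is a sum of independent
  terms. A bilinear term is a double sum over pairs of times \<open>u\<close> in the block and \<open>v\<close> in a
  window; it splits into the pairs where \<open>v\<close> enters the block later than \<open>u\<close>, which form a
  martingale when read backwards, the pairs where it does not, which form a martingale when read
  forwards, and the diagonal, which is bounded by its mean \<open>k p\<close> and a sum of independent centred
  terms (\<open>bilinear_ratio_bounded\<close>). After division by \<open>k\<close>, the suprema of the martingale
  parts have second moments of order \<open>n p / k0\<close>. Since the series defining the noise converges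
  almost surely, all bounds pass from its partial sums to the limit (\<open>tail_limit\<close>).

  Chebyshev's inequality then bounds the probability of a bad event by a constant times
  \<open>\<gamma>\<^sup>2 / (k0 D)\<close> for the linear term and \<open>\<gamma>\<^sup>4 p / (k0 n D\<^sup>2)\<close> for the quadratic ones, as soon as
  \<open>\<gamma>\<^sup>2 p\<close>, the offset from the diagonal, is small against \<open>n D\<close>. This is the signal-to-noise
  condition, and by the choice of \<open>k0\<close> both bounds are of order \<open>1 / K\<close> (\<open>deviation_rate\<close>).\<close>

section \<open>Square integrable functions\<close>

definition sq_integrable :: "'a measure \<Rightarrow> ('a \<Rightarrow> real) \<Rightarrow> bool" where
  "sq_integrable M f \<longleftrightarrow> f \<in> borel_measurable M \<and> integrable M (\<lambda>x. (f x)\<^sup>2)"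

lemma sq_integrable_measurable: "sq_integrable M f \<Longrightarrow> f \<in> borel_measurable M"
  by (simp add: sq_integrable_def)

lemma sq_integrable_mult:
  assumes "sq_integrable M f" "sq_integrable M g"
  shows "integrable M (\<lambda>x. f x * g x)"
proof (rule Bochner_Integration.integrable_bound[of _ "\<lambda>x. (f x)\<^sup>2 + (g x)\<^sup>2"])
  show "integrable M (\<lambda>x. (f x)\<^sup>2 + (g x)\<^sup>2)"
    using assms by (simp add: sq_integrable_def)
  show "(\<lambda>x. f x * g x) \<in> borel_measurable M"
    using assms by (auto simp: sq_integrable_def intro: borel_measurable_times)
  have "\<bar>a * b\<bar> \<le> a\<^sup>2 + b\<^sup>2" for a b :: real
  proof -
    have "0 \<le> (\<bar>a\<bar> - \<bar>b\<bar>)\<^sup>2" by simp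
    also have "\<dots> = a\<^sup>2 + b\<^sup>2 - 2 * \<bar>a * b\<bar>"
      by (simp add: power2_diff abs_mult algebra_simps)
    finally show ?thesis by linarith
  qed
  then show "AE x in M. norm (f x * g x) \<le> norm ((f x)\<^sup>2 + (g x)\<^sup>2)"
    by simp
qed

lemma sq_integrable_cmult:
  assumes "sq_integrable M f"
  shows "sq_integrable M (\<lambda>x. c * f x)"
  using assms by (auto simp: sq_integrable_def power_mult_distrib intro: borel_measurable_times)

lemma sq_integrable_add:
  assumes "sq_integrable M f" "sq_integrable M g"
  shows "sq_integrable M (\<lambda>x. f x + g x)"
proof -
  have "integrable M (\<lambda>x. (f x)\<^sup>2 + (g x)\<^sup>2 + 2 * (f x * g x))"
    using assms sq_integrable_mult[OF assms] by (simp add: sq_integrable_def)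
  moreover have "(\<lambda>x. (f x + g x)\<^sup>2) = (\<lambda>x. (f x)\<^sup>2 + (g x)\<^sup>2 + 2 * (f x * g x))"
    by (simp add: power2_sum algebra_simps)
  ultimately show ?thesis
    using assms by (auto simp: sq_integrable_def intro: borel_measurable_add)
qed

lemma sq_integrable_zero [simp]: "sq_integrable M (\<lambda>x. 0)"
  by (simp add: sq_integrable_def)

lemma sq_integrable_sum:
  assumes "\<And>i. i \<in> I \<Longrightarrow> sq_integrable M (f i)"
  shows "sq_integrable M (\<lambda>x. \<Sum>i\<in>I. f i x)"
  using assms by (induction I rule: infinite_finite_induct) (auto intro: sq_integrable_add)

lemma sq_integrable_dominated:
  assumes "sq_integrable M g" "f \<in> borel_measurable M" "\<And>x. x \<in> space M \<Longrightarrow> \<bar>f x\<bar> \<le> \<bar>g x\<bar>"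
  shows "sq_integrable M f"
  unfolding sq_integrable_def
proof (intro conjI)
  show "integrable M (\<lambda>x. (f x)\<^sup>2)"
  proof (rule Bochner_Integration.integrable_bound[of _ "\<lambda>x. (g x)\<^sup>2"])
    show "AE x in M. norm ((f x)\<^sup>2) \<le> norm ((g x)\<^sup>2)"
      using assms(3) by (auto simp: abs_le_square_iff)
  qed (use assms in \<open>simp_all add: sq_integrable_def\<close>)
qed fact

lemma sq_integrable_abs: "sq_integrable M f \<Longrightarrow> sq_integrable M (\<lambda>x. \<bar>f x\<bar>)"
  by (auto simp: sq_integrable_def intro: borel_measurable_abs)

lemma (in finite_measure) sq_integrable_const: "sq_integrable M (\<lambda>x. c)"
  by (simp add: sq_integrable_def)

lemma (in finite_measure) sq_integrable_integrable: "sq_integrable M f \<Longrightarrow> integrable M f"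
  using sq_integrable_mult[of M f "\<lambda>_. 1"] sq_integrable_const[of 1] by simp

section \<open>Maximal inequalities for martingale differences\<close>

text \<open>Orthogonality to the square integrable functions of the past stands in for vanishing
  conditional expectations.\<close>

definition martingale_differences ::
    "'a measure \<Rightarrow> nat \<Rightarrow> (nat \<Rightarrow> 'a \<Rightarrow> real) \<Rightarrow> bool" where
  "martingale_differences M N D \<longleftrightarrow> (\<forall>i<N. sq_integrable M (D i)) \<and>
     (\<exists>F. (\<forall>i\<le>N. subalgebra M (F i)) \<and> (\<forall>i\<le>N. \<forall>j<i. D j \<in> borel_measurable (F i)) \<and>
       (\<forall>i<N. \<forall>g\<in>borel_measurable (F i). sq_integrable M g \<longrightarrow> (\<integral>\<omega>. D i \<omega> * g \<omega> \<partial>M) = 0))"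

text \<open>Deterministic weights are what turns Doob's inequality into the Hajek-Renyi inequality.\<close>

lemma martingale_differences_scale:
  assumes "martingale_differences M N D"
  shows "martingale_differences M N (\<lambda>i \<omega>. c i * D i \<omega>)"
proof -
  obtain F where F: "\<forall>i\<le>N. subalgebra M (F i)" "\<forall>i\<le>N. \<forall>j<i. D j \<in> borel_measurable (F i)"
    "\<forall>i<N. \<forall>g\<in>borel_measurable (F i). sq_integrable M g \<longrightarrow> (\<integral>\<omega>. D i \<omega> * g \<omega> \<partial>M) = 0"
    and D: "\<forall>i<N. sq_integrable M (D i)"
    using assms unfolding martingale_differences_def by blast
  show ?thesis
    unfolding martingale_differences_def
  proof (intro conjI exI[of _ F] allI impI ballI)
    fix i g assume "i < N" "g \<in> borel_measurable (F i)" "sq_integrable M g"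
    then have "(\<integral>\<omega>. D i \<omega> * g \<omega> \<partial>M) = 0" using F(3) by blast
    then show "(\<integral>\<omega>. c i * D i \<omega> * g \<omega> \<partial>M) = 0"
      by (simp add: mult.assoc)
  qed (use F D in \<open>auto intro: sq_integrable_cmult borel_measurable_times\<close>)
qed

primrec running_max :: "(nat \<Rightarrow> real) \<Rightarrow> nat \<Rightarrow> real" where
  "running_max y 0 = \<bar>y 0\<bar>"
| "running_max y (Suc k) = max (running_max y k) \<bar>y (Suc k)\<bar>"

lemma running_max_ge: "i \<le> k \<Longrightarrow> \<bar>y i\<bar> \<le> running_max y k"
  by (induction k) (auto simp: le_Suc_eq)

lemma running_max_nonneg: "0 \<le> running_max y k"
  by (induction k) auto

lemma running_max_le_sum: "running_max y k \<le> (\<Sum>i\<le>k. \<bar>y i\<bar>)"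
  by (induction k) (auto simp: sum_nonneg intro: add_increasing2)

text \<open>The pathwise core of Doob's inequality, with \<open>m\<close> for the running maximum: the left-hand side
  is dominated by the sum of \<open>m i\<close> times the increment of \<open>|y|\<close>, and \<open>m\<close> grows only at times when
  it equals \<open>|y|\<close>. Since \<open>m i * sgn (y i)\<close> depends on the past only, the left-hand side has
  expectation 0 for martingale differences.\<close>

lemma running_max_pathwise:
  fixes d :: "nat \<Rightarrow> real"
  defines "y \<equiv> \<lambda>k. \<Sum>i<k. d i"
  shows "(\<Sum>i<k. d i * (running_max y i * sgn (y i))) \<le> running_max y k * \<bar>y k\<bar> - (running_max y k)\<^sup>2 / 2"
proof (induction k)
  case 0
  then show ?case by (simp add: y_def)
next
  case (Suc k)
  define m where "m = running_max y k"
  have m: "0 \<le> m" "\<bar>y k\<bar> \<le> m" by (simp_all add: m_def running_max_nonneg running_max_ge)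
  have "sgn (y k) * d k \<le> \<bar>y k + d k\<bar> - \<bar>y k\<bar>"
    by (cases "y k" "0::real" rule: linorder_cases) auto
  then have "m * (sgn (y k) * d k) \<le> m * (\<bar>y (Suc k)\<bar> - \<bar>y k\<bar>)"
    using m by (intro mult_left_mono) (simp_all add: y_def)
  moreover have "m * \<bar>y (Suc k)\<bar> - m\<^sup>2 / 2 \<le> max m \<bar>y (Suc k)\<bar> * \<bar>y (Suc k)\<bar> - (max m \<bar>y (Suc k)\<bar>)\<^sup>2 / 2"
  proof (cases "m \<le> \<bar>y (Suc k)\<bar>")
    case True
    have "0 \<le> (\<bar>y (Suc k)\<bar> - m)\<^sup>2" by simp
    then show ?thesis using True by (simp add: max_def power2_diff power2_eq_square field_simps)
  qed (simp add: max_def)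
  moreover have "(\<Sum>i<Suc k. d i * (running_max y i * sgn (y i))) =
      (\<Sum>i<k. d i * (running_max y i * sgn (y i))) + m * (sgn (y k) * d k)"
    by (simp add: m_def)
  ultimately show ?case
    using Suc by (simp add: m_def algebra_simps)
qed

text \<open>The right-hand side \<open>m |y| - m\<^sup>2 / 2\<close> of the pathwise inequality is at most
  \<open>y\<^sup>2 - m\<^sup>2 / 4\<close>; taking expectations gives the constant 4.\<close>

lemma doob_maximal:
  assumes "martingale_differences M N D"
  shows "\<exists>G. sq_integrable M G \<and> (\<forall>\<omega>. \<forall>k\<le>N. \<bar>\<Sum>i<k. D i \<omega>\<bar> \<le> G \<omega>) \<and>
           (\<integral>\<omega>. (G \<omega>)\<^sup>2 \<partial>M) \<le> 4 * (\<Sum>i<N. \<integral>\<omega>. (D i \<omega>)\<^sup>2 \<partial>M)"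
proof -
  obtain F where sub: "\<forall>i\<le>N. subalgebra M (F i)"
    and adapted: "\<forall>i\<le>N. \<forall>j<i. D j \<in> borel_measurable (F i)"
    and orth: "\<forall>i<N. \<forall>g\<in>borel_measurable (F i). sq_integrable M g \<longrightarrow> (\<integral>\<omega>. D i \<omega> * g \<omega> \<partial>M) = 0"
    and D: "\<And>i. i < N \<Longrightarrow> sq_integrable M (D i)"
    using assms unfolding martingale_differences_def by blast
  define y where "y \<omega> k = (\<Sum>i<k. D i \<omega>)" for \<omega> k
  define m where "m k \<omega> = running_max (y \<omega>) k" for k \<omega>
  have y_sq: "sq_integrable M (\<lambda>\<omega>. y \<omega> k)" if "k \<le> N" for k
    unfolding y_def using D that by (intro sq_integrable_sum) auto
  have y_F: "(\<lambda>\<omega>. y \<omega> i) \<in> borel_measurable (F k)" if "i \<le> k" "k \<le> N" for i k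
    unfolding y_def using adapted that by (intro borel_measurable_sum) auto
  have m_F: "m i \<in> borel_measurable (F k)" if "i \<le> k" "k \<le> N" for i k
    using that
  proof (induction i)
    case 0
    then show ?case using y_F[of 0 k] by (simp add: m_def)
  next
    case (Suc i)
    then show ?case using y_F[of "Suc i" k] by (simp add: m_def)
  qed
  have m_M: "m i \<in> borel_measurable M" if "i \<le> N" for i
    using m_F[of i i] that sub measurable_from_subalg by blast
  have m_sq: "sq_integrable M (m k)" if "k \<le> N" for k
  proof (rule sq_integrable_dominated)
    show "sq_integrable M (\<lambda>\<omega>. \<Sum>i\<le>k. \<bar>y \<omega> i\<bar>)"
      using y_sq that by (intro sq_integrable_sum sq_integrable_abs) auto
    show "\<bar>m k \<omega>\<bar> \<le> \<bar>\<Sum>i\<le>k. \<bar>y \<omega> i\<bar>\<bar>" for \<omega>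
      using running_max_le_sum[of "y \<omega>" k] running_max_nonneg[of "y \<omega>" k] by (simp add: m_def)
  qed (use m_M that in auto)
  define g where "g i \<omega> = m i \<omega> * sgn (y \<omega> i)" for i \<omega>
  have g_F: "g i \<in> borel_measurable (F i)" if "i \<le> N" for i
    unfolding g_def using m_F[of i i] y_F[of i i] that by simp
  have g_sq: "sq_integrable M (g i)" if "i \<le> N" for i
  proof (rule sq_integrable_dominated[OF m_sq])
    show "g i \<in> borel_measurable M" using g_F[OF that] that sub measurable_from_subalg by blast
  qed (use that in \<open>auto simp: g_def abs_mult abs_sgn_eq\<close>)
  have zero: "(\<integral>\<omega>. D i \<omega> * g i \<omega> \<partial>M) = 0" if "i < N" for i
    using orth g_F g_sq that by auto
  have pathwise: "(m N \<omega>)\<^sup>2 \<le> 4 * (y \<omega> N)\<^sup>2 - 4 * (\<Sum>i<N. D i \<omega> * g i \<omega>)" for \<omega>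
  proof -
    have "(\<Sum>i<N. D i \<omega> * g i \<omega>) \<le> m N \<omega> * \<bar>y \<omega> N\<bar> - (m N \<omega>)\<^sup>2 / 2"
      using running_max_pathwise[of "\<lambda>i. D i \<omega>" N] by (simp add: g_def m_def y_def[abs_def])
    moreover have "0 \<le> (m N \<omega> - 2 * \<bar>y \<omega> N\<bar>)\<^sup>2" by simp
    ultimately show ?thesis by (simp add: power2_diff power_mult_distrib algebra_simps)
  qed
  have Dg: "integrable M (\<lambda>\<omega>. D i \<omega> * g i \<omega>)" if "i < N" for i
    using D g_sq that by (intro sq_integrable_mult) auto
  have "(\<integral>\<omega>. (m N \<omega>)\<^sup>2 \<partial>M) \<le> (\<integral>\<omega>. 4 * (y \<omega> N)\<^sup>2 - 4 * (\<Sum>i<N. D i \<omega> * g i \<omega>) \<partial>M)"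
    using m_sq[of N] y_sq[of N] Dg pathwise
    by (intro integral_mono Bochner_Integration.integrable_diff integrable_mult_right
        Bochner_Integration.integrable_sum) (auto simp: sq_integrable_def)
  also have "\<dots> = 4 * (\<integral>\<omega>. (y \<omega> N)\<^sup>2 \<partial>M)"
    using y_sq[of N] Dg zero
    by (subst Bochner_Integration.integral_diff)
       (auto simp: sq_integrable_def intro!: Bochner_Integration.integrable_sum)
  also have "(\<integral>\<omega>. (y \<omega> N)\<^sup>2 \<partial>M) = (\<Sum>i<N. \<integral>\<omega>. (D i \<omega>)\<^sup>2 \<partial>M)"
  proof -
    have "(\<integral>\<omega>. (y \<omega> k)\<^sup>2 \<partial>M) = (\<Sum>i<k. \<integral>\<omega>. (D i \<omega>)\<^sup>2 \<partial>M)" if "k \<le> N" for k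
      using that
    proof (induction k)
      case 0
      then show ?case by (simp add: y_def)
    next
      case (Suc k)
      have "(\<lambda>\<omega>. (y \<omega> (Suc k))\<^sup>2) = (\<lambda>\<omega>. (y \<omega> k)\<^sup>2 + (D k \<omega>)\<^sup>2 + 2 * (D k \<omega> * y \<omega> k))"
        by (simp add: y_def power2_sum algebra_simps)
      moreover have "(\<integral>\<omega>. D k \<omega> * y \<omega> k \<partial>M) = 0"
        using orth y_F[of k k] y_sq[of k] Suc.prems by auto
      moreover have "integrable M (\<lambda>\<omega>. D k \<omega> * y \<omega> k)"
        using D y_sq Suc.prems by (intro sq_integrable_mult) auto
      ultimately show ?case
        using Suc D[of k] y_sq[of k] by (simp add: sq_integrable_def)
    qed
    then show ?thesis by simp
  qed
  finally have "(\<integral>\<omega>. (m N \<omega>)\<^sup>2 \<partial>M) \<le> 4 * (\<Sum>i<N. \<integral>\<omega>. (D i \<omega>)\<^sup>2 \<partial>M)" .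
  moreover have "\<forall>\<omega>. \<forall>k\<le>N. \<bar>\<Sum>i<k. D i \<omega>\<bar> \<le> m N \<omega>"
    using running_max_ge[of _ N "y _"] by (simp add: m_def y_def[abs_def])
  ultimately show ?thesis using m_sq[of N] by blast
qed

text \<open>Summation by parts, as in Kronecker's lemma: if the sums of \<open>d i / w i\<close> are bounded by \<open>m\<close>, then
  those of \<open>d i\<close> are bounded by \<open>2 w k m\<close>.\<close>

lemma abel_bound:
  fixes e w :: "nat \<Rightarrow> real"
  assumes "mono w" "\<And>i. 0 \<le> w i" "\<And>i. i \<le> k \<Longrightarrow> \<bar>\<Sum>j<i. e j\<bar> \<le> m"
  shows "\<bar>\<Sum>i<k. w i * e i\<bar> \<le> 2 * w k * m"
proof -
  define y where "y i = (\<Sum>j<i. e j)" for i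
  have m: "0 \<le> m" using assms(3)[of 0] by simp
  have "(\<Sum>i<k. w i * e i) = w k * y k - (\<Sum>i<k. (w (Suc i) - w i) * y (Suc i))"
    by (induction k) (simp_all add: y_def algebra_simps)
  also have "\<bar>\<dots>\<bar> \<le> \<bar>w k * y k\<bar> + \<bar>\<Sum>i<k. (w (Suc i) - w i) * y (Suc i)\<bar>"
    by (rule abs_triangle_ineq4)
  also have "\<bar>w k * y k\<bar> \<le> w k * m"
    using assms(2)[of k] assms(3)[of k] by (simp add: abs_mult y_def mult_left_mono)
  also have "\<bar>\<Sum>i<k. (w (Suc i) - w i) * y (Suc i)\<bar> \<le> (\<Sum>i<k. (w (Suc i) - w i) * m)"
  proof (rule order_trans[OF sum_abs sum_mono])
    fix i assume "i \<in> {..<k}"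
    moreover have "w i \<le> w (Suc i)" using assms(1) by (simp add: mono_def)
    ultimately show "\<bar>(w (Suc i) - w i) * y (Suc i)\<bar> \<le> (w (Suc i) - w i) * m"
      using assms(3)[of "Suc i"] by (simp add: abs_mult y_def mult_left_mono)
  qed
  also have "(\<Sum>i<k. (w (Suc i) - w i) * m) = (w k - w 0) * m"
    by (simp add: sum_distrib_right[symmetric] sum_lessThan_telescope)
  also have "\<dots> \<le> w k * m"
    using assms(2)[of 0] m by (intro mult_right_mono) auto
  finally show ?thesis by (simp add: mult.commute mult.left_commute)
qed

lemma sum_inverse_squares_bound:
  assumes "1 \<le> k0"
  shows "(\<Sum>i<N. 1 / (real (max i k0))\<^sup>2) \<le> 3 / real k0"
proof -
  have *: "(\<Sum>i<Suc (k0 + j). 1 / (real (max i k0))\<^sup>2) \<le> 3 / real k0 - 1 / real (k0 + j)" for j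
  proof (induction j)
    case 0
    have "(\<Sum>i<Suc k0. 1 / (real (max i k0))\<^sup>2) = (\<Sum>i<Suc k0. 1 / (real k0)\<^sup>2)"
      by (intro sum.cong) (auto simp: max_def)
    also have "\<dots> = (real k0 + 1) / (real k0)\<^sup>2" by simp
    also have "\<dots> \<le> 2 * real k0 / (real k0)\<^sup>2"
      using assms by (intro divide_right_mono) auto
    also have "\<dots> = 3 / real k0 - 1 / real k0"
      using assms by (simp add: power2_eq_square field_simps)
    finally show ?case by simp
  next
    case (Suc j)
    define x where "x = real (k0 + j)"
    have x: "x > 0" using assms by (simp add: x_def)
    have "1 / (x + 1)\<^sup>2 \<le> 1 / (x * (x + 1))"
      using x by (intro divide_left_mono) (auto simp: power2_eq_square)
    also have "\<dots> = 1 / x - 1 / (x + 1)" using x by (simp add: field_simps)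
    finally have "1 / (x + 1)\<^sup>2 \<le> 1 / x - 1 / (x + 1)" .
    moreover have "real (max (Suc (k0 + j)) k0) = x + 1" by (simp add: x_def)
    moreover have "real (k0 + Suc j) = x + 1" by (simp add: x_def)
    ultimately show ?case using Suc by (simp add: x_def add_ac)
  qed
  have "(\<Sum>i<N. 1 / (real (max i k0))\<^sup>2) \<le> (\<Sum>i<Suc (k0 + N). 1 / (real (max i k0))\<^sup>2)"
    by (intro sum_mono2) auto
  also have "\<dots> \<le> 3 / real k0 - 1 / real (k0 + N)" by (rule *)
  also have "\<dots> \<le> 3 / real k0" by simp
  finally show ?thesis .
qed

text \<open>Maximal inequalities do not care whether the differences are orthogonal to their predecessors
  or to their successors; both kinds arise from one bilinear form.\<close>

definition directed_martingale_differences ::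
    "'a measure \<Rightarrow> nat \<Rightarrow> (nat \<Rightarrow> 'a \<Rightarrow> real) \<Rightarrow> bool" where
  "directed_martingale_differences M N D \<longleftrightarrow>
     martingale_differences M N D \<or> martingale_differences M N (\<lambda>i. D (N - Suc i))"

lemma sum_nat_tail:
  fixes f :: "nat \<Rightarrow> real"
  assumes "k \<le> N"
  shows "(\<Sum>i<N - k. f (N - Suc i)) = (\<Sum>i<N. f i) - (\<Sum>i<k. f i)"
proof -
  have "(\<Sum>i<N - k. f (N - Suc i)) = (\<Sum>i\<in>{k..<N}. f i)"
    using assms by (intro sum.reindex_bij_witness[of _ "\<lambda>i. N - Suc i" "\<lambda>i. N - Suc i"]) auto
  also have "\<dots> = (\<Sum>i<N. f i) - (\<Sum>i<k. f i)"
    using sum.atLeastLessThan_concat[of 0 k N f] assms by (simp add: lessThan_atLeast0)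
  finally show ?thesis .
qed

text \<open>In the backward case a partial sum is the total minus a sum of the reversed sequence, which
  costs a factor 2 in \<open>G\<close>.\<close>

lemma directed_maximal:
  assumes "directed_martingale_differences M N D"
  shows "\<exists>G. sq_integrable M G \<and> (\<forall>\<omega>. \<forall>k\<le>N. \<bar>\<Sum>i<k. D i \<omega>\<bar> \<le> G \<omega>) \<and>
           (\<integral>\<omega>. (G \<omega>)\<^sup>2 \<partial>M) \<le> 16 * (\<Sum>i<N. \<integral>\<omega>. (D i \<omega>)\<^sup>2 \<partial>M)"
  using assms unfolding directed_martingale_differences_def
proof
  assume "martingale_differences M N D"
  then obtain G where G: "sq_integrable M G" "\<forall>\<omega>. \<forall>k\<le>N. \<bar>\<Sum>i<k. D i \<omega>\<bar> \<le> G \<omega>"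
    "(\<integral>\<omega>. (G \<omega>)\<^sup>2 \<partial>M) \<le> 4 * (\<Sum>i<N. \<integral>\<omega>. (D i \<omega>)\<^sup>2 \<partial>M)"
    using doob_maximal by blast
  have "0 \<le> (\<Sum>i<N. \<integral>\<omega>. (D i \<omega>)\<^sup>2 \<partial>M)" by (simp add: sum_nonneg)
  with G show ?thesis by (intro exI[of _ G]) auto
next
  assume "martingale_differences M N (\<lambda>i. D (N - Suc i))"
  then obtain G where G: "sq_integrable M G"
    "\<And>\<omega> k. k \<le> N \<Longrightarrow> \<bar>\<Sum>i<k. D (N - Suc i) \<omega>\<bar> \<le> G \<omega>"
    "(\<integral>\<omega>. (G \<omega>)\<^sup>2 \<partial>M) \<le> 4 * (\<Sum>i<N. \<integral>\<omega>. (D (N - Suc i) \<omega>)\<^sup>2 \<partial>M)"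
    using doob_maximal by blast
  have "(\<Sum>i<N. \<integral>\<omega>. (D (N - Suc i) \<omega>)\<^sup>2 \<partial>M) = (\<Sum>i<N. \<integral>\<omega>. (D i \<omega>)\<^sup>2 \<partial>M)"
    using sum_nat_tail[of 0 N "\<lambda>i. \<integral>\<omega>. (D i \<omega>)\<^sup>2 \<partial>M"] by simp
  moreover have "\<bar>\<Sum>i<k. D i \<omega>\<bar> \<le> 2 * G \<omega>" if "k \<le> N" for k \<omega>
    using G(2)[of "N - k" \<omega>] G(2)[of N \<omega>] sum_nat_tail[OF that, of "\<lambda>i. D i \<omega>"]
      sum_nat_tail[of 0 N "\<lambda>i. D i \<omega>"] by auto
  ultimately show ?thesis
    using G(3) sq_integrable_cmult[OF G(1), of 2]
    by (intro exI[of _ "\<lambda>\<omega>. 2 * G \<omega>"]) (auto simp: power_mult_distrib)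
qed

section \<open>Suprema of normalised partial sums\<close>

text \<open>The excess of the supremum of \<open>|f k| / k\<close> over the offset \<open>b\<close> has second moment at most \<open>s\<close>.
  Asking for a dominating \<open>G\<close> instead of the supremum itself makes the notion stable under sums without any
  measurability argument.\<close>

definition ratio_bounded ::
    "'a measure \<Rightarrow> nat set \<Rightarrow> (nat \<Rightarrow> 'a \<Rightarrow> real) \<Rightarrow> real \<Rightarrow> real \<Rightarrow> bool" where
  "ratio_bounded M K f b s \<longleftrightarrow> (\<exists>G. sq_integrable M G \<and> (\<forall>\<omega>. 0 \<le> G \<omega>) \<and>
     (\<forall>\<omega>. \<forall>k\<in>K. \<bar>f k \<omega>\<bar> \<le> real k * (b + G \<omega>)) \<and> (\<integral>\<omega>. (G \<omega>)\<^sup>2 \<partial>M) \<le> s)"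

lemma ratio_bounded_perturb:
  assumes "ratio_bounded M K f b s" "\<And>k \<omega>. k \<in> K \<Longrightarrow> \<bar>g k \<omega>\<bar> \<le> \<bar>f k \<omega>\<bar> + real k * b'" "s \<le> s'"
  shows "ratio_bounded M K g (b + b') s'"
proof -
  obtain G where G: "sq_integrable M G" "\<forall>\<omega>. 0 \<le> G \<omega>"
    "\<And>\<omega> k. k \<in> K \<Longrightarrow> \<bar>f k \<omega>\<bar> \<le> real k * (b + G \<omega>)" "(\<integral>\<omega>. (G \<omega>)\<^sup>2 \<partial>M) \<le> s"
    using assms(1) unfolding ratio_bounded_def by blast
  have "\<bar>g k \<omega>\<bar> \<le> real k * (b + b' + G \<omega>)" if "k \<in> K" for k \<omega>
    using G(3)[OF that, of \<omega>] assms(2)[OF that, of \<omega>] by (simp add: algebra_simps)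
  then show ?thesis
    using G assms(3) unfolding ratio_bounded_def by (intro exI[of _ G]) auto
qed

lemma ratio_bounded_mono:
  assumes "ratio_bounded M K f b s" "b \<le> b'" "s \<le> s'"
  shows "ratio_bounded M K f b' s'"
proof -
  have "ratio_bounded M K f (b + (b' - b)) s'"
    using assms by (intro ratio_bounded_perturb[OF assms(1)]) auto
  then show ?thesis by simp
qed

lemma ratio_bounded_add:
  assumes "ratio_bounded M K f b s" "ratio_bounded M K g b' s'"
  shows "ratio_bounded M K (\<lambda>k \<omega>. f k \<omega> + g k \<omega>) (b + b') (2 * s + 2 * s')"
proof -
  obtain G where G: "sq_integrable M G" "\<forall>\<omega>. 0 \<le> G \<omega>"
    "\<And>\<omega> k. k \<in> K \<Longrightarrow> \<bar>f k \<omega>\<bar> \<le> real k * (b + G \<omega>)" "(\<integral>\<omega>. (G \<omega>)\<^sup>2 \<partial>M) \<le> s"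
    using assms(1) unfolding ratio_bounded_def by blast
  obtain H where H: "sq_integrable M H" "\<forall>\<omega>. 0 \<le> H \<omega>"
    "\<And>\<omega> k. k \<in> K \<Longrightarrow> \<bar>g k \<omega>\<bar> \<le> real k * (b' + H \<omega>)" "(\<integral>\<omega>. (H \<omega>)\<^sup>2 \<partial>M) \<le> s'"
    using assms(2) unfolding ratio_bounded_def by blast
  have "\<bar>f k \<omega> + g k \<omega>\<bar> \<le> real k * (b + b' + (G \<omega> + H \<omega>))" if "k \<in> K" for k \<omega>
    using G(3)[OF that, of \<omega>] H(3)[OF that, of \<omega>] by (simp add: algebra_simps)
  moreover have "(\<integral>\<omega>. (G \<omega> + H \<omega>)\<^sup>2 \<partial>M) \<le> 2 * s + 2 * s'"
  proof -
    have "(\<integral>\<omega>. (G \<omega> + H \<omega>)\<^sup>2 \<partial>M) \<le> (\<integral>\<omega>. 2 * (G \<omega>)\<^sup>2 + 2 * (H \<omega>)\<^sup>2 \<partial>M)"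
    proof (rule integral_mono)
      show "integrable M (\<lambda>\<omega>. (G \<omega> + H \<omega>)\<^sup>2)"
        using sq_integrable_add[OF G(1) H(1)] by (simp add: sq_integrable_def)
      show "(G \<omega> + H \<omega>)\<^sup>2 \<le> 2 * (G \<omega>)\<^sup>2 + 2 * (H \<omega>)\<^sup>2" for \<omega>
        using zero_le_power2[of "G \<omega> - H \<omega>"] by (simp add: power2_sum power2_diff)
    qed (use G(1) H(1) in \<open>simp add: sq_integrable_def\<close>)
    also have "\<dots> \<le> 2 * s + 2 * s'"
      using G H by (simp add: sq_integrable_def)
    finally show ?thesis .
  qed
  ultimately show ?thesis
    using G H sq_integrable_add[OF G(1) H(1)]
    unfolding ratio_bounded_def by (intro exI[of _ "\<lambda>\<omega>. G \<omega> + H \<omega>"]) auto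
qed

lemma weighted_cauchy_schwarz:
  fixes a x :: "'i \<Rightarrow> real"
  assumes "\<And>i. i \<in> I \<Longrightarrow> 0 \<le> a i"
  shows "(\<Sum>i\<in>I. a i * x i)\<^sup>2 \<le> (\<Sum>i\<in>I. a i) * (\<Sum>i\<in>I. a i * (x i)\<^sup>2)"
proof -
  have "(\<Sum>i\<in>I. a i * x i)\<^sup>2 = (\<Sum>i\<in>I. sqrt (a i) * (sqrt (a i) * x i))\<^sup>2"
    using assms by (simp add: mult.assoc[symmetric])
  also have "\<dots> \<le> (\<Sum>i\<in>I. (sqrt (a i))\<^sup>2) * (\<Sum>i\<in>I. (sqrt (a i) * x i)\<^sup>2)"
    by (rule Cauchy_Schwarz_ineq_sum)
  also have "\<dots> = (\<Sum>i\<in>I. a i) * (\<Sum>i\<in>I. a i * (x i)\<^sup>2)"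
    using assms by (simp add: power_mult_distrib)
  finally show ?thesis .
qed

text \<open>The bound depends on the total mass of the weights alone, so it is uniform in the number of
  terms.\<close>

lemma ratio_bounded_weighted_sum:
  assumes "\<And>i. i \<in> I \<Longrightarrow> 0 \<le> a i" "\<And>i. i \<in> I \<Longrightarrow> ratio_bounded M K (f i) b s"
  shows "ratio_bounded M K (\<lambda>k \<omega>. \<Sum>i\<in>I. a i * f i k \<omega>) ((\<Sum>i\<in>I. a i) * b) ((\<Sum>i\<in>I. a i)\<^sup>2 * s)"
proof -
  have "\<exists>G. sq_integrable M G \<and> (\<forall>\<omega>. 0 \<le> G \<omega>) \<and>
     (\<forall>\<omega>. \<forall>k\<in>K. \<bar>f i k \<omega>\<bar> \<le> real k * (b + G \<omega>)) \<and> (\<integral>\<omega>. (G \<omega>)\<^sup>2 \<partial>M) \<le> s" if "i \<in> I" for i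
    using assms(2)[OF that] unfolding ratio_bounded_def .
  then obtain G where G: "\<And>i. i \<in> I \<Longrightarrow> sq_integrable M (G i)"
    "\<And>i \<omega>. i \<in> I \<Longrightarrow> 0 \<le> G i \<omega>"
    "\<And>i \<omega> k. i \<in> I \<Longrightarrow> k \<in> K \<Longrightarrow> \<bar>f i k \<omega>\<bar> \<le> real k * (b + G i \<omega>)"
    "\<And>i. i \<in> I \<Longrightarrow> (\<integral>\<omega>. (G i \<omega>)\<^sup>2 \<partial>M) \<le> s"
    by metis
  define H where "H \<omega> = (\<Sum>i\<in>I. a i * G i \<omega>)" for \<omega>
  have H_sq: "sq_integrable M H"
    unfolding H_def using G(1) by (intro sq_integrable_sum sq_integrable_cmult) auto
  have "\<bar>\<Sum>i\<in>I. a i * f i k \<omega>\<bar> \<le> real k * ((\<Sum>i\<in>I. a i) * b + H \<omega>)" if "k \<in> K" for k \<omega>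
  proof -
    have "\<bar>\<Sum>i\<in>I. a i * f i k \<omega>\<bar> \<le> (\<Sum>i\<in>I. a i * (real k * (b + G i \<omega>)))"
      using assms(1) G(3)[OF _ that]
      by (intro order_trans[OF sum_abs] sum_mono) (auto simp: abs_mult intro!: mult_left_mono)
    also have "\<dots> = real k * ((\<Sum>i\<in>I. a i) * b + H \<omega>)"
      by (simp add: H_def sum_distrib_left sum_distrib_right sum.distrib algebra_simps)
    finally show ?thesis .
  qed
  moreover have "(\<integral>\<omega>. (H \<omega>)\<^sup>2 \<partial>M) \<le> (\<Sum>i\<in>I. a i)\<^sup>2 * s"
  proof -
    have "(\<integral>\<omega>. (H \<omega>)\<^sup>2 \<partial>M) \<le> (\<integral>\<omega>. (\<Sum>i\<in>I. a i) * (\<Sum>i\<in>I. a i * (G i \<omega>)\<^sup>2) \<partial>M)"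
      using H_sq G(1) assms(1) unfolding H_def
      by (intro integral_mono weighted_cauchy_schwarz integrable_mult_right
          Bochner_Integration.integrable_sum) (auto simp: sq_integrable_def)
    also have "\<dots> = (\<Sum>i\<in>I. a i) * (\<Sum>i\<in>I. a i * (\<integral>\<omega>. (G i \<omega>)\<^sup>2 \<partial>M))"
      using G(1) by (simp add: sq_integrable_def)
    also have "\<dots> \<le> (\<Sum>i\<in>I. a i) * (\<Sum>i\<in>I. a i * s)"
      using assms(1) G(4) by (intro mult_left_mono sum_mono) (auto intro: sum_nonneg)
    also have "\<dots> = (\<Sum>i\<in>I. a i)\<^sup>2 * s"
      by (simp add: sum_distrib_right[symmetric] power2_eq_square mult.assoc)
    finally show ?thesis .
  qed
  moreover have "0 \<le> H \<omega>" for \<omega>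
    unfolding H_def using assms(1) G(2) by (intro sum_nonneg) auto
  ultimately show ?thesis
    using H_sq unfolding ratio_bounded_def by (intro exI[of _ H]) auto
qed

text \<open>Doob's inequality for the differences divided by \<open>max i k0\<close>, followed by summation by parts.
  The sum of the squared weights is at most \<open>3 / k0\<close>, and this gives the whole
  range \<open>k \<ge> k0\<close> at the price of the single scale \<open>k0\<close>.\<close>

lemma hajek_renyi:
  assumes md: "directed_martingale_differences M N D"
    and "\<And>i. i < N \<Longrightarrow> (\<integral>\<omega>. (D i \<omega>)\<^sup>2 \<partial>M) \<le> s" and k0: "1 \<le> k0" and "0 \<le> s"
  shows "ratio_bounded M {k0..N} (\<lambda>k \<omega>. \<Sum>i<k. D i \<omega>) 0 (192 * s / real k0)"
proof -
  \<comment> \<open>the weights agree with \<open>k\<close> for \<open>k \<ge> k0\<close>, where the claim is made\<close>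
  define w where "w i = real (max i k0)" for i
  define E where "E i \<omega> = 1 / w i * D i \<omega>" for i \<omega>
  have w: "0 < w i" for i using k0 by (simp add: w_def)
  have "mono w" by (auto simp: mono_def w_def)
  have "directed_martingale_differences M N E"
    using md martingale_differences_scale[of M N D "\<lambda>i. 1 / w i"]
      martingale_differences_scale[of M N "\<lambda>i. D (N - Suc i)" "\<lambda>i. 1 / w (N - Suc i)"]
    by (auto simp: directed_martingale_differences_def E_def[abs_def])
  then obtain G where G: "sq_integrable M G" "\<And>\<omega> k. k \<le> N \<Longrightarrow> \<bar>\<Sum>i<k. E i \<omega>\<bar> \<le> G \<omega>"
    "(\<integral>\<omega>. (G \<omega>)\<^sup>2 \<partial>M) \<le> 16 * (\<Sum>i<N. \<integral>\<omega>. (E i \<omega>)\<^sup>2 \<partial>M)"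
    using directed_maximal by blast
  have G0: "0 \<le> G \<omega>" for \<omega> using G(2)[of 0 \<omega>] by simp
  have "\<bar>\<Sum>i<k. D i \<omega>\<bar> \<le> real k * (0 + 2 * G \<omega>)" if "k \<in> {k0..N}" for k \<omega>
  proof -
    have "w i * E i \<omega> = D i \<omega>" for i using w[of i] by (simp add: E_def)
    then have "\<bar>\<Sum>i<k. D i \<omega>\<bar> \<le> 2 * w k * G \<omega>"
      using abel_bound[of w k "\<lambda>i. E i \<omega>" "G \<omega>"] \<open>mono w\<close> w G(2) that
      by (auto simp: less_imp_le)
    also have "w k = real k" using that by (simp add: w_def)
    finally show ?thesis by simp
  qed
  moreover have "(\<integral>\<omega>. (2 * G \<omega>)\<^sup>2 \<partial>M) \<le> 192 * s / real k0"
  proof -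
    have "(\<Sum>i<N. \<integral>\<omega>. (E i \<omega>)\<^sup>2 \<partial>M) \<le> (\<Sum>i<N. 1 / (w i)\<^sup>2 * s)"
    proof (rule sum_mono)
      fix i assume "i \<in> {..<N}"
      then have "1 / (w i)\<^sup>2 * (\<integral>\<omega>. (D i \<omega>)\<^sup>2 \<partial>M) \<le> 1 / (w i)\<^sup>2 * s"
        using assms(2) by (intro mult_left_mono) auto
      then show "(\<integral>\<omega>. (E i \<omega>)\<^sup>2 \<partial>M) \<le> 1 / (w i)\<^sup>2 * s"
        by (simp add: E_def power_mult_distrib power_divide)
    qed
    also have "\<dots> = (\<Sum>i<N. 1 / (w i)\<^sup>2) * s" by (simp add: sum_distrib_right)
    also have "\<dots> \<le> 3 / real k0 * s"
      unfolding w_def using sum_inverse_squares_bound[OF k0] \<open>0 \<le> s\<close> by (intro mult_right_mono)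
    finally show ?thesis using G(3) by (simp add: power_mult_distrib)
  qed
  ultimately show ?thesis
    using G0 sq_integrable_cmult[OF G(1), of 2]
    unfolding ratio_bounded_def by (intro exI[of _ "\<lambda>\<omega>. 2 * G \<omega>"]) auto
qed

lemma (in finite_measure) ratio_bounded_tail:
  assumes "ratio_bounded M K f b s" "0 < r" 
  shows "measure M {\<omega> \<in> space M. \<exists>k\<in>K. \<bar>f k \<omega>\<bar> > real k * (b + r)} \<le> s / r\<^sup>2"
proof -
  obtain G where G: "sq_integrable M G" "\<forall>\<omega>. 0 \<le> G \<omega>"
    "\<And>\<omega> k. k \<in> K \<Longrightarrow> \<bar>f k \<omega>\<bar> \<le> real k * (b + G \<omega>)" "(\<integral>\<omega>. (G \<omega>)\<^sup>2 \<partial>M) \<le> s"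
    using assms(1) unfolding ratio_bounded_def by blast
  have [measurable]: "G \<in> borel_measurable M" using G(1) by (rule sq_integrable_measurable)
  have "r \<le> G \<omega>" if "k \<in> K" "\<bar>f k \<omega>\<bar> > real k * (b + r)" for k \<omega>
  proof -
    have "real k * (b + r) < real k * (b + G \<omega>)"
      using G(3)[OF that(1), of \<omega>] that(2) by linarith
    then have "b + r < b + G \<omega>" by (rule mult_left_less_imp_less) simp
    then show ?thesis by simp
  qed
  then have "r\<^sup>2 \<le> (G \<omega>)\<^sup>2" if "k \<in> K" "\<bar>f k \<omega>\<bar> > real k * (b + r)" for k \<omega>
    using that assms(2) by (intro power_mono) auto
  then have "measure M {\<omega> \<in> space M. \<exists>k\<in>K. \<bar>f k \<omega>\<bar> > real k * (b + r)}
      \<le> measure M {\<omega> \<in> space M. (G \<omega>)\<^sup>2 \<ge> r\<^sup>2}"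
    by (intro finite_measure_mono) auto
  also have "\<dots> \<le> (\<integral>\<omega>. (G \<omega>)\<^sup>2 \<partial>M) / r\<^sup>2"
    using G(1) assms(2) by (intro integral_Markov_inequality_measure[where A="{}"]) (auto simp: sq_integrable_def)
  also have "\<dots> \<le> s / r\<^sup>2" using G(4) by (intro divide_right_mono) auto
  finally show ?thesis .
qed

section \<open>Independent noise\<close>

locale iid_noise = prob_space M for M :: "'a measure" +
  fixes \<eta> :: "nat \<Rightarrow> int \<Rightarrow> 'a \<Rightarrow> real" and \<kappa> :: real
  assumes indep: "indep_vars (\<lambda>_. borel) (\<lambda>(k, t). \<eta> k t) UNIV"
    and mean_zero: "\<And>k t. expectation (\<eta> k t) = 0"
    and unit_second_moment: "\<And>k t. expectation (\<lambda>\<omega>. (\<eta> k t \<omega>)\<^sup>2) = 1"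
    and fourth_integrable: "\<And>k t. integrable M (\<lambda>\<omega>. \<eta> k t \<omega> ^ 4)"
    and fourth_moment: "\<And>k t. expectation (\<lambda>\<omega>. \<eta> k t \<omega> ^ 4) \<le> \<kappa>"
begin

lemma noise_measurable [measurable]: "\<eta> k t \<in> borel_measurable M"
  using indep unfolding indep_vars_def2 by auto

lemma square_sq_integrable: "sq_integrable M (\<lambda>\<omega>. (\<eta> k t \<omega>)\<^sup>2)"
  using fourth_integrable[of k t] by (simp add: sq_integrable_def power_mult[symmetric])

lemma noise_sq_integrable: "sq_integrable M (\<eta> k t)"
  using sq_integrable_integrable[OF square_sq_integrable[of k t]] by (simp add: sq_integrable_def)

lemma noise_integrable: "integrable M (\<eta> k t)"
  by (rule sq_integrable_integrable[OF noise_sq_integrable])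

lemma kurtosis_ge_1: "1 \<le> \<kappa>"
proof -
  have *: "(x\<^sup>2 - 1)\<^sup>2 = x ^ 4 - 2 * x\<^sup>2 + 1" for x :: real by algebra
  have "0 \<le> expectation (\<lambda>\<omega>. ((\<eta> 0 0 \<omega>)\<^sup>2 - 1)\<^sup>2)" by simp
  also have "\<dots> = expectation (\<lambda>\<omega>. \<eta> 0 0 \<omega> ^ 4 - 2 * (\<eta> 0 0 \<omega>)\<^sup>2 + 1)"
    unfolding * ..
  also have "\<dots> = expectation (\<lambda>\<omega>. \<eta> 0 0 \<omega> ^ 4) - 1"
    using fourth_integrable noise_sq_integrable unit_second_moment
    by (simp add: sq_integrable_def prob_space)
  finally show ?thesis using fourth_moment[of 0 0] by linarith
qed

text \<open>The information carried by the innovations with (coordinate, time) in \<open>I\<close>.\<close>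

definition info :: "(nat \<times> int) set \<Rightarrow> 'a measure" where
  "info I = sigma (space M) (\<Union>(k, t)\<in>I. {\<eta> k t -` B \<inter> space M | B. B \<in> sets borel})"

lemma space_info [simp]: "space (info I) = space M"
  by (simp add: info_def space_measure_of_conv)

lemma sets_info: "sets (info I) = sigma_sets (space M) (\<Union>(k, t)\<in>I. {\<eta> k t -` B \<inter> space M | B. B \<in> sets borel})"
  unfolding info_def by (rule sets_measure_of) auto

lemma subalgebra_info: "subalgebra M (info I)"
proof -
  have "(\<Union>(k, t)\<in>I. {\<eta> k t -` B \<inter> space M | B. B \<in> sets borel}) \<subseteq> sets M"
    by auto
  then show ?thesis
    unfolding subalgebra_def sets_info by (simp add: sets.sigma_sets_subset)
qed

lemma measurable_info: "g \<in> borel_measurable (info I) \<Longrightarrow> g \<in> borel_measurable M"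
  using subalgebra_info measurable_from_subalg by blast

lemma info_mono: "I \<subseteq> J \<Longrightarrow> g \<in> borel_measurable (info I) \<Longrightarrow> g \<in> borel_measurable (info J)"
proof (rule measurable_from_subalg[of "info J" "info I"])
  assume "I \<subseteq> J"
  then show "subalgebra (info J) (info I)"
    unfolding subalgebra_def sets_info by (intro conjI sigma_sets_mono' UN_mono) auto
qed

lemma noise_measurable_info: "(k, t) \<in> I \<Longrightarrow> \<eta> k t \<in> borel_measurable (info I)"
proof (rule measurableI)
  fix B :: "real set" assume "(k, t) \<in> I" "B \<in> sets borel"
  then show "\<eta> k t -` B \<inter> space (info I) \<in> sets (info I)"
    unfolding sets_info space_info by (intro sigma_sets.Basic UN_I[of "(k, t)"]) auto
qed simp

text \<open>Independence enters all later arguments only through this product rule.\<close>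

lemma expectation_mult_info:
  fixes f :: "real \<Rightarrow> real" and g :: "'a \<Rightarrow> real"
  assumes "(k, t) \<notin> I" and [measurable]: "f \<in> borel_measurable borel"
    and f_int: "integrable M (\<lambda>\<omega>. f (\<eta> k t \<omega>))"
    and g: "g \<in> borel_measurable (info I)" and g_int: "integrable M g"
  shows "integrable M (\<lambda>\<omega>. f (\<eta> k t \<omega>) * g \<omega>)"
    and "expectation (\<lambda>\<omega>. f (\<eta> k t \<omega>) * g \<omega>) = expectation (\<lambda>\<omega>. f (\<eta> k t \<omega>)) * expectation g"
proof -
  define E where "E = (\<lambda>(k, t). {\<eta> k t -` B \<inter> space M | B. B \<in> sets borel})"
  define L where "L = case_bool {(k, t)} I"
  have "indep_sets (\<lambda>j. sigma_sets (space M) (\<Union>i\<in>L j. E i)) (UNIV :: bool set)"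
  proof (rule indep_sets_collect_sigma)
    have "indep_sets E UNIV"
      using indep unfolding indep_vars_def2 E_def by (auto simp: case_prod_unfold)
    then show "indep_sets E (\<Union>j\<in>UNIV. L j)"
      by (rule indep_sets_mono_index[rotated]) simp
    show "Int_stable (E i)" for i
    proof (cases i)
      case (Pair a b)
      have "\<exists>S. (\<eta> a b -` A \<inter> space M) \<inter> (\<eta> a b -` B \<inter> space M) = \<eta> a b -` S \<inter> space M \<and>
          S \<in> sets borel" if "A \<in> sets borel" "B \<in> sets borel" for A B
        using that by (intro exI[of _ "A \<inter> B"]) auto
      then show ?thesis unfolding Pair E_def Int_stable_def by auto
    qed
    show "disjoint_family_on L UNIV"
      using assms(1) by (auto simp: disjoint_family_on_def L_def split: bool.split)
  qed
  then have indep2: "indep_set (sigma_sets (space M) (E (k, t))) (sets (info I))"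
    unfolding indep_set_def
    by (rule indep_sets_mono_sets) (auto split: bool.split simp: L_def sets_info E_def)
  have "indep_var borel (\<lambda>\<omega>. f (\<eta> k t \<omega>)) borel g"
    unfolding indep_var_eq
  proof (intro conjI)
    show "random_variable borel g" using g by (rule measurable_info)
    have 1: "sigma_sets (space M) {(\<lambda>\<omega>. f (\<eta> k t \<omega>)) -` A \<inter> space M | A. A \<in> sets borel}
        \<subseteq> sigma_sets (space M) (E (k, t))"
    proof (rule sigma_sets_mono')
      show "{(\<lambda>\<omega>. f (\<eta> k t \<omega>)) -` A \<inter> space M | A. A \<in> sets borel} \<subseteq> E (k, t)"
      proof
        fix S assume "S \<in> {(\<lambda>\<omega>. f (\<eta> k t \<omega>)) -` A \<inter> space M | A. A \<in> sets borel}"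
        then obtain A where A: "A \<in> sets borel" "S = (\<lambda>\<omega>. f (\<eta> k t \<omega>)) -` A \<inter> space M" by blast
        have "S = \<eta> k t -` (f -` A) \<inter> space M" using A(2) by auto
        moreover have "f -` A \<in> sets borel"
          using A(1) measurable_sets[of f borel borel A] assms(2) by simp
        ultimately show "S \<in> E (k, t)" by (auto simp: E_def)
      qed
    qed
    have 2: "sigma_sets (space M) {g -` A \<inter> space M | A. A \<in> sets borel} \<subseteq> sets (info I)"
    proof -
      have "{g -` A \<inter> space M | A. A \<in> sets borel} \<subseteq> sets (info I)"
        using measurable_sets[OF g] by auto
      then show ?thesis using sets.sigma_sets_subset[of _ "info I"] by simp
    qed
    show "indep_set (sigma_sets (space M) {(\<lambda>\<omega>. f (\<eta> k t \<omega>)) -` A \<inter> space M | A. A \<in> sets borel})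
        (sigma_sets (space M) {g -` A \<inter> space M | A. A \<in> sets borel})"
      using indep2 1 2 unfolding indep_sets2_eq by blast
  qed measurable
  from indep_var_integrable[OF this f_int g_int] indep_var_lebesgue_integral[OF this f_int g_int]
  show "integrable M (\<lambda>\<omega>. f (\<eta> k t \<omega>) * g \<omega>)"
    "expectation (\<lambda>\<omega>. f (\<eta> k t \<omega>) * g \<omega>) = expectation (\<lambda>\<omega>. f (\<eta> k t \<omega>)) * expectation g"
    by auto
qed

text \<open>When the coordinates are added one after the other, each new term is orthogonal to the sum of
  the previous ones, because the other factors do not involve the new innovation.\<close>

lemma increment_second_moment:
  assumes f: "f \<in> borel_measurable borel" "\<And>l. sq_integrable M (\<lambda>\<omega>. f (\<eta> l t \<omega>))"
    "\<And>l. expectation (\<lambda>\<omega>. f (\<eta> l t \<omega>)) = 0" "\<And>l. expectation (\<lambda>\<omega>. (f (\<eta> l t \<omega>))\<^sup>2) \<le> v"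
    and G: "\<And>l. l < d \<Longrightarrow> G l \<in> borel_measurable (info I)" "\<And>l. l < d \<Longrightarrow> sq_integrable M (G l)"
    and I: "\<And>l. (l, t) \<notin> I"
  shows "sq_integrable M (\<lambda>\<omega>. \<Sum>l<d. f (\<eta> l t \<omega>) * G l \<omega>)"
    and "expectation (\<lambda>\<omega>. (\<Sum>l<d. f (\<eta> l t \<omega>) * G l \<omega>)\<^sup>2) \<le> v * (\<Sum>l<d. expectation (\<lambda>\<omega>. (G l \<omega>)\<^sup>2))"
proof -
  have [measurable]: "f \<in> borel_measurable borel" by (rule f)
  have summand: "sq_integrable M (\<lambda>\<omega>. f (\<eta> l t \<omega>) * G l \<omega>)"
    "expectation (\<lambda>\<omega>. (f (\<eta> l t \<omega>) * G l \<omega>)\<^sup>2) \<le> v * expectation (\<lambda>\<omega>. (G l \<omega>)\<^sup>2)" if "l < d" for l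
  proof -
    have m: "(\<lambda>\<omega>. (G l \<omega>)\<^sup>2) \<in> borel_measurable (info I)" "integrable M (\<lambda>\<omega>. (G l \<omega>)\<^sup>2)"
      "(\<lambda>x. (f x)\<^sup>2) \<in> borel_measurable borel" "integrable M (\<lambda>\<omega>. (f (\<eta> l t \<omega>))\<^sup>2)"
      using G[OF that] f(2)[of l] by (auto simp: sq_integrable_def)
    note * = expectation_mult_info[OF I m(3,4,1,2)]
    show "sq_integrable M (\<lambda>\<omega>. f (\<eta> l t \<omega>) * G l \<omega>)"
      unfolding sq_integrable_def power_mult_distrib
    proof (rule conjI[OF _ *(1)])
      have [measurable]: "G l \<in> borel_measurable M" using G(1)[OF that] by (rule measurable_info)
      show "(\<lambda>\<omega>. f (\<eta> l t \<omega>) * G l \<omega>) \<in> borel_measurable M" by measurable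
    qed
    show "expectation (\<lambda>\<omega>. (f (\<eta> l t \<omega>) * G l \<omega>)\<^sup>2) \<le> v * expectation (\<lambda>\<omega>. (G l \<omega>)\<^sup>2)"
      unfolding power_mult_distrib *(2) using f(4)[of l] by (intro mult_right_mono) auto
  qed
  have "sq_integrable M (\<lambda>\<omega>. \<Sum>l<m. f (\<eta> l t \<omega>) * G l \<omega>) \<and>
    expectation (\<lambda>\<omega>. (\<Sum>l<m. f (\<eta> l t \<omega>) * G l \<omega>)\<^sup>2) \<le> v * (\<Sum>l<m. expectation (\<lambda>\<omega>. (G l \<omega>)\<^sup>2))"
    if "m \<le> d" for m
    using that
  proof (induction m)
    case 0
    then show ?case by simp
  next
    case (Suc m)
    define S where "S \<omega> = (\<Sum>l<m. f (\<eta> l t \<omega>) * G l \<omega>)" for \<omega>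
    define T where "T \<omega> = f (\<eta> m t \<omega>) * G m \<omega>" for \<omega>
    have S: "sq_integrable M S" "expectation (\<lambda>\<omega>. (S \<omega>)\<^sup>2) \<le> v * (\<Sum>l<m. expectation (\<lambda>\<omega>. (G l \<omega>)\<^sup>2))"
      using Suc by (auto simp: S_def[abs_def])
    have T: "sq_integrable M T" "expectation (\<lambda>\<omega>. (T \<omega>)\<^sup>2) \<le> v * expectation (\<lambda>\<omega>. (G m \<omega>)\<^sup>2)"
      using summand[of m] Suc.prems by (auto simp: T_def[abs_def])
    \<comment> \<open>the coordinates already added count as information for the next one\<close>
    define J where "J = I \<union> {(l, t) | l. l < m}"
    have G_J: "G l \<in> borel_measurable (info J)" if "l < d" for l
      using info_mono[OF _ G(1)[OF that]] by (simp add: J_def)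
    have \<eta>_J: "\<eta> l t \<in> borel_measurable (info J)" if "l < m" for l
      using that by (intro noise_measurable_info) (simp add: J_def)
    have "S \<in> borel_measurable (info J)"
      unfolding S_def[abs_def] using G_J \<eta>_J Suc.prems
      by (intro borel_measurable_sum borel_measurable_times measurable_compose[OF _ f(1)]) auto
    then have SG: "(\<lambda>\<omega>. G m \<omega> * S \<omega>) \<in> borel_measurable (info J)"
      using G_J[of m] Suc.prems by (intro borel_measurable_times) auto
    have "expectation (\<lambda>\<omega>. T \<omega> * S \<omega>) = expectation (\<lambda>\<omega>. f (\<eta> m t \<omega>) * (G m \<omega> * S \<omega>))"
      by (simp add: T_def mult.assoc)
    also have "\<dots> = expectation (\<lambda>\<omega>. f (\<eta> m t \<omega>)) * expectation (\<lambda>\<omega>. G m \<omega> * S \<omega>)"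
    proof (rule expectation_mult_info[OF _ f(1) _ SG])
      show "(m, t) \<notin> J" using I by (simp add: J_def)
      show "integrable M (\<lambda>\<omega>. G m \<omega> * S \<omega>)"
        using G(2)[of m] S(1) Suc.prems by (intro sq_integrable_mult) auto
    qed (rule sq_integrable_integrable[OF f(2)])
    finally have cross: "expectation (\<lambda>\<omega>. T \<omega> * S \<omega>) = 0" by (simp add: f(3))
    have "expectation (\<lambda>\<omega>. (S \<omega> + T \<omega>)\<^sup>2) = expectation (\<lambda>\<omega>. (S \<omega>)\<^sup>2 + (T \<omega>)\<^sup>2 + 2 * (T \<omega> * S \<omega>))"
      by (simp add: power2_sum algebra_simps)
    also have "\<dots> = expectation (\<lambda>\<omega>. (S \<omega>)\<^sup>2) + expectation (\<lambda>\<omega>. (T \<omega>)\<^sup>2)"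
      using S(1) T(1) sq_integrable_mult[OF T(1) S(1)] cross by (simp add: sq_integrable_def)
    finally show ?case
      using S T sq_integrable_add[OF S(1) T(1)] by (simp add: S_def T_def algebra_simps)
  qed
  then show "sq_integrable M (\<lambda>\<omega>. \<Sum>l<d. f (\<eta> l t \<omega>) * G l \<omega>)"
    "expectation (\<lambda>\<omega>. (\<Sum>l<d. f (\<eta> l t \<omega>) * G l \<omega>)\<^sup>2) \<le> v * (\<Sum>l<d. expectation (\<lambda>\<omega>. (G l \<omega>)\<^sup>2))"
    by auto
qed

text \<open>The past at step \<open>i\<close> consists of all innovations at times other than \<open>u i\<close>, \<open>u (i + 1)\<close>, ..., so it
  includes times that are not enumerated at all, and no order on the times is involved. The
  function \<open>f\<close> is the identity for linear and off-diagonal terms and \<open>x\<^sup>2 - 1\<close> for the diagonal.\<close>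

lemma martingale_differences_increments:
  assumes f: "f \<in> borel_measurable borel" "\<And>l t. sq_integrable M (\<lambda>\<omega>. f (\<eta> l t \<omega>))"
    "\<And>l t. expectation (\<lambda>\<omega>. f (\<eta> l t \<omega>)) = 0"
    "\<And>l t. expectation (\<lambda>\<omega>. (f (\<eta> l t \<omega>))\<^sup>2) \<le> v"
    and u: "inj_on u {..<N}"
    and G: "\<And>i l. i < N \<Longrightarrow> l < d \<Longrightarrow> G i l \<in> borel_measurable (info (UNIV \<times> (- u ` {i..<N})))"
      "\<And>i l. i < N \<Longrightarrow> l < d \<Longrightarrow> sq_integrable M (G i l)"
  shows "martingale_differences M N (\<lambda>i \<omega>. \<Sum>l<d. f (\<eta> l (u i) \<omega>) * G i l \<omega>)"
  unfolding martingale_differences_def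
proof (intro conjI exI[of _ "\<lambda>i. info (UNIV \<times> (- u ` {i..<N}))"] allI impI ballI)
  have out: "(l, u i) \<notin> UNIV \<times> (- u ` {i..<N})" if "i < N" for i l
    using that by auto
  show "sq_integrable M (\<lambda>\<omega>. \<Sum>l<d. f (\<eta> l (u i) \<omega>) * G i l \<omega>)" if "i < N" for i
    using that by (intro increment_second_moment(1)[OF f(1,2,3,4) G(1,2) out]) auto
  show "subalgebra M (info (UNIV \<times> (- u ` {i..<N})))" for i by (rule subalgebra_info)
  show "(\<lambda>\<omega>. \<Sum>l<d. f (\<eta> l (u j) \<omega>) * G j l \<omega>) \<in> borel_measurable (info (UNIV \<times> (- u ` {i..<N})))"
    if "i \<le> N" "j < i" for i j
  proof (intro borel_measurable_sum borel_measurable_times measurable_compose[OF _ f(1)])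
    fix l assume "l \<in> {..<d}"
    have "u j \<noteq> u x" if "x \<in> {i..<N}" for x
      using inj_onD[OF u, of j x] that \<open>i \<le> N\<close> \<open>j < i\<close> by auto
    then have "u j \<notin> u ` {i..<N}" by force
    then show "\<eta> l (u j) \<in> borel_measurable (info (UNIV \<times> (- u ` {i..<N})))"
      by (intro noise_measurable_info) auto
    have "UNIV \<times> (- u ` {j..<N}) \<subseteq> UNIV \<times> (- u ` {i..<N})" using that by auto
    then show "G j l \<in> borel_measurable (info (UNIV \<times> (- u ` {i..<N})))"
      using G(1)[of j l] that \<open>l \<in> {..<d}\<close> by (auto intro: info_mono)
  qed
  fix i g assume i: "i < N" and g: "g \<in> borel_measurable (info (UNIV \<times> (- u ` {i..<N})))" "sq_integrable M g"
  have *: "integrable M (\<lambda>\<omega>. f (\<eta> l (u i) \<omega>) * (G i l \<omega> * g \<omega>))"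
    "expectation (\<lambda>\<omega>. f (\<eta> l (u i) \<omega>) * (G i l \<omega> * g \<omega>)) = 0" if "l < d" for l
    using expectation_mult_info[OF out[OF i] f(1) sq_integrable_integrable[OF f(2)]
        borel_measurable_times[OF G(1)[OF i that] g(1)] sq_integrable_mult[OF G(2)[OF i that] g(2)]]
    by (simp_all add: f(3))
  have "expectation (\<lambda>\<omega>. (\<Sum>l<d. f (\<eta> l (u i) \<omega>) * G i l \<omega>) * g \<omega>)
      = expectation (\<lambda>\<omega>. \<Sum>l<d. f (\<eta> l (u i) \<omega>) * (G i l \<omega> * g \<omega>))"
    by (simp add: sum_distrib_right mult.assoc)
  also have "\<dots> = 0" using * by (subst Bochner_Integration.integral_sum) auto
  finally show "expectation (\<lambda>\<omega>. (\<Sum>l<d. f (\<eta> l (u i) \<omega>) * G i l \<omega>) * g \<omega>) = 0" .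
qed

subsection \<open>Linear and bilinear forms in the noise\<close>

lemma expectation_noise_mult:
  "expectation (\<lambda>\<omega>. \<eta> k t \<omega> * \<eta> l s \<omega>) = (if (k, t) = (l, s) then 1 else 0)"
proof (cases "(k, t) = (l, s)")
  case True
  then show ?thesis using unit_second_moment[of k t] by (simp add: power2_eq_square)
next
  case False
  then have "expectation (\<lambda>\<omega>. \<eta> k t \<omega> * \<eta> l s \<omega>) = expectation (\<eta> k t) * expectation (\<eta> l s)"
    using expectation_mult_info(2)[of k t "{(l, s)}" "\<lambda>x. x" "\<eta> l s"] noise_integrable
      noise_measurable_info[of l s "{(l, s)}"] by simp
  then show ?thesis using False by (auto simp: mean_zero)
qed

lemma linear_form_second_moment:
  assumes "finite S"
  shows "sq_integrable M (\<lambda>\<omega>. \<Sum>(l, t)\<in>S. c l t * \<eta> l t \<omega>)"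
    and "expectation (\<lambda>\<omega>. (\<Sum>(l, t)\<in>S. c l t * \<eta> l t \<omega>)\<^sup>2) = (\<Sum>(l, t)\<in>S. (c l t)\<^sup>2)"
proof -
  show "sq_integrable M (\<lambda>\<omega>. \<Sum>(l, t)\<in>S. c l t * \<eta> l t \<omega>)"
    using noise_sq_integrable by (auto intro!: sq_integrable_sum sq_integrable_cmult)
  have "expectation (\<lambda>\<omega>. (\<Sum>(l, t)\<in>S. c l t * \<eta> l t \<omega>)\<^sup>2)
      = expectation (\<lambda>\<omega>. \<Sum>(l, t)\<in>S. \<Sum>(k, s)\<in>S. c l t * c k s * (\<eta> l t \<omega> * \<eta> k s \<omega>))"
    by (simp add: power2_eq_square sum_product case_prod_unfold mult.assoc mult.left_commute)
  also have "\<dots> = (\<Sum>(l, t)\<in>S. \<Sum>(k, s)\<in>S. c l t * c k s * expectation (\<lambda>\<omega>. \<eta> l t \<omega> * \<eta> k s \<omega>))"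
    using sq_integrable_mult[OF noise_sq_integrable noise_sq_integrable]
    by (simp add: case_prod_unfold)
  also have "\<dots> = (\<Sum>(l, t)\<in>S. (c l t)\<^sup>2)"
  proof (rule sum.cong[OF refl])
    fix x assume x: "x \<in> S"
    have "(\<Sum>y\<in>S. c (fst x) (snd x) * c (fst y) (snd y) * expectation (\<lambda>\<omega>. \<eta> (fst x) (snd x) \<omega> * \<eta> (fst y) (snd y) \<omega>))
        = (\<Sum>y\<in>S. if y = x then (c (fst x) (snd x))\<^sup>2 else 0)"
      by (intro sum.cong) (auto simp: expectation_noise_mult power2_eq_square prod_eq_iff)
    then show "(case x of (l, t) \<Rightarrow> \<Sum>(k, s)\<in>S. c l t * c k s * expectation (\<lambda>\<omega>. \<eta> l t \<omega> * \<eta> k s \<omega>))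
        = (case x of (l, t) \<Rightarrow> (c l t)\<^sup>2)"
      using x assms by (simp add: case_prod_unfold)
  qed
  finally show "expectation (\<lambda>\<omega>. (\<Sum>(l, t)\<in>S. c l t * \<eta> l t \<omega>)\<^sup>2) = (\<Sum>(l, t)\<in>S. (c l t)\<^sup>2)" .
qed

lemma window_form_second_moment:
  assumes "finite V"
  shows "sq_integrable M (\<lambda>\<omega>. \<Sum>l<d. c l * (\<Sum>v\<in>V. \<eta> l v \<omega>))"
    and "expectation (\<lambda>\<omega>. (\<Sum>l<d. c l * (\<Sum>v\<in>V. \<eta> l v \<omega>))\<^sup>2) = real (card V) * (\<Sum>l<d. (c l)\<^sup>2)"
proof -
  have eq: "(\<Sum>l<d. c l * (\<Sum>v\<in>V. \<eta> l v \<omega>)) = (\<Sum>(l, v)\<in>{..<d} \<times> V. c l * \<eta> l v \<omega>)" for \<omega>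
    by (simp add: sum.cartesian_product sum_distrib_left)
  have fin: "finite ({..<d} \<times> V)" using assms by simp
  show "sq_integrable M (\<lambda>\<omega>. \<Sum>l<d. c l * (\<Sum>v\<in>V. \<eta> l v \<omega>))"
    unfolding eq by (rule linear_form_second_moment[OF fin])
  have "(\<Sum>(l, v)\<in>{..<d} \<times> V. (c l)\<^sup>2) = real (card V) * (\<Sum>l<d. (c l)\<^sup>2)"
    by (simp add: sum.cartesian_product[symmetric] sum_distrib_left)
  then show "expectation (\<lambda>\<omega>. (\<Sum>l<d. c l * (\<Sum>v\<in>V. \<eta> l v \<omega>))\<^sup>2) = real (card V) * (\<Sum>l<d. (c l)\<^sup>2)"
    unfolding eq using linear_form_second_moment(2)[OF fin, of "\<lambda>l _. c l"] by simp
qed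

lemma linear_ratio_bounded:
  assumes u: "inj_on u {..<N}" and "1 \<le> k0"
  shows "ratio_bounded M {k0..N} (\<lambda>k \<omega>. \<Sum>i<k. \<Sum>l<d. q l * \<eta> l (u i) \<omega>) 0 (192 * (\<Sum>l<d. (q l)\<^sup>2) / real k0)"
proof (rule hajek_renyi)
  have "martingale_differences M N (\<lambda>i \<omega>. \<Sum>l<d. \<eta> l (u i) \<omega> * q l)"
    by (rule martingale_differences_increments[where f = "\<lambda>x. x" and v = 1])
       (use u in \<open>auto simp: noise_sq_integrable mean_zero unit_second_moment sq_integrable_const\<close>)
  then show "directed_martingale_differences M N (\<lambda>i \<omega>. \<Sum>l<d. q l * \<eta> l (u i) \<omega>)"
    by (simp add: directed_martingale_differences_def mult.commute)
  show "expectation (\<lambda>\<omega>. (\<Sum>l<d. q l * \<eta> l (u i) \<omega>)\<^sup>2) \<le> (\<Sum>l<d. (q l)\<^sup>2)" for i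
    using window_form_second_moment(2)[of "{u i}" q d] by simp
qed (use \<open>1 \<le> k0\<close> in \<open>auto intro: sum_nonneg\<close>)

text \<open>The terms \<open>\<eta>\<^sup>2 - 1\<close> are independent and centred, with variance bounded by the fourth
  moment; their mean 1 becomes the offset \<open>d\<close>.\<close>

lemma diagonal_ratio_bounded:
  assumes u: "inj_on u {..<N}" and "1 \<le> k0"
  shows "ratio_bounded M {k0..N} (\<lambda>k \<omega>. \<Sum>i<k. \<Sum>l<d. (\<eta> l (u i) \<omega>)\<^sup>2) (real d) (192 * (\<kappa> * real d) / real k0)"
proof -
  define f :: "real \<Rightarrow> real" where "f x = x\<^sup>2 - 1" for x
  have f: "f \<in> borel_measurable borel" "sq_integrable M (\<lambda>\<omega>. f (\<eta> l t \<omega>))"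
    "expectation (\<lambda>\<omega>. f (\<eta> l t \<omega>)) = 0" "expectation (\<lambda>\<omega>. (f (\<eta> l t \<omega>))\<^sup>2) \<le> \<kappa>" for l t
  proof -
    show "f \<in> borel_measurable borel" by (simp add: f_def[abs_def])
    show "sq_integrable M (\<lambda>\<omega>. f (\<eta> l t \<omega>))"
      using sq_integrable_add[OF square_sq_integrable sq_integrable_const[of "-1"]] by (simp add: f_def)
    show "expectation (\<lambda>\<omega>. f (\<eta> l t \<omega>)) = 0"
      using noise_sq_integrable[of l t] by (simp add: f_def unit_second_moment sq_integrable_def prob_space)
    have *: "(f x)\<^sup>2 = x ^ 4 - 2 * x\<^sup>2 + 1" for x unfolding f_def by algebra
    have "expectation (\<lambda>\<omega>. (f (\<eta> l t \<omega>))\<^sup>2) = expectation (\<lambda>\<omega>. \<eta> l t \<omega> ^ 4) - 1"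
      unfolding * using fourth_integrable noise_sq_integrable[of l t] unit_second_moment
      by (simp add: sq_integrable_def prob_space)
    then show "expectation (\<lambda>\<omega>. (f (\<eta> l t \<omega>))\<^sup>2) \<le> \<kappa>" using fourth_moment[of l t] by simp
  qed
  define D where "D i \<omega> = (\<Sum>l<d. f (\<eta> l (u i) \<omega>) * 1)" for i \<omega>
  have "ratio_bounded M {k0..N} (\<lambda>k \<omega>. \<Sum>i<k. D i \<omega>) 0 (192 * (\<kappa> * real d) / real k0)"
  proof (rule hajek_renyi)
    have "martingale_differences M N D"
      unfolding D_def[abs_def]
      by (rule martingale_differences_increments[OF f u]) (auto simp: sq_integrable_const)
    then show "directed_martingale_differences M N D"
      by (simp add: directed_martingale_differences_def)
    show "expectation (\<lambda>\<omega>. (D i \<omega>)\<^sup>2) \<le> \<kappa> * real d" for i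
      using increment_second_moment(2)[OF f, where I = "{}" and d = d and G = "\<lambda>_ _. 1", of "u i"]
      by (simp add: D_def sq_integrable_const prob_space)
  qed (use \<open>1 \<le> k0\<close> kurtosis_ge_1 in auto)
  then have "ratio_bounded M {k0..N} (\<lambda>k \<omega>. \<Sum>i<k. \<Sum>l<d. (\<eta> l (u i) \<omega>)\<^sup>2) (0 + real d) (192 * (\<kappa> * real d) / real k0)"
  proof (rule ratio_bounded_perturb)
    fix k \<omega>
    have "(\<Sum>i<k. \<Sum>l<d. (\<eta> l (u i) \<omega>)\<^sup>2) = (\<Sum>i<k. D i \<omega>) + real k * real d"
      by (simp add: D_def f_def sum_subtractf)
    then show "\<bar>\<Sum>i<k. \<Sum>l<d. (\<eta> l (u i) \<omega>)\<^sup>2\<bar> \<le> \<bar>\<Sum>i<k. D i \<omega>\<bar> + real k * real d"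
      using abs_triangle_ineq[of "\<Sum>i<k. D i \<omega>" "real k * real d"] by simp
  qed simp
  then show ?thesis by simp
qed

text \<open>The strictly triangular part of a bilinear form: the innovation at time \<open>u i\<close> meets only
  innovations that are past for it.\<close>

lemma triangular_martingale_differences:
  assumes u: "inj_on u {..<N}" and V: "\<And>i. i < N \<Longrightarrow> finite (V i) \<and> V i \<subseteq> - u ` {i..<N}"
  shows "martingale_differences M N (\<lambda>i \<omega>. \<Sum>l<d. \<eta> l (u i) \<omega> * (\<Sum>l'<d. C l l' * (\<Sum>v\<in>V i. \<eta> l' v \<omega>)))"
proof (rule martingale_differences_increments[where f = "\<lambda>x. x" and v = 1])
  fix i l assume "i < N" "l < d"
  have "\<eta> l' v \<in> borel_measurable (info (UNIV \<times> (- u ` {i..<N})))" if "v \<in> V i" for l' v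
    using V[OF \<open>i < N\<close>] that by (intro noise_measurable_info) auto
  then show "(\<lambda>\<omega>. \<Sum>l'<d. C l l' * (\<Sum>v\<in>V i. \<eta> l' v \<omega>)) \<in> borel_measurable (info (UNIV \<times> (- u ` {i..<N})))"
    by (intro borel_measurable_sum borel_measurable_times borel_measurable_const)
  show "sq_integrable M (\<lambda>\<omega>. \<Sum>l'<d. C l l' * (\<Sum>v\<in>V i. \<eta> l' v \<omega>))"
    using V[OF \<open>i < N\<close>] by (intro window_form_second_moment) auto
qed (use u in \<open>auto simp: noise_sq_integrable mean_zero unit_second_moment\<close>)

text \<open>Each of the at most \<open>n\<close> partners \<open>v\<close> contributes the squared Frobenius norm of \<open>C\<close>. Using \<open>n\<close>
  here, rather than a number that grows with the block, is what makes the sum over all scales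
  converge.\<close>

lemma triangular_second_moment:
  assumes V: "finite V" "t \<notin> V" "card V \<le> n" and C: "(\<Sum>l<d. \<Sum>l'<d. (C l l')\<^sup>2) \<le> real d"
  shows "expectation (\<lambda>\<omega>. (\<Sum>l<d. \<eta> l t \<omega> * (\<Sum>l'<d. C l l' * (\<Sum>v\<in>V. \<eta> l' v \<omega>)))\<^sup>2) \<le> real n * real d"
proof -
  have "\<eta> l' v \<in> borel_measurable (info (UNIV \<times> V))" if "v \<in> V" for l' v
    using that by (intro noise_measurable_info) auto
  then have "(\<lambda>\<omega>. \<Sum>l'<d. C l l' * (\<Sum>v\<in>V. \<eta> l' v \<omega>)) \<in> borel_measurable (info (UNIV \<times> V))" for l
    by (intro borel_measurable_sum borel_measurable_times borel_measurable_const)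
  then have "expectation (\<lambda>\<omega>. (\<Sum>l<d. \<eta> l t \<omega> * (\<Sum>l'<d. C l l' * (\<Sum>v\<in>V. \<eta> l' v \<omega>)))\<^sup>2)
      \<le> 1 * (\<Sum>l<d. expectation (\<lambda>\<omega>. (\<Sum>l'<d. C l l' * (\<Sum>v\<in>V. \<eta> l' v \<omega>))\<^sup>2))"
    by (intro increment_second_moment(2)[where f = "\<lambda>x. x" and I = "UNIV \<times> V"])
       (use V in \<open>auto simp: noise_sq_integrable mean_zero unit_second_moment window_form_second_moment\<close>)
  also have "\<dots> = real (card V) * (\<Sum>l<d. \<Sum>l'<d. (C l l')\<^sup>2)"
    unfolding window_form_second_moment(2)[OF V(1)] mult_1 by (rule sum_distrib_left[symmetric])
  also have "\<dots> \<le> real n * real d"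
    using V C by (intro mult_mono) (auto intro!: sum_nonneg)
  finally show ?thesis .
qed

text \<open>The diagonal contributes 384 and the triangular parts 1536; 2000 serves both quadratic bounds
  since \<open>n\<close> and \<open>\<kappa>\<close> are at least 1.\<close>

lemma variance_constants:
  assumes "1 \<le> n"
  shows "384 * (\<kappa> * real d) + 1536 * (real n * real d) \<le> 2000 * (\<kappa> * (real n * real d))"
proof -
  have "\<kappa> * (1 * real d) \<le> \<kappa> * (real n * real d)"
    using kurtosis_ge_1 assms by (intro mult_left_mono mult_right_mono) auto
  moreover have "1 * (real n * real d) \<le> \<kappa> * (real n * real d)"
    using kurtosis_ge_1 by (intro mult_right_mono) auto
  moreover have "0 \<le> \<kappa> * (real n * real d)"
    using kurtosis_ge_1 by simp
  ultimately show ?thesis unfolding mult_1 by linarith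
qed

text \<open>The square is its diagonal plus twice the triangular sum in which each time meets the times
  enumerated before it.\<close>

lemma square_ratio_bounded:
  assumes u: "inj_on u {..<N}" and "1 \<le> k0" "N \<le> n" "1 \<le> n"
  shows "ratio_bounded M {k0..N} (\<lambda>k \<omega>. \<Sum>l<d. (\<Sum>i<k. \<eta> l (u i) \<omega>)\<^sup>2) (real d) (2000 * \<kappa> * real n * real d / real k0)"
proof -
  define I :: "nat \<Rightarrow> nat \<Rightarrow> real" where "I l l' = (if l' = l then 1 else 0)" for l l'
  define D where "D i \<omega> = (\<Sum>l<d. \<eta> l (u i) \<omega> * (\<Sum>l'<d. I l l' * (\<Sum>v\<in>u ` {..<i}. \<eta> l' v \<omega>)))" for i \<omega>
  have out: "u i \<notin> u ` {..<j}" if "j \<le> i" "i < N" for i j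
  proof
    assume "u i \<in> u ` {..<j}"
    then obtain x where "x < j" "u i = u x" by auto
    then show False using inj_onD[OF u, of i x] that by auto
  qed
  have "ratio_bounded M {k0..N} (\<lambda>k \<omega>. \<Sum>i<k. D i \<omega>) 0 (192 * (real n * real d) / real k0)"
  proof (rule hajek_renyi)
    have "martingale_differences M N D"
      unfolding D_def[abs_def]
    proof (rule triangular_martingale_differences[OF u])
      fix i assume "i < N"
      have "u x \<noteq> u y" if "x < i" "y \<in> {i..<N}" for x y
        using inj_onD[OF u, of x y] that by auto
      then show "finite (u ` {..<i}) \<and> u ` {..<i} \<subseteq> - u ` {i..<N}" by force
    qed
    then show "directed_martingale_differences M N D"
      by (simp add: directed_martingale_differences_def)
    show "expectation (\<lambda>\<omega>. (D i \<omega>)\<^sup>2) \<le> real n * real d" if "i < N" for i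
      unfolding D_def
    proof (rule triangular_second_moment)
      show "u i \<notin> u ` {..<i}" using out that by blast
      show "card (u ` {..<i}) \<le> n"
        using card_image_le[of "{..<i}" u] that \<open>N \<le> n\<close> by simp
      show "(\<Sum>l<d. \<Sum>l'<d. (I l l')\<^sup>2) \<le> real d"
        by (simp add: I_def if_distrib[of "\<lambda>x. x\<^sup>2"] cong: if_cong)
    qed simp
  qed (use \<open>1 \<le> k0\<close> in auto)
  from ratio_bounded_weighted_sum[of "{()}" "\<lambda>_. 2" M "{k0..N}" "\<lambda>_ k \<omega>. \<Sum>i<k. D i \<omega>", OF _ this]
  have "ratio_bounded M {k0..N} (\<lambda>k \<omega>. 2 * (\<Sum>i<k. D i \<omega>)) 0 (4 * (192 * (real n * real d) / real k0))"
    by simp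
  from ratio_bounded_add[OF diagonal_ratio_bounded[OF u \<open>1 \<le> k0\<close>, of d] this]
  have "ratio_bounded M {k0..N} (\<lambda>k \<omega>. \<Sum>l<d. (\<Sum>i<k. \<eta> l (u i) \<omega>)\<^sup>2) (real d + 0 + 0) (2000 * \<kappa> * real n * real d / real k0)"
  proof (rule ratio_bounded_perturb)
    fix k \<omega> assume k: "k \<in> {k0..N}"
    have D: "D i \<omega> = (\<Sum>l<d. \<eta> l (u i) \<omega> * (\<Sum>j<i. \<eta> l (u j) \<omega>))" if "i < k" for i
    proof -
      have "inj_on u {..<i}" using u that k by (auto intro: inj_on_subset)
      then have "(\<Sum>v\<in>u ` {..<i}. \<eta> l v \<omega>) = (\<Sum>j<i. \<eta> l (u j) \<omega>)" for l
        by (simp add: sum.reindex)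
      moreover have "(\<Sum>l'<d. I l l' * x l') = x l" if "l < d" for l and x :: "nat \<Rightarrow> real"
        using that by (simp add: I_def if_distrib[of "\<lambda>y. y * _"] cong: if_cong)
      ultimately show ?thesis by (simp add: D_def)
    qed
    have sq: "(\<Sum>i<m. x i)\<^sup>2 = (\<Sum>i<m. (x i)\<^sup>2) + 2 * (\<Sum>i<m. x i * (\<Sum>j<i. x j))" for x :: "nat \<Rightarrow> real" and m
      by (induction m) (simp_all add: power2_sum algebra_simps)
    have "(\<Sum>l<d. (\<Sum>i<k. \<eta> l (u i) \<omega>)\<^sup>2) = (\<Sum>i<k. \<Sum>l<d. (\<eta> l (u i) \<omega>)\<^sup>2) + 2 * (\<Sum>i<k. D i \<omega>)"
      unfolding sq by (simp add: sum.distrib sum_distrib_left[symmetric] D sum.swap[of _ "{..<k}"])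
    then show "\<bar>\<Sum>l<d. (\<Sum>i<k. \<eta> l (u i) \<omega>)\<^sup>2\<bar> \<le> \<bar>(\<Sum>i<k. \<Sum>l<d. (\<eta> l (u i) \<omega>)\<^sup>2) + 2 * (\<Sum>i<k. D i \<omega>)\<bar> + real k * 0"
      by simp
  next
    note constants = variance_constants[OF \<open>1 \<le> n\<close>, of d]
    show "2 * (192 * (\<kappa> * real d) / real k0) + 2 * (4 * (192 * (real n * real d) / real k0)) \<le> 2000 * \<kappa> * real n * real d / real k0"
      using constants divide_right_mono[OF constants, of "real k0"] by (simp add: add_divide_distrib mult_ac)
  qed
  then show ?thesis by simp
qed

text \<open>A window \<open>W\<close> that is unrelated to the block is split, for each \<open>i\<close>, into the times that are still
  to be enumerated, the time \<open>u i\<close> itself, and everything else. The last part yields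
  martingale differences in the given order and the first part in the reverse order.\<close>

lemma bilinear_ratio_bounded:
  assumes u: "inj_on u {..<N}" and "1 \<le> k0" "1 \<le> n" and W: "finite W" "card W \<le> n"
    and C: "(\<Sum>l<d. \<Sum>l'<d. (C l l')\<^sup>2) \<le> real d"
    and diag: "\<And>x. \<bar>\<Sum>l<d. x l * (\<Sum>l'<d. C l l' * x l')\<bar> \<le> (\<Sum>l<d. (x l)\<^sup>2)"
  shows "ratio_bounded M {k0..N}
    (\<lambda>k \<omega>. \<Sum>i<k. \<Sum>l<d. \<eta> l (u i) \<omega> * (\<Sum>l'<d. C l l' * (\<Sum>v\<in>W. \<eta> l' v \<omega>)))
    (real d) (2000 * \<kappa> * real n * real d / real k0)"
proof -
  define D where "D V i \<omega> = (\<Sum>l<d. \<eta> l (u i) \<omega> * (\<Sum>l'<d. C l l' * (\<Sum>v\<in>V i. \<eta> l' v \<omega>)))" for V i \<omega>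
  define past where "past i = W - u ` {i..<N}" for i
  define future where "future i = W \<inter> u ` {Suc i..<N}" for i
  define present where "present i = W \<inter> {u i}" for i
  have fin: "finite (past i)" "finite (future i)" "finite (present i)" for i
    using W by (auto simp: past_def future_def present_def)
  have card: "card (past i) \<le> n" "card (future i) \<le> n" for i
    using W card_mono[OF W(1), of "past i"] card_mono[OF W(1), of "future i"]
    by (auto simp: past_def future_def)
  have not_future: "u i \<notin> future i" if "i < N" for i
  proof
    assume "u i \<in> future i"
    then obtain x where "x \<in> {Suc i..<N}" "u i = u x" by (auto simp: future_def)
    then show False using inj_onD[OF u, of i x] that by auto
  qed
  have forward: "ratio_bounded M {k0..N} (\<lambda>k \<omega>. \<Sum>i<k. D past i \<omega>) 0 (192 * (real n * real d) / real k0)"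
  proof (rule hajek_renyi)
    have "martingale_differences M N (D past)"
      unfolding D_def[abs_def] using fin
      by (intro triangular_martingale_differences[OF u]) (auto simp: past_def)
    then show "directed_martingale_differences M N (D past)"
      by (simp add: directed_martingale_differences_def)
    show "expectation (\<lambda>\<omega>. (D past i \<omega>)\<^sup>2) \<le> real n * real d" if "i < N" for i
      unfolding D_def using fin card C that by (intro triangular_second_moment) (auto simp: past_def)
  qed (use \<open>1 \<le> k0\<close> in auto)
  have backward: "ratio_bounded M {k0..N} (\<lambda>k \<omega>. \<Sum>i<k. D future i \<omega>) 0 (192 * (real n * real d) / real k0)"
  proof (rule hajek_renyi)
    have "martingale_differences M N (\<lambda>i. D future (N - Suc i))"
      unfolding D_def[abs_def]
    proof (rule triangular_martingale_differences)
      show "inj_on (\<lambda>i. u (N - Suc i)) {..<N}"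
      proof (rule inj_onI)
        fix i j assume "i \<in> {..<N}" "j \<in> {..<N}" "u (N - Suc i) = u (N - Suc j)"
        then show "i = j" using inj_onD[OF u, of "N - Suc i" "N - Suc j"] by auto
      qed
      fix i assume i: "i < N"
      have "u x \<noteq> u (N - Suc j)" if "x \<in> {Suc (N - Suc i)..<N}" "j \<in> {i..<N}" for x j
        using inj_onD[OF u, of x "N - Suc j"] that i by auto
      then show "finite (future (N - Suc i)) \<and> future (N - Suc i) \<subseteq> - (\<lambda>i. u (N - Suc i)) ` {i..<N}"
        using fin by (force simp: future_def)
    qed
    then show "directed_martingale_differences M N (D future)"
      by (simp add: directed_martingale_differences_def)
    show "expectation (\<lambda>\<omega>. (D future i \<omega>)\<^sup>2) \<le> real n * real d" if "i < N" for i
      unfolding D_def using fin card C that not_future by (intro triangular_second_moment) auto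
  qed (use \<open>1 \<le> k0\<close> in auto)
  have diagonal: "ratio_bounded M {k0..N} (\<lambda>k \<omega>. \<Sum>i<k. D present i \<omega>) (real d + 0) (192 * (\<kappa> * real d) / real k0)"
  proof (rule ratio_bounded_perturb[OF diagonal_ratio_bounded[OF u \<open>1 \<le> k0\<close>]])
    fix k \<omega>
    have "\<bar>D present i \<omega>\<bar> \<le> (\<Sum>l<d. (\<eta> l (u i) \<omega>)\<^sup>2)" for i
      using diag[of "\<lambda>l. \<eta> l (u i) \<omega>"] by (cases "u i \<in> W") (auto simp: D_def present_def sum_nonneg)
    then have "\<bar>\<Sum>i<k. D present i \<omega>\<bar> \<le> (\<Sum>i<k. \<Sum>l<d. (\<eta> l (u i) \<omega>)\<^sup>2)"
      by (intro order_trans[OF sum_abs] sum_mono)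
    then show "\<bar>\<Sum>i<k. D present i \<omega>\<bar> \<le> \<bar>\<Sum>i<k. \<Sum>l<d. (\<eta> l (u i) \<omega>)\<^sup>2\<bar> + real k * 0" by simp
  qed simp
  note sum = ratio_bounded_add[OF diagonal ratio_bounded_add[OF forward backward]]
  have "ratio_bounded M {k0..N}
    (\<lambda>k \<omega>. \<Sum>i<k. \<Sum>l<d. \<eta> l (u i) \<omega> * (\<Sum>l'<d. C l l' * (\<Sum>v\<in>W. \<eta> l' v \<omega>)))
    (real d + 0 + (0 + 0) + 0) (2000 * \<kappa> * real n * real d / real k0)"
  proof (rule ratio_bounded_perturb[OF sum])
    fix k \<omega> assume k: "k \<in> {k0..N}"
    have "(\<Sum>l<d. \<eta> l (u i) \<omega> * (\<Sum>l'<d. C l l' * (\<Sum>v\<in>W. \<eta> l' v \<omega>)))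
        = D present i \<omega> + (D past i \<omega> + D future i \<omega>)" if "i < k" for i
    proof -
      have "i < N" using that k by auto
      then have W_eq: "W = present i \<union> (past i \<union> future i)"
      proof -
        have "{i..<N} = insert i {Suc i..<N}" using \<open>i < N\<close> by auto
        then show ?thesis by (auto simp: past_def future_def present_def)
      qed
      have "present i \<inter> (past i \<union> future i) = {}" "past i \<inter> future i = {}"
        using not_future[OF \<open>i < N\<close>] \<open>i < N\<close> by (auto simp: past_def future_def present_def)
      then have "(\<Sum>v\<in>W. \<eta> l v \<omega>) = (\<Sum>v\<in>present i. \<eta> l v \<omega>) + ((\<Sum>v\<in>past i. \<eta> l v \<omega>) + (\<Sum>v\<in>future i. \<eta> l v \<omega>))" for l
        using fin by (subst W_eq) (simp add: sum.union_disjoint)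
      then show ?thesis by (simp add: D_def sum.distrib algebra_simps)
    qed
    then have "(\<Sum>i<k. \<Sum>l<d. \<eta> l (u i) \<omega> * (\<Sum>l'<d. C l l' * (\<Sum>v\<in>W. \<eta> l' v \<omega>)))
        = (\<Sum>i<k. D present i \<omega>) + ((\<Sum>i<k. D past i \<omega>) + (\<Sum>i<k. D future i \<omega>))"
      by (simp add: sum.distrib)
    then show "\<bar>\<Sum>i<k. \<Sum>l<d. \<eta> l (u i) \<omega> * (\<Sum>l'<d. C l l' * (\<Sum>v\<in>W. \<eta> l' v \<omega>))\<bar>
        \<le> \<bar>(\<Sum>i<k. D present i \<omega>) + ((\<Sum>i<k. D past i \<omega>) + (\<Sum>i<k. D future i \<omega>))\<bar> + real k * 0"
      by simp
  next
    note constants = variance_constants[OF \<open>1 \<le> n\<close>, of d]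
    show "2 * (192 * (\<kappa> * real d) / real k0) +
        2 * (2 * (192 * (real n * real d) / real k0) + 2 * (192 * (real n * real d) / real k0))
        \<le> 2000 * \<kappa> * real n * real d / real k0"
      using constants divide_right_mono[OF constants, of "real k0"] by (simp add: add_divide_distrib mult_ac)
  qed
  then show ?thesis by simp
qed

end

section \<open>Contractions and the spectral norm\<close>

definition contraction :: "nat \<Rightarrow> (nat \<Rightarrow> nat \<Rightarrow> real) \<Rightarrow> bool" where
  "contraction d B \<longleftrightarrow> (\<forall>x. (\<Sum>c<d. (mat_vec d B x c)\<^sup>2) \<le> (\<Sum>l<d. (x l)\<^sup>2))"

text \<open>The transpose of a contraction is a contraction: apply Cauchy-Schwarz to
  \<open>|q|\<^sup>2 = \<langle>y, B q\<rangle>\<close>, where \<open>q\<close> is the transpose of \<open>B\<close> applied to \<open>y\<close>.\<close>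

lemma contraction_transpose:
  assumes "contraction d B"
  shows "(\<Sum>l<d. (\<Sum>c<d. y c * B c l)\<^sup>2) \<le> (\<Sum>c<d. (y c)\<^sup>2)"
proof -
  define q where "q l = (\<Sum>c<d. y c * B c l)" for l
  define s where "s = (\<Sum>l<d. (q l)\<^sup>2)"
  have "s = (\<Sum>l<d. \<Sum>c<d. y c * B c l * q l)"
    by (simp add: s_def power2_eq_square q_def sum_distrib_right)
  also have "\<dots> = (\<Sum>c<d. y c * mat_vec d B q c)"
    by (subst sum.swap) (simp add: mat_vec_def sum_distrib_left mult.assoc)
  finally have "s\<^sup>2 \<le> (\<Sum>c<d. (y c)\<^sup>2) * (\<Sum>c<d. (mat_vec d B q c)\<^sup>2)"
    using Cauchy_Schwarz_ineq_sum[of y "mat_vec d B q" "{..<d}"] by simp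
  also have "\<dots> \<le> (\<Sum>c<d. (y c)\<^sup>2) * s"
    using assms unfolding contraction_def s_def by (intro mult_left_mono) (auto intro: sum_nonneg)
  finally have "s * s \<le> (\<Sum>c<d. (y c)\<^sup>2) * s" by (simp add: power2_eq_square)
  moreover have "0 \<le> s" "0 \<le> (\<Sum>c<d. (y c)\<^sup>2)" by (simp_all add: s_def sum_nonneg)
  ultimately have "s \<le> (\<Sum>c<d. (y c)\<^sup>2)"
    by (cases "s = 0") (auto simp: mult_le_cancel_right)
  then show ?thesis by (simp add: s_def q_def)
qed

lemma contraction_column:
  assumes "contraction d B" "m < d"
  shows "(\<Sum>c<d. (B c m)\<^sup>2) \<le> 1"
proof -
  define e :: "nat \<Rightarrow> real" where "e l = (if l = m then 1 else 0)" for l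
  have "mat_vec d B e c = B c m" for c
    using assms(2) by (simp add: mat_vec_def e_def if_distrib cong: if_cong)
  moreover have "(\<Sum>l<d. (e l)\<^sup>2) = 1"
    using assms(2) by (simp add: e_def if_distrib[of "\<lambda>x. x\<^sup>2"] cong: if_cong)
  ultimately show ?thesis
    using assms(1)[unfolded contraction_def, rule_format, of e] by simp
qed

lemma contraction_row:
  assumes "contraction d B" "m < d"
  shows "(\<Sum>l<d. (B m l)\<^sup>2) \<le> 1"
proof -
  define e :: "nat \<Rightarrow> real" where "e c = (if c = m then 1 else 0)" for c
  have "(\<Sum>c<d. e c * B c l) = B m l" for l
    using assms(2) by (simp add: e_def if_distrib[of "\<lambda>x. x * _"] cong: if_cong)
  moreover have "(\<Sum>c<d. (e c)\<^sup>2) = 1"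
    using assms(2) by (simp add: e_def if_distrib[of "\<lambda>x. x\<^sup>2"] cong: if_cong)
  ultimately show ?thesis
    using contraction_transpose[OF assms(1), of e] by simp
qed

text \<open>Each column of the product has norm at most 1. That the bound is \<open>d\<close> and not \<open>d\<^sup>2\<close> is the gain
  over estimating an inner product of noise vectors by the product of their norms.\<close>

lemma contraction_product_frobenius:
  assumes "contraction d B" "contraction d B'"
  shows "(\<Sum>l<d. \<Sum>l'<d. (\<Sum>c<d. B c l * B' c l')\<^sup>2) \<le> real d"
proof -
  have "(\<Sum>l<d. \<Sum>l'<d. (\<Sum>c<d. B c l * B' c l')\<^sup>2) = (\<Sum>l'<d. \<Sum>l<d. (\<Sum>c<d. B' c l' * B c l)\<^sup>2)"
    by (subst sum.swap) (simp add: mult.commute)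
  also have "\<dots> \<le> (\<Sum>l'<d. \<Sum>c<d. (B' c l')\<^sup>2)"
    by (intro sum_mono contraction_transpose[OF assms(1)])
  also have "\<dots> \<le> (\<Sum>l'<d. 1)"
    by (intro sum_mono contraction_column[OF assms(2)]) simp
  finally show ?thesis by simp
qed

lemma mat_vec_product:
  "(\<Sum>c<d. mat_vec d B x c * mat_vec d B' y c) = (\<Sum>l<d. x l * (\<Sum>l'<d. (\<Sum>c<d. B c l * B' c l') * y l'))"
proof -
  have "(\<Sum>c<d. mat_vec d B x c * mat_vec d B' y c) = (\<Sum>c<d. \<Sum>l<d. \<Sum>l'<d. (B c l * x l) * (B' c l' * y l'))"
    by (simp add: mat_vec_def sum_product)
  also have "\<dots> = (\<Sum>l<d. \<Sum>c<d. \<Sum>l'<d. (B c l * x l) * (B' c l' * y l'))"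
    by (rule sum.swap)
  also have "\<dots> = (\<Sum>l<d. \<Sum>l'<d. \<Sum>c<d. (B c l * x l) * (B' c l' * y l'))"
    by (rule sum.cong[OF refl sum.swap])
  also have "\<dots> = (\<Sum>l<d. x l * (\<Sum>l'<d. (\<Sum>c<d. B c l * B' c l') * y l'))"
    by (simp add: sum_distrib_left sum_distrib_right mult_ac)
  finally show ?thesis .
qed

lemma contraction_product_bilinear:
  assumes "contraction d B" "contraction d B'"
  shows "\<bar>\<Sum>l<d. x l * (\<Sum>l'<d. (\<Sum>c<d. B c l * B' c l') * x l')\<bar> \<le> (\<Sum>l<d. (x l)\<^sup>2)"
proof -
  note eq = mat_vec_product[of d B x B' x, symmetric]
  have "(\<Sum>c<d. mat_vec d B x c * mat_vec d B' x c)\<^sup>2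
      \<le> (\<Sum>c<d. (mat_vec d B x c)\<^sup>2) * (\<Sum>c<d. (mat_vec d B' x c)\<^sup>2)"
    by (rule Cauchy_Schwarz_ineq_sum)
  also have "\<dots> \<le> (\<Sum>l<d. (x l)\<^sup>2) * (\<Sum>l<d. (x l)\<^sup>2)"
    using assms unfolding contraction_def by (intro mult_mono) (auto intro: sum_nonneg)
  finally have "(\<Sum>c<d. mat_vec d B x c * mat_vec d B' x c)\<^sup>2 \<le> (\<Sum>l<d. (x l)\<^sup>2)\<^sup>2"
    by (simp add: power2_eq_square)
  moreover have "0 \<le> (\<Sum>l<d. (x l)\<^sup>2)" by (simp add: sum_nonneg)
  ultimately show ?thesis unfolding eq by (metis abs_le_square_iff abs_of_nonneg)
qed

lemma vnorm_square: "(vnorm d x)\<^sup>2 = (\<Sum>k<d. (x k)\<^sup>2)"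
  by (simp add: vnorm_def L2_set_def sum_nonneg)

lemma vnorm_nonneg: "0 \<le> vnorm d x"
  by (simp add: vnorm_def)

lemma vnorm_scale: "vnorm d (\<lambda>k. a * x k) = \<bar>a\<bar> * vnorm d x"
proof -
  have "(vnorm d (\<lambda>k. a * x k))\<^sup>2 = (\<bar>a\<bar> * vnorm d x)\<^sup>2"
    unfolding power_mult_distrib vnorm_square by (simp add: sum_distrib_left)
  then show ?thesis by (metis abs_ge_zero mult_nonneg_nonneg power2_eq_iff_nonneg vnorm_nonneg)
qed

lemma mat_vec_scale: "mat_vec d A (\<lambda>l. a * x l) = (\<lambda>k. a * mat_vec d A x k)"
  by (simp add: mat_vec_def sum_distrib_left mult.left_commute)

text \<open>Without this bound the supremum in the definition of the spectral norm would be an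
  unspecified number.\<close>

lemma bdd_above_spectral: "bdd_above ((\<lambda>v. vnorm d (mat_vec d A v)) ` {v. vnorm d v \<le> 1})"
proof (rule bdd_aboveI2)
  fix v :: "nat \<Rightarrow> real" assume "v \<in> {v. vnorm d v \<le> 1}"
  then have 1: "sqrt (\<Sum>i<d. (v i)\<^sup>2) \<le> 1" by (simp only: vnorm_def L2_set_def mem_Collect_eq)
  have v: "\<bar>v l\<bar> \<le> 1" if "l < d" for l
    using order_trans[OF member_le_L2_set[of "{..<d}" l "\<lambda>l. \<bar>v l\<bar>"]] 1 that
    by (simp add: L2_set_def)
  have "vnorm d (mat_vec d A v) \<le> (\<Sum>k<d. \<bar>mat_vec d A v k\<bar>)"
    unfolding vnorm_def by (rule L2_set_le_sum_abs)
  also have "\<dots> \<le> (\<Sum>k<d. \<Sum>l<d. \<bar>A k l\<bar>)"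
    unfolding mat_vec_def using v
    by (intro sum_mono order_trans[OF sum_abs]) (auto simp: abs_mult intro: mult_left_le)
  finally show "vnorm d (mat_vec d A v) \<le> (\<Sum>k<d. \<Sum>l<d. \<bar>A k l\<bar>)" .
qed

lemma vnorm_zero [simp]: "vnorm d (\<lambda>_. 0) = 0"
  by (simp add: vnorm_def L2_set_def)

lemma spectral_norm_nonneg: "0 \<le> spectral_norm d A"
  unfolding spectral_norm_def
  by (rule order_trans[OF vnorm_nonneg cSUP_upper[OF _ bdd_above_spectral, of "\<lambda>_. 0"]]) simp

lemma spectral_norm_bound: "vnorm d (mat_vec d A x) \<le> spectral_norm d A * vnorm d x"
proof (cases "vnorm d x = 0")
  case True
  then have "x l = 0" if "l < d" for l
    using that vnorm_square[of d x] by (simp add: sum_nonneg_eq_0_iff)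
  then have "mat_vec d A x = (\<lambda>_. 0)" by (simp add: mat_vec_def fun_eq_iff)
  then show ?thesis using True by simp
next
  case False
  \<comment> \<open>rescale \<open>x\<close> to the unit ball\<close>
  define r where "r = vnorm d x"
  have r: "0 < r" using False vnorm_nonneg[of d x] by (simp add: r_def)
  have "vnorm d (mat_vec d A (\<lambda>l. 1 / r * x l)) \<le> spectral_norm d A"
    unfolding spectral_norm_def
    by (rule cSUP_upper[OF _ bdd_above_spectral]) (use r in \<open>simp only: mem_Collect_eq vnorm_scale, simp add: r_def\<close>)
  then have "1 / r * vnorm d (mat_vec d A x) \<le> spectral_norm d A"
    unfolding mat_vec_scale vnorm_scale using r by simp
  then show ?thesis using r by (simp add: r_def[symmetric] field_simps)
qed

text \<open>Each coefficient matrix is a weight times a contraction. This includes the weight 0, since a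
  matrix of spectral norm 0 vanishes on the first \<open>d\<close> coordinates.\<close>

lemma spectral_factorization:
  fixes A :: "nat \<Rightarrow> nat \<Rightarrow> real" and d :: nat
  defines "a \<equiv> spectral_norm d A"
  obtains B where "contraction d B" "\<And>x c. c < d \<Longrightarrow> mat_vec d A x c = a * mat_vec d B x c"
proof
  define B where "B k l = 1 / a * A k l" for k l
  have a: "0 \<le> a" by (simp add: a_def spectral_norm_nonneg)
  have B: "mat_vec d B x = (\<lambda>c. 1 / a * mat_vec d A x c)" for x
    by (simp add: mat_vec_def B_def sum_divide_distrib)
  show "contraction d B"
    unfolding contraction_def vnorm_square[symmetric]
  proof
    fix x
    have "vnorm d (mat_vec d B x) \<le> vnorm d x"
    proof (cases "a = 0")
      case False
      then show ?thesis
        unfolding B vnorm_scale using a spectral_norm_bound[of d A x] by (simp add: a_def field_simps)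
    qed (simp add: B vnorm_nonneg)
    then show "(vnorm d (mat_vec d B x))\<^sup>2 \<le> (vnorm d x)\<^sup>2"
      by (intro power_mono vnorm_nonneg)
  qed
  fix x c assume c: "c < d"
  show "mat_vec d A x c = a * mat_vec d B x c"
  proof (cases "a = 0")
    case True
    then have "vnorm d (mat_vec d A x) = 0"
      using spectral_norm_bound[of d A x] vnorm_nonneg[of d "mat_vec d A x"] by (simp add: a_def)
    then have "mat_vec d A x c = 0"
      using c vnorm_square[of d "mat_vec d A x"] by (simp add: sum_nonneg_eq_0_iff)
    then show ?thesis using True by simp
  qed (simp add: B)
qed

lemma mat_vec_sum: "mat_vec d B (\<lambda>l. \<Sum>i\<in>T. x i l) c = (\<Sum>i\<in>T. mat_vec d B (x i) c)"
  unfolding mat_vec_def by (simp add: sum_distrib_left sum.swap[of _ T])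

lemma sum_mat_vec_transpose:
  "(\<Sum>c<d. y c * mat_vec d B x c) = (\<Sum>l<d. (\<Sum>c<d. y c * B c l) * x l)"
proof -
  have "(\<Sum>c<d. y c * mat_vec d B x c) = (\<Sum>c<d. \<Sum>l<d. y c * B c l * x l)"
    by (simp add: mat_vec_def sum_distrib_left mult.assoc)
  also have "\<dots> = (\<Sum>l<d. \<Sum>c<d. y c * B c l * x l)" by (rule sum.swap)
  finally show ?thesis by (simp add: sum_distrib_right)
qed

section \<open>Maximal inequalities for the linear process\<close>

text \<open>If a limit exceeds its threshold, then eventually so do the approximations; hence the tail
  event of the limit lies in the limes inferior of the tail events.\<close>

lemma (in finite_measure) tail_limit:
  fixes f :: "nat \<Rightarrow> nat \<Rightarrow> 'a \<Rightarrow> real" and g :: "nat \<Rightarrow> 'a \<Rightarrow> real"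
  assumes [measurable]: "\<And>J k. f J k \<in> borel_measurable M" "\<And>k. g k \<in> borel_measurable M"
    and conv: "AE \<omega> in M. \<forall>k\<in>K. (\<lambda>J. f J k \<omega>) \<longlonglongrightarrow> g k \<omega>"
    and tail: "\<And>J. measure M {\<omega> \<in> space M. \<exists>k\<in>K. \<bar>f J k \<omega>\<bar> > r k} \<le> \<beta>"
  shows "measure M {\<omega> \<in> space M. \<exists>k\<in>K. \<bar>g k \<omega>\<bar> > r k} \<le> \<beta>"
proof -
  define E where "E J = {\<omega> \<in> space M. \<exists>k\<in>K. \<bar>f J k \<omega>\<bar> > r k}" for J
  \<comment> \<open>these sets increase, and each is contained in one of the given tail events\<close>
  define H where "H m = {\<omega> \<in> space M. \<forall>J\<ge>m. \<omega> \<in> E J}" for m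
  have [measurable]: "E J \<in> sets M" for J unfolding E_def by measurable
  have [measurable]: "H m \<in> sets M" for m unfolding H_def by measurable
  have "measure M {\<omega> \<in> space M. \<exists>k\<in>K. \<bar>g k \<omega>\<bar> > r k} \<le> measure M (\<Union>m. H m)"
  proof (rule finite_measure_mono_AE)
    show "AE \<omega> in M. \<omega> \<in> {\<omega> \<in> space M. \<exists>k\<in>K. \<bar>g k \<omega>\<bar> > r k} \<longrightarrow> \<omega> \<in> (\<Union>m. H m)"
      using conv
    proof eventually_elim
      fix \<omega> assume lim: "\<forall>k\<in>K. (\<lambda>J. f J k \<omega>) \<longlonglongrightarrow> g k \<omega>"
      show "\<omega> \<in> {\<omega> \<in> space M. \<exists>k\<in>K. \<bar>g k \<omega>\<bar> > r k} \<longrightarrow> \<omega> \<in> (\<Union>m. H m)"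
      proof
        assume "\<omega> \<in> {\<omega> \<in> space M. \<exists>k\<in>K. \<bar>g k \<omega>\<bar> > r k}"
        then obtain k where k: "\<omega> \<in> space M" "k \<in> K" "\<bar>g k \<omega>\<bar> > r k" by blast
        have "(\<lambda>J. \<bar>f J k \<omega>\<bar>) \<longlonglongrightarrow> \<bar>g k \<omega>\<bar>" using lim k(2) by (intro tendsto_rabs) auto
        then have "\<forall>\<^sub>F J in sequentially. \<bar>f J k \<omega>\<bar> > r k" using k(3) by (rule order_tendstoD)
        then obtain m where "\<And>J. m \<le> J \<Longrightarrow> \<bar>f J k \<omega>\<bar> > r k"
          unfolding eventually_sequentially by blast
        then have "\<omega> \<in> H m" using k by (auto simp: H_def E_def)
        then show "\<omega> \<in> (\<Union>m. H m)" by blast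
      qed
    qed
  qed measurable
  also have "measure M (\<Union>m. H m) \<le> \<beta>"
  proof (rule LIMSEQ_le_const2[OF finite_Lim_measure_incseq])
    show "range H \<subseteq> sets M" by auto
    show "incseq H" by (auto simp: incseq_def H_def)
    have "measure M (H m) \<le> measure M (E m)" for m
      by (intro finite_measure_mono) (auto simp: H_def)
    then show "\<exists>N. \<forall>m\<ge>N. measure M (H m) \<le> \<beta>"
      using tail unfolding E_def by (meson order_trans)
  qed
  finally show ?thesis .
qed

text \<open>The expected sum of the absolute values is finite, so this sum is finite almost everywhere.\<close>

lemma AE_summable:
  fixes f :: "nat \<Rightarrow> 'a \<Rightarrow> real"
  assumes int: "\<And>j. integrable M (f j)" and sum: "summable (\<lambda>j. \<integral>\<omega>. \<bar>f j \<omega>\<bar> \<partial>M)"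
  shows "AE \<omega> in M. summable (\<lambda>j. f j \<omega>)"
proof -
  have [measurable]: "f j \<in> borel_measurable M" for j using int[of j] by simp
  have "(\<integral>\<^sup>+\<omega>. (\<Sum>j. ennreal \<bar>f j \<omega>\<bar>) \<partial>M) = (\<Sum>j. \<integral>\<^sup>+\<omega>. ennreal \<bar>f j \<omega>\<bar> \<partial>M)"
    by (rule nn_integral_suminf) measurable
  also have "\<dots> = (\<Sum>j. ennreal (\<integral>\<omega>. \<bar>f j \<omega>\<bar> \<partial>M))"
    using int by (subst nn_integral_eq_integral) auto
  also have "\<dots> = ennreal (\<Sum>j. \<integral>\<omega>. \<bar>f j \<omega>\<bar> \<partial>M)"
    using sum by (intro suminf_ennreal2) auto
  finally have "(\<integral>\<^sup>+\<omega>. (\<Sum>j. ennreal \<bar>f j \<omega>\<bar>) \<partial>M) \<noteq> \<infinity>" by simp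
  then have "AE \<omega> in M. (\<Sum>j. ennreal \<bar>f j \<omega>\<bar>) \<noteq> \<infinity>"
    by (intro nn_integral_PInf_AE) measurable
  then show ?thesis
  proof eventually_elim
    fix \<omega> assume "(\<Sum>j. ennreal \<bar>f j \<omega>\<bar>) \<noteq> \<infinity>"
    then have "summable (\<lambda>j. \<bar>f j \<omega>\<bar>)" by (intro summable_suminf_not_top) auto
    then show "summable (\<lambda>j. f j \<omega>)" by (rule summable_rabs_cancel)
  qed
qed

context iid_noise
begin

text \<open>All moment bounds are for these finite sums; the series itself is only reached almost surely.\<close>

definition partial_process ::
    "nat \<Rightarrow> (nat \<Rightarrow> nat \<Rightarrow> nat \<Rightarrow> real) \<Rightarrow> nat \<Rightarrow> nat \<Rightarrow> int \<Rightarrow> 'a \<Rightarrow> real" where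
  "partial_process d A J c t \<omega> = (\<Sum>j<J. mat_vec d (A j) (\<lambda>l. \<eta> l (t - int j) \<omega>) c)"

lemma partial_process_measurable [measurable]: "partial_process d A J c t \<in> borel_measurable M"
  unfolding partial_process_def[abs_def] mat_vec_def by measurable

lemma linear_process_measurable [measurable]: "linear_process d A \<eta> c t \<in> borel_measurable M"
  unfolding linear_process_def[abs_def] mat_vec_def by measurable

text \<open>Each row of a contraction has norm at most 1, so the \<open>j\<close>-th term of the series has \<open>L\<^sup>1\<close> norm at
  most the spectral norm of the \<open>j\<close>-th coefficient.\<close>

lemma partial_process_converges:
  assumes "summable (\<lambda>j. spectral_norm d (A j))"
  shows "AE \<omega> in M. \<forall>c<d. \<forall>t. (\<lambda>J. partial_process d A J c t \<omega>) \<longlonglongrightarrow> linear_process d A \<eta> c t \<omega>"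
proof -
  have "AE \<omega> in M. c < d \<longrightarrow> summable (\<lambda>j. mat_vec d (A j) (\<lambda>l. \<eta> l (t - int j) \<omega>) c)" for c t
  proof (cases "c < d")
    case c: True
    define f where "f j \<omega> = mat_vec d (A j) (\<lambda>l. \<eta> l (t - int j) \<omega>) c" for j \<omega>
    have f: "integrable M (f j)" "(\<integral>\<omega>. \<bar>f j \<omega>\<bar> \<partial>M) \<le> spectral_norm d (A j)" for j
    proof -
      define a where "a = spectral_norm d (A j)"
      have a: "0 \<le> a" by (simp add: a_def spectral_norm_nonneg)
      obtain B where B: "contraction d B"
        "\<And>x c. c < d \<Longrightarrow> mat_vec d (A j) x c = a * mat_vec d B x c"
        using spectral_factorization[of d "A j"] unfolding a_def by blast
      define y where "y \<omega> = (\<Sum>l<d. B c l * (\<Sum>v\<in>{t - int j}. \<eta> l v \<omega>))" for \<omega>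
      have f_eq: "f j \<omega> = a * y \<omega>" for \<omega>
        unfolding f_def B(2)[OF c] by (simp add: y_def mat_vec_def)
      have y_sq: "sq_integrable M y"
        unfolding y_def[abs_def] by (rule window_form_second_moment) simp
      have "expectation (\<lambda>\<omega>. (y \<omega>)\<^sup>2) \<le> 1"
        unfolding y_def using contraction_row[OF B(1) c]
        by (subst window_form_second_moment) auto
      have y_int: "integrable M (\<lambda>\<omega>. \<bar>y \<omega>\<bar>)"
        using sq_integrable_integrable[OF y_sq] by simp
      have "expectation (\<lambda>\<omega>. \<bar>y \<omega>\<bar>) \<le> expectation (\<lambda>\<omega>. (1 + (y \<omega>)\<^sup>2) / 2)"
      proof (rule integral_mono[OF y_int])
        show "integrable M (\<lambda>\<omega>. (1 + (y \<omega>)\<^sup>2) / 2)" using y_sq by (simp add: sq_integrable_def)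
        show "\<bar>y \<omega>\<bar> \<le> (1 + (y \<omega>)\<^sup>2) / 2" for \<omega>
          using zero_le_power2[of "\<bar>y \<omega>\<bar> - 1"] by (simp add: power2_diff)
      qed
      also have "\<dots> \<le> 1"
        using \<open>expectation (\<lambda>\<omega>. (y \<omega>)\<^sup>2) \<le> 1\<close> y_sq by (simp add: sq_integrable_def prob_space)
      finally have "a * expectation (\<lambda>\<omega>. \<bar>y \<omega>\<bar>) \<le> a * 1" using a by (rule mult_left_mono)
      then show "(\<integral>\<omega>. \<bar>f j \<omega>\<bar> \<partial>M) \<le> spectral_norm d (A j)"
        using a by (simp add: f_eq abs_mult a_def)
      show "integrable M (f j)"
        unfolding f_eq[abs_def] using sq_integrable_integrable[OF y_sq] by simp
    qed
    have "summable (\<lambda>j. \<integral>\<omega>. \<bar>f j \<omega>\<bar> \<partial>M)"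
      by (rule summable_comparison_test'[OF assms]) (use f in auto)
    then show ?thesis using AE_summable[OF f(1)] c by (simp add: f_def)
  qed simp
  then have "AE \<omega> in M. \<forall>c. \<forall>t. c < d \<longrightarrow> summable (\<lambda>j. mat_vec d (A j) (\<lambda>l. \<eta> l (t - int j) \<omega>) c)"
    by (simp add: AE_all_countable)
  then show ?thesis
    by eventually_elim (auto simp: partial_process_def linear_process_def summable_LIMSEQ)
qed

lemma partial_process_block:
  assumes "\<And>j x c. c < d \<Longrightarrow> mat_vec d (A j) x c = a j * mat_vec d (B j) x c" "c < d"
  shows "(\<Sum>i\<in>T. partial_process d A J c (t i) \<omega>) =
    (\<Sum>j<J. a j * mat_vec d (B j) (\<lambda>l. \<Sum>i\<in>T. \<eta> l (t i - int j) \<omega>) c)"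
proof -
  have "(\<Sum>i\<in>T. partial_process d A J c (t i) \<omega>)
      = (\<Sum>j<J. \<Sum>i\<in>T. a j * mat_vec d (B j) (\<lambda>l. \<eta> l (t i - int j) \<omega>) c)"
    using assms by (simp add: partial_process_def sum.swap[of _ T])
  then show ?thesis by (simp add: mat_vec_sum sum_distrib_left)
qed

lemma inj_on_shift: "inj_on t S \<Longrightarrow> inj_on (\<lambda>i. t i - s) S" for t :: "nat \<Rightarrow> int"
  by (simp add: inj_on_def)

lemma truncation_setup:
  assumes "summable (\<lambda>j. spectral_norm d (A j))"
  obtains B where "\<And>j. contraction d (B j)"
    "\<And>j x c. c < d \<Longrightarrow> mat_vec d (A j) x c = spectral_norm d (A j) * mat_vec d (B j) x c"
    "\<And>J. 0 \<le> (\<Sum>j<J. spectral_norm d (A j))"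
    "\<And>J. (\<Sum>j<J. spectral_norm d (A j)) \<le> coeff_norm_sum d A"
proof -
  have "\<exists>B. contraction d B \<and> (\<forall>x c. c < d \<longrightarrow> mat_vec d (A j) x c = spectral_norm d (A j) * mat_vec d B x c)" for j
    using spectral_factorization[of d "A j"] by metis
  then obtain B where "\<And>j. contraction d (B j)"
    "\<And>j x c. c < d \<Longrightarrow> mat_vec d (A j) x c = spectral_norm d (A j) * mat_vec d (B j) x c"
    by metis
  moreover have "0 \<le> (\<Sum>j<J. spectral_norm d (A j))" for J
    by (simp add: sum_nonneg spectral_norm_nonneg)
  moreover have "(\<Sum>j<J. spectral_norm d (A j)) \<le> coeff_norm_sum d A" for J
    unfolding coeff_norm_sum_def using assms by (intro sum_le_suminf) (auto simp: spectral_norm_nonneg)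
  ultimately show ?thesis using that by blast
qed

lemma partial_linear_ratio_bounded:
  assumes A: "summable (\<lambda>j. spectral_norm d (A j))" and t: "inj_on t {..<N}" and k0: "1 \<le> k0"
  shows "ratio_bounded M {k0..N} (\<lambda>k \<omega>. \<Sum>c<d. \<theta> c * (\<Sum>i<k. partial_process d A J c (t i) \<omega>)) 0
    ((coeff_norm_sum d A)\<^sup>2 * (192 * (\<Sum>c<d. (\<theta> c)\<^sup>2) / real k0))"
proof -
  define a where "a j = spectral_norm d (A j)" for j
  obtain B where B: "\<And>j. contraction d (B j)"
    "\<And>j x c. c < d \<Longrightarrow> mat_vec d (A j) x c = a j * mat_vec d (B j) x c"
    and sum_a: "\<And>J. 0 \<le> (\<Sum>j<J. a j)" "\<And>J. (\<Sum>j<J. a j) \<le> coeff_norm_sum d A"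
    using truncation_setup[OF A] unfolding a_def by metis
  define q where "q j l = (\<Sum>c<d. \<theta> c * B j c l)" for j l
  have q: "(\<Sum>l<d. (q j l)\<^sup>2) \<le> (\<Sum>c<d. (\<theta> c)\<^sup>2)" for j
    unfolding q_def by (rule contraction_transpose[OF B(1)])
  define s where "s = 192 * (\<Sum>c<d. (\<theta> c)\<^sup>2) / real k0"
  have s: "0 \<le> s" by (simp add: s_def sum_nonneg)
  have "ratio_bounded M {k0..N} (\<lambda>k \<omega>. \<Sum>i<k. \<Sum>l<d. q j l * \<eta> l (t i - int j) \<omega>) 0 s" for j
    using q[of j] k0 unfolding s_def
    by (intro ratio_bounded_mono[OF linear_ratio_bounded[OF inj_on_shift[OF t] k0] order_refl]
        divide_right_mono) auto
  then have "ratio_bounded M {k0..N} (\<lambda>k \<omega>. \<Sum>j<J. a j * (\<Sum>i<k. \<Sum>l<d. q j l * \<eta> l (t i - int j) \<omega>))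
      ((\<Sum>j<J. a j) * 0) ((\<Sum>j<J. a j)\<^sup>2 * s)"
    by (intro ratio_bounded_weighted_sum) (auto simp: a_def spectral_norm_nonneg)
  moreover have "(\<Sum>c<d. \<theta> c * (\<Sum>i<k. partial_process d A J c (t i) \<omega>))
      = (\<Sum>j<J. a j * (\<Sum>i<k. \<Sum>l<d. q j l * \<eta> l (t i - int j) \<omega>))" for k \<omega>
  proof -
    have "(\<Sum>c<d. \<theta> c * (\<Sum>i<k. partial_process d A J c (t i) \<omega>))
        = (\<Sum>c<d. \<Sum>j<J. a j * (\<theta> c * mat_vec d (B j) (\<lambda>l. \<Sum>i<k. \<eta> l (t i - int j) \<omega>) c))"
      by (simp add: partial_process_block[where A = A and B = B and a = a, OF B(2)] sum_distrib_left mult.left_commute)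
    also have "\<dots> = (\<Sum>j<J. a j * (\<Sum>c<d. \<theta> c * mat_vec d (B j) (\<lambda>l. \<Sum>i<k. \<eta> l (t i - int j) \<omega>) c))"
      by (subst sum.swap) (simp add: sum_distrib_left)
    also have "\<dots> = (\<Sum>j<J. a j * (\<Sum>l<d. \<Sum>i<k. q j l * \<eta> l (t i - int j) \<omega>))"
      unfolding sum_mat_vec_transpose q_def[symmetric] by (simp add: sum_distrib_left)
    also have "\<dots> = (\<Sum>j<J. a j * (\<Sum>i<k. \<Sum>l<d. q j l * \<eta> l (t i - int j) \<omega>))"
      by (subst sum.swap) (rule refl)
    finally show ?thesis .
  qed
  ultimately have "ratio_bounded M {k0..N} (\<lambda>k \<omega>. \<Sum>c<d. \<theta> c * (\<Sum>i<k. partial_process d A J c (t i) \<omega>))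
      0 ((\<Sum>j<J. a j)\<^sup>2 * s)" by simp
  then show ?thesis
    unfolding s_def[symmetric]
    by (rule ratio_bounded_mono[OF _ order_refl]) (intro mult_right_mono power_mono sum_a s)
qed

text \<open>By convexity of the square and contractivity the coefficient matrices drop out, which reduces
  the claim to squared norms of sums of innovations. A double expansion would leave, for two
  different lags, two different blocks that grow simultaneously and form no martingale.\<close>

lemma partial_square_ratio_bounded:
  assumes A: "summable (\<lambda>j. spectral_norm d (A j))" and t: "inj_on t {..<N}" and k0: "1 \<le> k0"
    and n: "N \<le> n" "1 \<le> n"
  shows "ratio_bounded M {k0..N} (\<lambda>k \<omega>. \<Sum>c<d. (\<Sum>i<k. partial_process d A J c (t i) \<omega>)\<^sup>2)
    ((coeff_norm_sum d A)\<^sup>2 * real d) ((coeff_norm_sum d A)^4 * (2000 * \<kappa> * real n * real d / real k0))"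
proof -
  define a where "a j = spectral_norm d (A j)" for j
  obtain B where B: "\<And>j. contraction d (B j)"
    "\<And>j x c. c < d \<Longrightarrow> mat_vec d (A j) x c = a j * mat_vec d (B j) x c"
    and sum_a: "\<And>J. 0 \<le> (\<Sum>j<J. a j)" "\<And>J. (\<Sum>j<J. a j) \<le> coeff_norm_sum d A"
    using truncation_setup[OF A] unfolding a_def by metis
  have a: "0 \<le> a j" for j by (simp add: a_def spectral_norm_nonneg)
  define g where "g = (\<Sum>j<J. a j)"
  define s where "s = 2000 * \<kappa> * real n * real d / real k0"
  have s: "0 \<le> s" using kurtosis_ge_1 by (simp add: s_def)
  have "ratio_bounded M {k0..N} (\<lambda>k \<omega>. \<Sum>j<J. (g * a j) * (\<Sum>l<d. (\<Sum>i<k. \<eta> l (t i - int j) \<omega>)\<^sup>2))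
      ((\<Sum>j<J. g * a j) * real d) ((\<Sum>j<J. g * a j)\<^sup>2 * s)"
    unfolding s_def
    by (intro ratio_bounded_weighted_sum square_ratio_bounded[OF inj_on_shift[OF t] k0 n])
       (auto simp: g_def a sum_a)
  also have "(\<Sum>j<J. g * a j) = g\<^sup>2" by (simp add: g_def sum_distrib_left power2_eq_square)
  finally have "ratio_bounded M {k0..N} (\<lambda>k \<omega>. \<Sum>c<d. (\<Sum>i<k. partial_process d A J c (t i) \<omega>)\<^sup>2)
      (g\<^sup>2 * real d + 0) ((g\<^sup>2)\<^sup>2 * s)"
  proof (rule ratio_bounded_perturb)
    fix k \<omega>
    define H where "H j l = (\<Sum>i<k. \<eta> l (t i - int j) \<omega>)" for j l
    have "(\<Sum>c<d. (\<Sum>i<k. partial_process d A J c (t i) \<omega>)\<^sup>2) = (\<Sum>c<d. (\<Sum>j<J. a j * mat_vec d (B j) (H j) c)\<^sup>2)"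
      by (simp add: partial_process_block[where A = A and B = B and a = a, OF B(2)] H_def[abs_def])
    also have "\<dots> \<le> (\<Sum>c<d. g * (\<Sum>j<J. a j * (mat_vec d (B j) (H j) c)\<^sup>2))"
      unfolding g_def by (intro sum_mono weighted_cauchy_schwarz a)
    also have "\<dots> = (\<Sum>j<J. (g * a j) * (\<Sum>c<d. (mat_vec d (B j) (H j) c)\<^sup>2))"
      by (simp add: sum_distrib_left sum.swap[of _ "{..<d}"] mult.assoc)
    also have "\<dots> \<le> (\<Sum>j<J. (g * a j) * (\<Sum>l<d. (H j l)\<^sup>2))"
      using B(1) a sum_a unfolding contraction_def g_def
      by (intro sum_mono[where K = "{..<J}"] mult_left_mono) auto
    finally show "\<bar>\<Sum>c<d. (\<Sum>i<k. partial_process d A J c (t i) \<omega>)\<^sup>2\<bar>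
        \<le> \<bar>\<Sum>j<J. (g * a j) * (\<Sum>l<d. (\<Sum>i<k. \<eta> l (t i - int j) \<omega>)\<^sup>2)\<bar> + real k * 0"
      by (simp add: H_def sum_nonneg)
  qed simp
  then show ?thesis
    unfolding s_def[symmetric]
    by (rule ratio_bounded_mono)
       (use sum_a s in \<open>auto simp: g_def power_mult[symmetric] intro!: mult_right_mono power_mono\<close>)
qed

text \<open>For a fixed window the double expansion over pairs of lags works: every pair is a bilinear form
  with matrix \<open>C j j'\<close>, the transpose of one contraction times the other.\<close>

lemma partial_cross_ratio_bounded:
  assumes A: "summable (\<lambda>j. spectral_norm d (A j))" and t: "inj_on t {..<N}" and k0: "1 \<le> k0"
    and n: "1 \<le> n" and W: "finite W" "card W \<le> n"
  shows "ratio_bounded M {k0..N}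
    (\<lambda>k \<omega>. \<Sum>c<d. (\<Sum>i<k. partial_process d A J c (t i) \<omega>) * (\<Sum>v\<in>W. partial_process d A J c v \<omega>))
    ((coeff_norm_sum d A)\<^sup>2 * real d) ((coeff_norm_sum d A)^4 * (2000 * \<kappa> * real n * real d / real k0))"
proof -
  define a where "a j = spectral_norm d (A j)" for j
  obtain B where B: "\<And>j. contraction d (B j)"
    "\<And>j x c. c < d \<Longrightarrow> mat_vec d (A j) x c = a j * mat_vec d (B j) x c"
    and sum_a: "\<And>J. 0 \<le> (\<Sum>j<J. a j)" "\<And>J. (\<Sum>j<J. a j) \<le> coeff_norm_sum d A"
    using truncation_setup[OF A] unfolding a_def by metis
  have a: "0 \<le> a j" for j by (simp add: a_def spectral_norm_nonneg)
  define g where "g = (\<Sum>j<J. a j)"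
  define s where "s = 2000 * \<kappa> * real n * real d / real k0"
  have s: "0 \<le> s" using kurtosis_ge_1 by (simp add: s_def)
  define C where "C j j' l l' = (\<Sum>c<d. B j c l * B j' c l')" for j j' l l'
  define W' where "W' j' = (\<lambda>v. v - int j') ` W" for j'
  define f where "f j j' k \<omega> = (\<Sum>i<k. \<Sum>l<d. \<eta> l (t i - int j) \<omega> * (\<Sum>l'<d. C j j' l l' * (\<Sum>v\<in>W' j'. \<eta> l' v \<omega>)))"
    for j j' k \<omega>
  have "ratio_bounded M {k0..N} (f j j') (real d) s" for j j'
    unfolding f_def[abs_def] s_def C_def
    using W card_image_le[OF W(1), of "\<lambda>v. v - int j'"]
    by (intro bilinear_ratio_bounded inj_on_shift t k0 n contraction_product_frobenius
        contraction_product_bilinear B) (auto simp: W'_def)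
  then have "ratio_bounded M {k0..N} (\<lambda>k \<omega>. \<Sum>p\<in>{..<J} \<times> {..<J}. (a (fst p) * a (snd p)) * f (fst p) (snd p) k \<omega>)
      ((\<Sum>p\<in>{..<J} \<times> {..<J}. a (fst p) * a (snd p)) * real d)
      ((\<Sum>p\<in>{..<J} \<times> {..<J}. a (fst p) * a (snd p))\<^sup>2 * s)"
    by (intro ratio_bounded_weighted_sum) (auto simp: a)
  also have "(\<Sum>p\<in>{..<J} \<times> {..<J}. a (fst p) * a (snd p)) = g\<^sup>2"
    by (simp add: g_def power2_eq_square sum_product sum.cartesian_product case_prod_unfold)
  also have "(\<lambda>k \<omega>. \<Sum>p\<in>{..<J} \<times> {..<J}. (a (fst p) * a (snd p)) * f (fst p) (snd p) k \<omega>)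
      = (\<lambda>k \<omega>. \<Sum>c<d. (\<Sum>i<k. partial_process d A J c (t i) \<omega>) * (\<Sum>v\<in>W. partial_process d A J c v \<omega>))"
  proof (intro ext)
    fix k \<omega>
    define H where "H j l = (\<Sum>i<k. \<eta> l (t i - int j) \<omega>)" for j l
    define H' where "H' j l = (\<Sum>v\<in>W. \<eta> l (v - int j) \<omega>)" for j l
    have "f j j' k \<omega> = (\<Sum>c<d. mat_vec d (B j) (H j) c * mat_vec d (B j') (H' j') c)" for j j'
    proof -
      have "H' j' l' = (\<Sum>v\<in>W' j'. \<eta> l' v \<omega>)" for l'
        by (simp add: H'_def W'_def sum.reindex inj_on_def)
      then show ?thesis
        unfolding mat_vec_product f_def by (simp add: H_def C_def sum_distrib_right sum.swap[of _ "{..<k}"])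
    qed
    then have "(\<Sum>p\<in>{..<J} \<times> {..<J}. (a (fst p) * a (snd p)) * f (fst p) (snd p) k \<omega>)
        = (\<Sum>p\<in>{..<J} \<times> {..<J}. \<Sum>c<d. (a (fst p) * mat_vec d (B (fst p)) (H (fst p)) c) *
            (a (snd p) * mat_vec d (B (snd p)) (H' (snd p)) c))"
      by (simp add: sum_distrib_left mult_ac)
    also have "\<dots> = (\<Sum>c<d. (\<Sum>j<J. a j * mat_vec d (B j) (H j) c) * (\<Sum>j<J. a j * mat_vec d (B j) (H' j) c))"
      by (subst sum.swap) (simp add: sum_product sum.cartesian_product case_prod_unfold)
    also have "\<dots> = (\<Sum>c<d. (\<Sum>i<k. partial_process d A J c (t i) \<omega>) * (\<Sum>v\<in>W. partial_process d A J c v \<omega>))"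
      by (simp add: partial_process_block[where A = A and B = B and a = a, OF B(2)] H_def[abs_def] H'_def[abs_def])
    finally show "(\<Sum>p\<in>{..<J} \<times> {..<J}. (a (fst p) * a (snd p)) * f (fst p) (snd p) k \<omega>)
      = (\<Sum>c<d. (\<Sum>i<k. partial_process d A J c (t i) \<omega>) * (\<Sum>v\<in>W. partial_process d A J c v \<omega>))" .
  qed
  finally show ?thesis
    unfolding s_def[symmetric]
    by (rule ratio_bounded_mono)
       (use sum_a s in \<open>auto simp: g_def power_mult[symmetric] intro!: mult_right_mono power_mono\<close>)
qed

lemma linear_process_tail_linear:
  assumes A: "summable (\<lambda>j. spectral_norm d (A j))" and t: "inj_on t {..<N}" and k0: "1 \<le> k0"
    and r: "0 < r"
  shows "prob {\<omega> \<in> space M. \<exists>k\<in>{k0..N}.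
      \<bar>\<Sum>c<d. \<theta> c * (\<Sum>i<k. linear_process d A \<eta> c (t i) \<omega>)\<bar> > real k * (0 + r)}
    \<le> (coeff_norm_sum d A)\<^sup>2 * (192 * (\<Sum>c<d. (\<theta> c)\<^sup>2) / real k0) / r\<^sup>2"
proof (rule tail_limit)
  show "prob {\<omega> \<in> space M. \<exists>k\<in>{k0..N}.
      \<bar>\<Sum>c<d. \<theta> c * (\<Sum>i<k. partial_process d A J c (t i) \<omega>)\<bar> > real k * (0 + r)}
    \<le> (coeff_norm_sum d A)\<^sup>2 * (192 * (\<Sum>c<d. (\<theta> c)\<^sup>2) / real k0) / r\<^sup>2" for J
    by (rule ratio_bounded_tail[OF partial_linear_ratio_bounded[OF A t k0] r])
  show "AE \<omega> in M. \<forall>k\<in>{k0..N}. (\<lambda>J. \<Sum>c<d. \<theta> c * (\<Sum>i<k. partial_process d A J c (t i) \<omega>))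
      \<longlonglongrightarrow> (\<Sum>c<d. \<theta> c * (\<Sum>i<k. linear_process d A \<eta> c (t i) \<omega>))"
    using partial_process_converges[OF A] by eventually_elim (auto intro!: tendsto_intros)
qed measurable

lemma linear_process_tail_square:
  assumes A: "summable (\<lambda>j. spectral_norm d (A j))" and t: "inj_on t {..<N}" and k0: "1 \<le> k0"
    and n: "N \<le> n" "1 \<le> n" and r: "0 < r"
  shows "prob {\<omega> \<in> space M. \<exists>k\<in>{k0..N}. \<bar>\<Sum>c<d. (\<Sum>i<k. linear_process d A \<eta> c (t i) \<omega>)\<^sup>2\<bar>
        > real k * ((coeff_norm_sum d A)\<^sup>2 * real d + r)}
    \<le> (coeff_norm_sum d A)^4 * (2000 * \<kappa> * real n * real d / real k0) / r\<^sup>2"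
proof (rule tail_limit)
  show "prob {\<omega> \<in> space M. \<exists>k\<in>{k0..N}. \<bar>\<Sum>c<d. (\<Sum>i<k. partial_process d A J c (t i) \<omega>)\<^sup>2\<bar>
        > real k * ((coeff_norm_sum d A)\<^sup>2 * real d + r)}
    \<le> (coeff_norm_sum d A)^4 * (2000 * \<kappa> * real n * real d / real k0) / r\<^sup>2" for J
    by (rule ratio_bounded_tail[OF partial_square_ratio_bounded[OF A t k0 n] r])
  show "AE \<omega> in M. \<forall>k\<in>{k0..N}. (\<lambda>J. \<Sum>c<d. (\<Sum>i<k. partial_process d A J c (t i) \<omega>)\<^sup>2)
      \<longlonglongrightarrow> (\<Sum>c<d. (\<Sum>i<k. linear_process d A \<eta> c (t i) \<omega>)\<^sup>2)"
    using partial_process_converges[OF A] by eventually_elim (auto intro!: tendsto_intros)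
qed measurable

lemma linear_process_tail_cross:
  assumes A: "summable (\<lambda>j. spectral_norm d (A j))" and t: "inj_on t {..<N}" and k0: "1 \<le> k0"
    and n: "1 \<le> n" and W: "finite W" "card W \<le> n" and r: "0 < r"
  shows "prob {\<omega> \<in> space M. \<exists>k\<in>{k0..N}.
      \<bar>\<Sum>c<d. (\<Sum>i<k. linear_process d A \<eta> c (t i) \<omega>) * (\<Sum>v\<in>W. linear_process d A \<eta> c v \<omega>)\<bar>
        > real k * ((coeff_norm_sum d A)\<^sup>2 * real d + r)}
    \<le> (coeff_norm_sum d A)^4 * (2000 * \<kappa> * real n * real d / real k0) / r\<^sup>2"
proof (rule tail_limit)
  show "prob {\<omega> \<in> space M. \<exists>k\<in>{k0..N}.
      \<bar>\<Sum>c<d. (\<Sum>i<k. partial_process d A J c (t i) \<omega>) * (\<Sum>v\<in>W. partial_process d A J c v \<omega>)\<bar>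
        > real k * ((coeff_norm_sum d A)\<^sup>2 * real d + r)}
    \<le> (coeff_norm_sum d A)^4 * (2000 * \<kappa> * real n * real d / real k0) / r\<^sup>2" for J
    by (rule ratio_bounded_tail[OF partial_cross_ratio_bounded[OF A t k0 n W] r])
  show "AE \<omega> in M. \<forall>k\<in>{k0..N}.
      (\<lambda>J. \<Sum>c<d. (\<Sum>i<k. partial_process d A J c (t i) \<omega>) * (\<Sum>v\<in>W. partial_process d A J c v \<omega>))
      \<longlonglongrightarrow> (\<Sum>c<d. (\<Sum>i<k. linear_process d A \<eta> c (t i) \<omega>) * (\<Sum>v\<in>W. linear_process d A \<eta> c v \<omega>))"
    using partial_process_converges[OF A] by eventually_elim (auto intro!: tendsto_intros)
qed measurable

end

section \<open>Least squares for a noisy step\<close>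

definition average :: "nat set \<Rightarrow> (nat \<Rightarrow> real) \<Rightarrow> real" where
  "average T x = (\<Sum>t\<in>T. x t) / real (card T)"

definition dispersion :: "nat set \<Rightarrow> (nat \<Rightarrow> real) \<Rightarrow> real" where
  "dispersion T x = (\<Sum>t\<in>T. (x t - average T x)\<^sup>2)"

text \<open>The excess of the right-hand side is the number of points times the squared distance of \<open>a\<close> to
  the mean.\<close>

lemma dispersion_le:
  assumes "finite T"
  shows "dispersion T x \<le> (\<Sum>t\<in>T. (x t - a)\<^sup>2)"
proof (cases "T = {}")
  case False
  define q where "q = real (card T)"
  have q: "q > 0" using assms False by (simp add: q_def card_gt_0_iff)
  have sum: "(\<Sum>t\<in>T. x t) = q * average T x" using q by (simp add: average_def q_def)
  have "(\<Sum>t\<in>T. (x t - a)\<^sup>2) - dispersion T x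
      = (\<Sum>t\<in>T. (average T x - a) * (2 * x t - average T x - a))"
    unfolding dispersion_def sum_subtractf[symmetric]
    by (rule sum.cong) (auto simp: power2_eq_square algebra_simps)
  also have "\<dots> = (average T x - a) * (2 * (\<Sum>t\<in>T. x t) - q * average T x - q * a)"
    by (simp add: sum_distrib_left[symmetric] sum_subtractf q_def)
  also have "\<dots> = q * (average T x - a)\<^sup>2"
    unfolding sum by (simp add: power2_eq_square algebra_simps)
  also have "\<dots> \<ge> 0" using q by simp
  finally show ?thesis by simp
qed (simp add: dispersion_def)

text \<open>The vectors \<open>e1\<close> and \<open>e2\<close> are the errors of the two means. Expanding the product gives \<open>\<rho>\<^sup>2 D / 2\<close>,
  two squares, of which \<open>|e2|\<^sup>2 / 2\<close> helps, and multiples of the controlled inner products. In total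
  the harmful terms are at most \<open>\<epsilon> D (1 + 6 / c + 2 / c\<^sup>2)\<close>, which is less than \<open>c\<^sup>2 D / 2\<close>.\<close>

lemma signal_dominates:
  fixes \<theta> U S0 S1 :: "nat \<Rightarrow> real" and k n q1 q2 c D :: real
  defines "\<epsilon> \<equiv> c ^ 4 / 16" and "\<rho> \<equiv> 1 - k / q2"
    and "e1 \<equiv> \<lambda>i. (S0 i - U i) / q1" and "e2 \<equiv> \<lambda>i. (S1 i + U i) / q2"
  assumes c: "0 < c" "c \<le> 1 / 2" and k: "0 < k" "k \<le> n"
    and q: "c * n \<le> q1" "q2 \<le> n" "c * n \<le> q2 - k"
    and D: "(\<Sum>i<d. (\<theta> i)\<^sup>2) = D" "0 < D"
    and \<theta>: "\<bar>\<Sum>i<d. \<theta> i * U i\<bar> \<le> k * (\<epsilon> * D)" "\<bar>\<Sum>i<d. \<theta> i * S1 i\<bar> \<le> n * (\<epsilon> * D)"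
    and U: "(\<Sum>i<d. (U i)\<^sup>2) \<le> k * (\<epsilon> * n * D)" "\<bar>\<Sum>i<d. U i * S0 i\<bar> \<le> k * (\<epsilon> * n * D)"
      "\<bar>\<Sum>i<d. U i * S1 i\<bar> \<le> k * (\<epsilon> * n * D)"
    and S0: "(\<Sum>i<d. (S0 i)\<^sup>2) \<le> n * (\<epsilon> * n * D)"
  shows "0 < (\<Sum>i<d. (\<rho> * \<theta> i + e1 i - e2 i) * (\<rho> * \<theta> i / 2 + U i / k - (e1 i + e2 i) / 2))"
proof -
  have n: "0 < n" using k by simp
  have cn: "0 < c * n" using c n by simp
  have q1: "0 < q1" and q2: "0 < q2" "c * n \<le> q2" using cn q k by auto
  have \<epsilon>: "0 < \<epsilon>" using c by (simp add: \<epsilon>_def)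
  have "\<rho> = (q2 - k) / q2" using q2 by (simp add: \<rho>_def field_simps)
  moreover have "c * q2 \<le> q2 - k"
    using mult_left_mono[OF q(2), of c] c q(3) by linarith
  ultimately have \<rho>: "c \<le> \<rho>" "\<rho> \<le> 1"
    using q2 k by (simp_all add: pos_le_divide_eq pos_divide_le_eq)
  have "(\<Sum>i<d. (\<rho> * \<theta> i + e1 i - e2 i) * (\<rho> * \<theta> i / 2 + U i / k - (e1 i + e2 i) / 2))
      = (\<Sum>i<d. \<rho>\<^sup>2 / 2 * (\<theta> i)\<^sup>2 + \<rho> / k * (\<theta> i * U i) + 1 / (k * q1) * (U i * S0 i) - 1 / (k * q1) * (U i)\<^sup>2
        - 1 / (k * q2) * (U i * S1 i) - 1 / (k * q2) * (U i)\<^sup>2 - \<rho> / q2 * (\<theta> i * S1 i) - \<rho> / q2 * (\<theta> i * U i)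
        - 1 / 2 * (e1 i)\<^sup>2 + 1 / 2 * (e2 i)\<^sup>2)"
    using k q1 q2
    by (intro sum.cong refl) (simp add: e1_def e2_def field_simps power2_eq_square)
  also have "\<dots> = \<rho>\<^sup>2 / 2 * D + \<rho> / k * (\<Sum>i<d. \<theta> i * U i) + 1 / (k * q1) * (\<Sum>i<d. U i * S0 i)
        - 1 / (k * q1) * (\<Sum>i<d. (U i)\<^sup>2) - 1 / (k * q2) * (\<Sum>i<d. U i * S1 i) - 1 / (k * q2) * (\<Sum>i<d. (U i)\<^sup>2)
        - \<rho> / q2 * (\<Sum>i<d. \<theta> i * S1 i) - \<rho> / q2 * (\<Sum>i<d. \<theta> i * U i)
        - 1 / 2 * (\<Sum>i<d. (e1 i)\<^sup>2) + 1 / 2 * (\<Sum>i<d. (e2 i)\<^sup>2)"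
    by (simp only: sum.distrib sum_subtractf sum_distrib_left[symmetric] D(1))
  finally have eq: "(\<Sum>i<d. (\<rho> * \<theta> i + e1 i - e2 i) * (\<rho> * \<theta> i / 2 + U i / k - (e1 i + e2 i) / 2)) = \<dots>" .
  have small: "\<bar>w * s\<bar> \<le> \<epsilon> * D / c" if "\<bar>s\<bar> \<le> B" "0 \<le> w" "w * B \<le> \<epsilon> * D / c" for w s B :: real
    using mult_left_mono[OF that(1,2)] that(2,3) by (simp add: abs_mult)
  have nq: "n / q1 \<le> 1 / c" "n / q2 \<le> 1 / c" using q q1 q2 c by (simp_all add: field_simps)
  have w: "1 / (k * q1) * (k * (\<epsilon> * n * D)) \<le> \<epsilon> * D / c" "1 / (k * q2) * (k * (\<epsilon> * n * D)) \<le> \<epsilon> * D / c"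
  proof -
    have "1 / (k * q) * (k * (\<epsilon> * n * D)) = (\<epsilon> * D) * (n / q)" for q using k by (simp add: field_simps)
    moreover have "(\<epsilon> * D) * (n / q1) \<le> (\<epsilon> * D) * (1 / c)" "(\<epsilon> * D) * (n / q2) \<le> (\<epsilon> * D) * (1 / c)"
      using mult_left_mono[OF nq(1), of "\<epsilon> * D"] mult_left_mono[OF nq(2), of "\<epsilon> * D"] mult_pos_pos[OF \<epsilon> D(2)]
      by linarith+
    ultimately show "1 / (k * q1) * (k * (\<epsilon> * n * D)) \<le> \<epsilon> * D / c" "1 / (k * q2) * (k * (\<epsilon> * n * D)) \<le> \<epsilon> * D / c"
      by simp_all
  qed
  have v: "\<rho> / q2 * (m * (\<epsilon> * D)) \<le> \<epsilon> * D / c" if "0 \<le> m" "m \<le> n" for m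
  proof -
    have "m / q2 \<le> 1 / c" using divide_right_mono[OF that(2), of q2] q2 nq by linarith
    then have "\<rho> * (m / q2) \<le> 1 * (1 / c)" using \<rho> c that q2 by (intro mult_mono) auto
    then have "\<rho> * (m / q2) * (\<epsilon> * D) \<le> 1 * (1 / c) * (\<epsilon> * D)" using \<epsilon> D by (intro mult_right_mono) auto
    then show ?thesis by (simp add: field_simps)
  qed
  have U2: "\<bar>\<Sum>i<d. (U i)\<^sup>2\<bar> \<le> k * (\<epsilon> * n * D)" using U(1) by (simp add: sum_nonneg)
  have b1: "\<bar>\<rho> / k * (\<Sum>i<d. \<theta> i * U i)\<bar> \<le> \<epsilon> * D"
  proof -
    have "\<rho> / k * \<bar>\<Sum>i<d. \<theta> i * U i\<bar> \<le> \<rho> / k * (k * (\<epsilon> * D))"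
      using \<theta>(1) \<rho> c k by (intro mult_left_mono) auto
    also have "\<dots> = \<rho> * (\<epsilon> * D)" using k by simp
    also have "\<dots> \<le> 1 * (\<epsilon> * D)" using \<rho> \<epsilon> D by (intro mult_right_mono) auto
    finally show ?thesis using \<rho> c k by (simp add: abs_mult)
  qed
  have b2: "\<bar>1 / (k * q1) * (\<Sum>i<d. U i * S0 i)\<bar> \<le> \<epsilon> * D / c" "\<bar>1 / (k * q1) * (\<Sum>i<d. (U i)\<^sup>2)\<bar> \<le> \<epsilon> * D / c"
    "\<bar>1 / (k * q2) * (\<Sum>i<d. U i * S1 i)\<bar> \<le> \<epsilon> * D / c" "\<bar>1 / (k * q2) * (\<Sum>i<d. (U i)\<^sup>2)\<bar> \<le> \<epsilon> * D / c"
    by (rule small[OF U(2) _ w(1)] small[OF U(3) _ w(2)] small[OF U2 _ w(1)] small[OF U2 _ w(2)],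
        use k q1 q2 in simp)+
  have b3: "\<bar>\<rho> / q2 * (\<Sum>i<d. \<theta> i * S1 i)\<bar> \<le> \<epsilon> * D / c" "\<bar>\<rho> / q2 * (\<Sum>i<d. \<theta> i * U i)\<bar> \<le> \<epsilon> * D / c"
  proof -
    have "0 \<le> \<rho> / q2" using \<rho> c q2 by simp
    then show "\<bar>\<rho> / q2 * (\<Sum>i<d. \<theta> i * S1 i)\<bar> \<le> \<epsilon> * D / c" "\<bar>\<rho> / q2 * (\<Sum>i<d. \<theta> i * U i)\<bar> \<le> \<epsilon> * D / c"
      using small[OF \<theta>(2), of "\<rho> / q2"] small[OF \<theta>(1), of "\<rho> / q2"] v[of n] v[of k] k n by simp_all
  qed
  have b4: "(\<Sum>i<d. (e1 i)\<^sup>2) \<le> 4 * (\<epsilon> * D / c\<^sup>2)"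
  proof -
    have "(\<Sum>i<d. (S0 i - U i)\<^sup>2) \<le> (\<Sum>i<d. 2 * (S0 i)\<^sup>2 + 2 * (U i)\<^sup>2)"
    proof (rule sum_mono)
      fix i show "(S0 i - U i)\<^sup>2 \<le> 2 * (S0 i)\<^sup>2 + 2 * (U i)\<^sup>2"
        using zero_le_power2[of "S0 i + U i"] by (simp add: power2_sum power2_diff)
    qed
    also have "\<dots> = 2 * (\<Sum>i<d. (S0 i)\<^sup>2) + 2 * (\<Sum>i<d. (U i)\<^sup>2)"
      by (simp add: sum.distrib sum_distrib_left)
    also have "\<dots> \<le> 2 * (n * (\<epsilon> * n * D)) + 2 * (n * (\<epsilon> * n * D))"
    proof -
      have "k * (\<epsilon> * n * D) \<le> n * (\<epsilon> * n * D)" using k \<epsilon> n D by (intro mult_right_mono) auto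
      then show ?thesis using S0 U(1) by linarith
    qed
    finally have 1: "(\<Sum>i<d. (S0 i - U i)\<^sup>2) \<le> 4 * (\<epsilon> * D) * n\<^sup>2" by (simp add: power2_eq_square mult_ac)
    have "(c * n)\<^sup>2 \<le> q1\<^sup>2" using q cn by (intro power_mono) auto
    have "(\<Sum>i<d. (e1 i)\<^sup>2) = (\<Sum>i<d. (S0 i - U i)\<^sup>2) / q1\<^sup>2"
      by (simp add: e1_def power_divide sum_divide_distrib)
    also have "\<dots> \<le> (4 * (\<epsilon> * D) * n\<^sup>2) / (c * n)\<^sup>2"
      using 1 \<open>(c * n)\<^sup>2 \<le> q1\<^sup>2\<close> cn \<epsilon> D q1 by (intro frac_le) auto
    also have "\<dots> = 4 * (\<epsilon> * D / c\<^sup>2)" using n c by (simp add: power_mult_distrib)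
    finally show ?thesis .
  qed
  have b5: "0 \<le> (\<Sum>i<d. (e2 i)\<^sup>2)" by (simp add: sum_nonneg)
  have b6: "\<epsilon> * D + 6 * (\<epsilon> * D / c) + 2 * (\<epsilon> * D / c\<^sup>2) < c\<^sup>2 / 2 * D"
  proof -
    define u where "u = c\<^sup>2 * D"
    have u: "0 < u" using c D by (simp add: u_def)
    have c2: "c * c \<le> 1 / 4" using mult_mono[of c "1/2" c "1/2"] c by simp
    have eq: "\<epsilon> * D = u * (c * c) / 16" "\<epsilon> * D / c = u * c / 16" "\<epsilon> * D / c\<^sup>2 = u / 16"
      using c by (simp_all add: \<epsilon>_def u_def power2_eq_square eval_nat_numeral)
    have "u * (c * c) \<le> u * (1 / 4)" "u * c \<le> u * (1 / 2)" using u c c2 by (auto intro!: mult_left_mono)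
    then have "u * (c * c) / 16 + 6 * (u * c / 16) + 2 * (u / 16) < u / 2" using u by linarith
    moreover have "c\<^sup>2 / 2 * D = u / 2" by (simp add: u_def)
    ultimately show ?thesis unfolding eq(2,3) unfolding eq(1) by simp
  qed
  have b7: "c\<^sup>2 / 2 * D \<le> \<rho>\<^sup>2 / 2 * D"
    using \<rho> c D by (intro mult_right_mono divide_right_mono power_mono) auto
  have "0 < B + x1 + x2 - x3 - x4 - x5 - x6 - x7 - 1 / 2 * y + 1 / 2 * w"
    if "\<bar>x1\<bar> \<le> E" "\<bar>x2\<bar> \<le> F" "\<bar>x3\<bar> \<le> F" "\<bar>x4\<bar> \<le> F" "\<bar>x5\<bar> \<le> F" "\<bar>x6\<bar> \<le> F" "\<bar>x7\<bar> \<le> F"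
      "y \<le> 4 * G" "0 \<le> w" "E + 6 * F + 2 * G < C" "C \<le> B" for B C E F G w x1 x2 x3 x4 x5 x6 x7 y :: real
    using that by linarith
  then show ?thesis unfolding eq using b1 b2 b3 b4 b5 b6 b7 .
qed

text \<open>The comparison of two splits that differ by the block \<open>T\<close>. It is stated for abstract sets of times,
  because \<open>T\<close> may lie on either side of the change: \<open>Own\<close> is what the wrong split leaves of the side
  to which \<open>T\<close> belongs, \<open>Rest\<close> is the true other side.\<close>

lemma split_gap:
  fixes x z :: "nat \<Rightarrow> nat \<Rightarrow> real" and \<nu> \<nu>' :: "nat \<Rightarrow> real" and Own T Rest :: "nat set" and c n D :: real
  defines "U \<equiv> \<lambda>i. \<Sum>t\<in>T. z i t" and "S0 \<equiv> \<lambda>i. \<Sum>t\<in>Own \<union> T. z i t" and "S1 \<equiv> \<lambda>i. \<Sum>t\<in>Rest. z i t"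
    and "k \<equiv> real (card T)" and "\<epsilon> \<equiv> c ^ 4 / 16"
  assumes fin: "finite Own" "finite T" "finite Rest"
    and disj: "Own \<inter> T = {}" "Rest \<inter> T = {}"
    and x_own: "\<And>i t. t \<in> Own \<union> T \<Longrightarrow> x i t = \<nu> i + z i t"
    and x_rest: "\<And>i t. t \<in> Rest \<Longrightarrow> x i t = \<nu>' i + z i t"
    and c: "0 < c" "c \<le> 1 / 2" and T: "T \<noteq> {}"
    and size: "c * n \<le> real (card Own)" "c * n \<le> real (card Rest)"
      "real (card Own) + k + real (card Rest) \<le> n"
    and D: "(\<Sum>i<d. (\<nu> i - \<nu>' i)\<^sup>2) = D" "0 < D"
    and \<theta>: "\<bar>\<Sum>i<d. (\<nu> i - \<nu>' i) * U i\<bar> \<le> k * (\<epsilon> * D)" "\<bar>\<Sum>i<d. (\<nu> i - \<nu>' i) * S1 i\<bar> \<le> n * (\<epsilon> * D)"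
    and U: "(\<Sum>i<d. (U i)\<^sup>2) \<le> k * (\<epsilon> * n * D)" "\<bar>\<Sum>i<d. U i * S0 i\<bar> \<le> k * (\<epsilon> * n * D)"
      "\<bar>\<Sum>i<d. U i * S1 i\<bar> \<le> k * (\<epsilon> * n * D)"
    and S0: "(\<Sum>i<d. (S0 i)\<^sup>2) \<le> n * (\<epsilon> * n * D)"
  shows "(\<Sum>i<d. dispersion (Own \<union> T) (x i) + dispersion Rest (x i))
    < (\<Sum>i<d. dispersion Own (x i) + dispersion (Rest \<union> T) (x i))"
proof -
  define q1 where "q1 = real (card Own)"
  define q2 where "q2 = real (card Rest) + k"
  define \<theta> where "\<theta> i = \<nu> i - \<nu>' i" for i
  define \<rho> where "\<rho> = 1 - k / q2"
  define e1 where "e1 i = (S0 i - U i) / q1" for i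
  define e2 where "e2 i = (S1 i + U i) / q2" for i
  define a where "a i = average Own (x i)" for i
  define a' where "a' i = average (Rest \<union> T) (x i)" for i
  have k: "0 < k" using T fin by (simp add: k_def card_gt_0_iff)
  have n: "0 < n" using k size(3) by linarith
  have q1: "0 < q1" and q2: "0 < q2" "real (card Rest) = q2 - k"
    using mult_pos_pos[OF c(1) n] size(1,2) k by (auto simp: q1_def q2_def)
  have S0_eq: "S0 i = (\<Sum>t\<in>Own. z i t) + U i" for i
    using fin disj by (simp add: S0_def U_def sum.union_disjoint)
  have a: "a i = \<nu> i + e1 i" for i
  proof -
    have "(\<Sum>t\<in>Own. x i t) = q1 * \<nu> i + (S0 i - U i)"
      by (simp add: x_own sum.distrib S0_eq q1_def)
    then show ?thesis using q1 by (simp add: a_def average_def e1_def q1_def[symmetric] field_simps)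
  qed
  have T_sum: "(\<Sum>t\<in>T. x i t) = k * \<nu> i + U i" for i
    by (simp add: x_own sum.distrib U_def k_def)
  have a': "a' i = \<nu>' i + k / q2 * \<theta> i + e2 i" for i
  proof -
    have "(\<Sum>t\<in>Rest \<union> T. x i t) = (q2 - k) * \<nu>' i + S1 i + (k * \<nu> i + U i)"
      unfolding T_sum[symmetric] S1_def q2(2)[symmetric] using fin disj
      by (simp add: sum.union_disjoint x_rest sum.distrib)
    moreover have "real (card (Rest \<union> T)) = q2"
      using fin disj by (simp add: card_Un_disjoint q2_def k_def)
    ultimately have *: "a' i = ((q2 - k) * \<nu>' i + S1 i + (k * \<nu> i + U i)) / q2"
      unfolding a'_def average_def by (simp only:)
    show ?thesis unfolding * e2_def \<theta>_def using q2(1) by (simp add: field_simps)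
  qed
  have gap: "(\<Sum>t\<in>T. (x i t - a i)\<^sup>2) - (\<Sum>t\<in>T. (x i t - a' i)\<^sup>2)
      = - (2 * k) * ((\<rho> * \<theta> i + e1 i - e2 i) * (\<rho> * \<theta> i / 2 + U i / k - (e1 i + e2 i) / 2))" for i
  proof -
    have "(\<Sum>t\<in>T. (x i t - a i)\<^sup>2) - (\<Sum>t\<in>T. (x i t - a' i)\<^sup>2) = (\<Sum>t\<in>T. (a' i - a i) * (2 * x i t - a i - a' i))"
      unfolding sum_subtractf[symmetric] by (rule sum.cong) (auto simp: power2_eq_square algebra_simps)
    also have "\<dots> = (a' i - a i) * (2 * (\<Sum>t\<in>T. x i t) - k * a i - k * a' i)"
      by (simp add: sum_distrib_left[symmetric] sum_subtractf k_def)
    also have "\<dots> = - (2 * k) * ((a i - a' i) * (\<nu> i + U i / k - (a i + a' i) / 2))"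
      unfolding T_sum using k by (simp add: field_simps)
    also have "a i - a' i = \<rho> * \<theta> i + e1 i - e2 i"
      by (simp add: a a' \<rho>_def \<theta>_def algebra_simps)
    also have "\<nu> i + U i / k - (a i + a' i) / 2 = \<rho> * \<theta> i / 2 + U i / k - (e1 i + e2 i) / 2"
      unfolding a a' \<rho>_def \<theta>_def using q2(1) by (simp add: field_simps)
    finally show ?thesis .
  qed
  have pos: "0 < (\<Sum>i<d. (\<rho> * \<theta> i + e1 i - e2 i) * (\<rho> * \<theta> i / 2 + U i / k - (e1 i + e2 i) / 2))"
    unfolding \<rho>_def e1_def e2_def
  proof (rule signal_dominates[where c = c and n = n and D = D, folded \<epsilon>_def])
    show "k \<le> n" "q2 \<le> n" using size(3) of_nat_0_le_iff[of "card Own"] of_nat_0_le_iff[of "card Rest"]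
      unfolding q2_def by linarith+
    show "c * n \<le> q1" "c * n \<le> q2 - k" using size(1,2) by (simp_all add: q1_def q2_def)
    show "(\<Sum>i<d. (\<theta> i)\<^sup>2) = D" "\<bar>\<Sum>i<d. \<theta> i * U i\<bar> \<le> k * (\<epsilon> * D)" "\<bar>\<Sum>i<d. \<theta> i * S1 i\<bar> \<le> n * (\<epsilon> * D)"
      unfolding \<theta>_def by (rule D \<theta>)+
  qed (fact c k D U S0)+
  have "(\<Sum>i<d. dispersion (Own \<union> T) (x i) + dispersion Rest (x i))
      \<le> (\<Sum>i<d. (\<Sum>t\<in>Own \<union> T. (x i t - a i)\<^sup>2) + (\<Sum>t\<in>Rest. (x i t - a' i)\<^sup>2))"
    using fin by (intro sum_mono add_mono dispersion_le) auto
  also have "\<dots> = (\<Sum>i<d. dispersion Own (x i) + dispersion (Rest \<union> T) (x i)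
      + ((\<Sum>t\<in>T. (x i t - a i)\<^sup>2) - (\<Sum>t\<in>T. (x i t - a' i)\<^sup>2)))"
    using fin disj by (simp add: dispersion_def a_def a'_def sum.union_disjoint algebra_simps)
  also have "\<dots> = (\<Sum>i<d. dispersion Own (x i) + dispersion (Rest \<union> T) (x i))
      - 2 * k * (\<Sum>i<d. (\<rho> * \<theta> i + e1 i - e2 i) * (\<rho> * \<theta> i / 2 + U i / k - (e1 i + e2 i) / 2))"
    unfolding gap by (simp add: sum.distrib sum_distrib_left sum_subtractf sum_negf)
  also have "\<dots> < (\<Sum>i<d. dispersion Own (x i) + dispersion (Rest \<union> T) (x i))"
    using pos k by simp
  finally show ?thesis .
qed

text \<open>The noise \<open>z\<close>, summed along the enumeration \<open>t\<close> that moves away from the change point, against the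
  jump \<open>\<theta>\<close>, against itself, and against the windows in \<open>Ws\<close>.\<close>

definition controlled ::
    "nat \<Rightarrow> (nat \<Rightarrow> real) \<Rightarrow> (nat \<Rightarrow> int \<Rightarrow> real) \<Rightarrow> (nat \<Rightarrow> int) \<Rightarrow> nat set \<Rightarrow> int set set \<Rightarrow> real \<Rightarrow> real \<Rightarrow> bool" where
  "controlled d \<theta> z t K Ws b1 b2 \<longleftrightarrow> (\<forall>k\<in>K.
     \<bar>\<Sum>c<d. \<theta> c * (\<Sum>i<k. z c (t i))\<bar> \<le> real k * b1 \<and>
     (\<Sum>c<d. (\<Sum>i<k. z c (t i))\<^sup>2) \<le> real k * b2 \<and>
     (\<forall>W\<in>Ws. \<bar>\<Sum>c<d. (\<Sum>i<k. z c (t i)) * (\<Sum>v\<in>W. z c v)\<bar> \<le> real k * b2))"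

lemma sum_int_window: "(\<Sum>v\<in>{int a..int b}. f v) = (\<Sum>t\<in>{a..b}. f (int t))"
  by (rule sum.reindex_bij_witness[of _ int nat]) auto

lemma sum_leftwards:
  "m \<le> m0 \<Longrightarrow> (\<Sum>t\<in>{m + 1..m0}. f (int t)) = (\<Sum>i<m0 - m. f (int m0 - int i))"
  by (rule sum.reindex_bij_witness[of _ "\<lambda>i. m0 - i" "\<lambda>t. m0 - t"]) (auto simp: of_nat_diff)

lemma sum_rightwards:
  "m0 \<le> m \<Longrightarrow> (\<Sum>t\<in>{m0 + 1..m}. f (int t)) = (\<Sum>i<m - m0. f (int m0 + 1 + int i))"
  by (rule sum.reindex_bij_witness[of _ "\<lambda>i. m0 + 1 + i" "\<lambda>t. t - (m0 + 1)"]) (auto simp: of_nat_diff algebra_simps)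

definition split_dispersion :: "nat \<Rightarrow> nat \<Rightarrow> (nat \<Rightarrow> nat \<Rightarrow> real) \<Rightarrow> nat \<Rightarrow> real" where
  "split_dispersion n d x m = (\<Sum>i<d. dispersion {1..m} (x i) + dispersion {m + 1..n} (x i))"

text \<open>Besides the block sums, the means involve the noise totals of both sides. These are
  the largest block sums, at \<open>k = m0\<close> and \<open>k = n - m0\<close>, so the control of blocks covers them provided
  that \<open>k0\<close> does not exceed either number.\<close>

lemma distant_split_is_worse:
  fixes x :: "nat \<Rightarrow> nat \<Rightarrow> real" and z :: "nat \<Rightarrow> int \<Rightarrow> real" and \<mu>1 \<mu>2 :: "nat \<Rightarrow> real"
    and n m m0 k0 d :: nat and c D :: real
  defines "\<epsilon> \<equiv> c ^ 4 / 16" and "\<theta> \<equiv> \<lambda>i. \<mu>1 i - \<mu>2 i"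
  defines "Ws \<equiv> {{int 1..int m0}, {int (m0 + 1)..int n}}"
  assumes x: "\<And>i t. x i t = (if t \<le> m0 then \<mu>1 i else \<mu>2 i) + z i (int t)"
    and c: "0 < c" "c \<le> 1 / 2"
    and m0: "m0 \<le> n" "c * real n \<le> real m0" "c * real n \<le> real (n - m0)"
    and m: "m \<le> n" "c * real n \<le> real m" "c * real n \<le> real (n - m)"
    and k0: "1 \<le> k0" "k0 \<le> m0" "k0 \<le> n - m0"
    and far: "real k0 \<le> \<bar>real m - real m0\<bar>"
    and D: "(\<Sum>i<d. (\<theta> i)\<^sup>2) = D" "0 < D"
    and left: "controlled d \<theta> z (\<lambda>i. int m0 - int i) {k0..m0} Ws (\<epsilon> * D) (\<epsilon> * real n * D)"
    and right: "controlled d \<theta> z (\<lambda>i. int m0 + 1 + int i) {k0..n - m0} Ws (\<epsilon> * D) (\<epsilon> * real n * D)"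
  shows "split_dispersion n d x m0 < split_dispersion n d x m"
proof -
  define L where "L i = (\<Sum>t\<in>{1..m0}. z i (int t))" for i
  define R where "R i = (\<Sum>t\<in>{m0 + 1..n}. z i (int t))" for i
  have L_left: "(\<Sum>j<m0. z i (int m0 - int j)) = L i" for i
    using sum_leftwards[of 0 m0 "z i"] by (simp add: L_def)
  have R_right: "(\<Sum>j<n - m0. z i (int m0 + 1 + int j)) = R i" for i
    using sum_rightwards[OF m0(1), of "z i"] by (simp add: R_def)
  have windows: "(\<Sum>v\<in>{int 1..int m0}. z i v) = L i" "(\<Sum>v\<in>{int (m0 + 1)..int n}. z i v) = R i" for i
    unfolding sum_int_window L_def R_def by auto
  have \<epsilon>: "0 < \<epsilon>" using c by (simp add: \<epsilon>_def)
  have \<theta>_eq: "\<mu>1 i - \<mu>2 i = \<theta> i" for i by (simp add: \<theta>_def)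
  have leftD: "\<bar>\<Sum>i<d. \<theta> i * (\<Sum>j<k. z i (int m0 - int j))\<bar> \<le> real k * (\<epsilon> * D)"
      "(\<Sum>i<d. (\<Sum>j<k. z i (int m0 - int j))\<^sup>2) \<le> real k * (\<epsilon> * real n * D)"
      "\<bar>\<Sum>i<d. (\<Sum>j<k. z i (int m0 - int j)) * L i\<bar> \<le> real k * (\<epsilon> * real n * D)"
      "\<bar>\<Sum>i<d. (\<Sum>j<k. z i (int m0 - int j)) * R i\<bar> \<le> real k * (\<epsilon> * real n * D)" if "k \<in> {k0..m0}" for k
    using left[unfolded controlled_def, rule_format, OF that] unfolding Ws_def by (auto simp: windows[simplified])
  have rightD: "\<bar>\<Sum>i<d. \<theta> i * (\<Sum>j<k. z i (int m0 + 1 + int j))\<bar> \<le> real k * (\<epsilon> * D)"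
      "(\<Sum>i<d. (\<Sum>j<k. z i (int m0 + 1 + int j))\<^sup>2) \<le> real k * (\<epsilon> * real n * D)"
      "\<bar>\<Sum>i<d. (\<Sum>j<k. z i (int m0 + 1 + int j)) * L i\<bar> \<le> real k * (\<epsilon> * real n * D)"
      "\<bar>\<Sum>i<d. (\<Sum>j<k. z i (int m0 + 1 + int j)) * R i\<bar> \<le> real k * (\<epsilon> * real n * D)" if "k \<in> {k0..n - m0}" for k
    using right[unfolded controlled_def, rule_format, OF that] unfolding Ws_def by (auto simp: windows[simplified])
  have grow: "real k * b \<le> real n * b" if "k \<le> n" "0 \<le> b" for k b
    using that by (intro mult_right_mono) auto
  have nonneg: "0 \<le> \<epsilon> * D" "0 \<le> \<epsilon> * real n * D" using \<epsilon> D by auto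
  have L: "\<bar>\<Sum>i<d. \<theta> i * L i\<bar> \<le> real n * (\<epsilon> * D)" "(\<Sum>i<d. (L i)\<^sup>2) \<le> real n * (\<epsilon> * real n * D)"
    using leftD(1,2)[of m0] k0 m0 grow[OF m0(1) nonneg(1)] grow[OF m0(1) nonneg(2)] by (auto simp: L_left)
  have R: "\<bar>\<Sum>i<d. \<theta> i * R i\<bar> \<le> real n * (\<epsilon> * D)" "(\<Sum>i<d. (R i)\<^sup>2) \<le> real n * (\<epsilon> * real n * D)"
    using rightD(1,2)[of "n - m0"] k0 m0 grow[of "n - m0", OF _ nonneg(1)] grow[of "n - m0", OF _ nonneg(2)]
    by (auto simp: R_right)
  show ?thesis
  proof (cases "m < m0")
    case True
    define T where "T = {m + 1..m0}"
    have k: "m0 - m \<in> {k0..m0}" using far True by auto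
    have card: "real (card T) = real (m0 - m)" by (simp add: T_def)
    have union: "{1..m} \<union> T = {1..m0}" "{m0 + 1..n} \<union> T = {m + 1..n}" using True m0 by (auto simp: T_def)
    have U: "(\<Sum>t\<in>T. z i (int t)) = (\<Sum>j<m0 - m. z i (int m0 - int j))" for i
      unfolding T_def using True by (intro sum_leftwards) auto
    have S: "(\<Sum>t\<in>{1..m} \<union> T. z i (int t)) = L i" "(\<Sum>t\<in>{m0 + 1..n}. z i (int t)) = R i" for i
      by (simp_all only: union L_def R_def)
    have "(\<Sum>i<d. dispersion ({1..m} \<union> T) (x i) + dispersion {m0 + 1..n} (x i))
        < (\<Sum>i<d. dispersion {1..m} (x i) + dispersion ({m0 + 1..n} \<union> T) (x i))"
    proof (rule split_gap[where c = c and n = "real n" and D = D and z = "\<lambda>i t. z i (int t)" and \<nu> = \<mu>1 and \<nu>' = \<mu>2])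
      show "x i t = \<mu>1 i + z i (int t)" if "t \<in> {1..m} \<union> T" for i t
        using that True by (auto simp: x T_def)
      show "x i t = \<mu>2 i + z i (int t)" if "t \<in> {m0 + 1..n}" for i t using that by (auto simp: x)
      show "{1..m} \<inter> T = {}" "{m0 + 1..n} \<inter> T = {}" "T \<noteq> {}" "finite T" using True by (auto simp: T_def)
      show "c * real n \<le> real (card {1..m})" "c * real n \<le> real (card {m0 + 1..n})" using m m0 by simp_all
      show "real (card {1..m}) + real (card T) + real (card {m0 + 1..n}) \<le> real n"
        unfolding card using True m m0 by simp
      show "\<bar>\<Sum>i<d. (\<mu>1 i - \<mu>2 i) * (\<Sum>t\<in>T. z i (int t))\<bar> \<le> real (card T) * (c ^ 4 / 16 * D)"
        unfolding card U \<theta>_eq \<epsilon>_def[symmetric] by (rule leftD(1)[OF k])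
      show "\<bar>\<Sum>i<d. (\<mu>1 i - \<mu>2 i) * (\<Sum>t\<in>{m0 + 1..n}. z i (int t))\<bar> \<le> real n * (c ^ 4 / 16 * D)"
        unfolding S \<theta>_eq \<epsilon>_def[symmetric] by (rule R(1))
      show "(\<Sum>i<d. (\<Sum>t\<in>T. z i (int t))\<^sup>2) \<le> real (card T) * (c ^ 4 / 16 * real n * D)"
        unfolding card U \<epsilon>_def[symmetric] by (rule leftD(2)[OF k])
      show "\<bar>\<Sum>i<d. (\<Sum>t\<in>T. z i (int t)) * (\<Sum>t\<in>{1..m} \<union> T. z i (int t))\<bar> \<le> real (card T) * (c ^ 4 / 16 * real n * D)"
        unfolding card U S \<epsilon>_def[symmetric] by (rule leftD(3)[OF k])
      show "\<bar>\<Sum>i<d. (\<Sum>t\<in>T. z i (int t)) * (\<Sum>t\<in>{m0 + 1..n}. z i (int t))\<bar> \<le> real (card T) * (c ^ 4 / 16 * real n * D)"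
        unfolding card U S \<epsilon>_def[symmetric] by (rule leftD(4)[OF k])
      show "(\<Sum>i<d. (\<Sum>t\<in>{1..m} \<union> T. z i (int t))\<^sup>2) \<le> real n * (c ^ 4 / 16 * real n * D)"
        unfolding S \<epsilon>_def[symmetric] by (rule L(2))
      show "(\<Sum>i<d. (\<mu>1 i - \<mu>2 i)\<^sup>2) = D" unfolding \<theta>_eq by (rule D(1))
    qed (use c D in auto)
    then show ?thesis unfolding split_dispersion_def union .
  next
    case False
    then have less: "m0 < m" using far k0 by (cases "m = m0") auto
    define T where "T = {m0 + 1..m}"
    have k: "m - m0 \<in> {k0..n - m0}" using far less m by auto
    have card: "real (card T) = real (m - m0)" by (simp add: T_def)
    have union: "{m + 1..n} \<union> T = {m0 + 1..n}" "{1..m0} \<union> T = {1..m}" using less m by (auto simp: T_def)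
    have U: "(\<Sum>t\<in>T. z i (int t)) = (\<Sum>j<m - m0. z i (int m0 + 1 + int j))" for i
      unfolding T_def using less by (intro sum_rightwards) auto
    have flip: "\<bar>\<Sum>i<d. (\<mu>2 i - \<mu>1 i) * y i\<bar> = \<bar>\<Sum>i<d. \<theta> i * y i\<bar>" for y :: "nat \<Rightarrow> real"
    proof -
      have "(\<Sum>i<d. (\<mu>2 i - \<mu>1 i) * y i) = - (\<Sum>i<d. \<theta> i * y i)"
        unfolding sum_negf[symmetric] by (rule sum.cong) (auto simp: \<theta>_def algebra_simps)
      then show ?thesis by simp
    qed
    have flip2: "(\<Sum>i<d. (\<mu>2 i - \<mu>1 i)\<^sup>2) = D"
      unfolding D(1)[symmetric] \<theta>_def by (simp add: power2_commute)
    have S: "(\<Sum>t\<in>{m + 1..n} \<union> T. z i (int t)) = R i" "(\<Sum>t\<in>{1..m0}. z i (int t)) = L i" for i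
      by (simp_all only: union L_def R_def)
    have "(\<Sum>i<d. dispersion ({m + 1..n} \<union> T) (x i) + dispersion {1..m0} (x i))
        < (\<Sum>i<d. dispersion {m + 1..n} (x i) + dispersion ({1..m0} \<union> T) (x i))"
    proof (rule split_gap[where c = c and n = "real n" and D = D and z = "\<lambda>i t. z i (int t)" and \<nu> = \<mu>2 and \<nu>' = \<mu>1])
      show "x i t = \<mu>2 i + z i (int t)" if "t \<in> {m + 1..n} \<union> T" for i t
        using that less by (auto simp: x T_def)
      show "x i t = \<mu>1 i + z i (int t)" if "t \<in> {1..m0}" for i t using that by (auto simp: x)
      show "{m + 1..n} \<inter> T = {}" "{1..m0} \<inter> T = {}" "T \<noteq> {}" "finite T" using less by (auto simp: T_def)
      show "c * real n \<le> real (card {m + 1..n})" "c * real n \<le> real (card {1..m0})" using m m0 by simp_all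
      show "real (card {m + 1..n}) + real (card T) + real (card {1..m0}) \<le> real n"
        unfolding card using less m m0 by simp
      show "\<bar>\<Sum>i<d. (\<mu>2 i - \<mu>1 i) * (\<Sum>t\<in>T. z i (int t))\<bar> \<le> real (card T) * (c ^ 4 / 16 * D)"
        unfolding card U flip \<epsilon>_def[symmetric] by (rule rightD(1)[OF k])
      show "\<bar>\<Sum>i<d. (\<mu>2 i - \<mu>1 i) * (\<Sum>t\<in>{1..m0}. z i (int t))\<bar> \<le> real n * (c ^ 4 / 16 * D)"
        unfolding S flip \<epsilon>_def[symmetric] by (rule L(1))
      show "(\<Sum>i<d. (\<Sum>t\<in>T. z i (int t))\<^sup>2) \<le> real (card T) * (c ^ 4 / 16 * real n * D)"
        unfolding card U \<epsilon>_def[symmetric] by (rule rightD(2)[OF k])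
      show "\<bar>\<Sum>i<d. (\<Sum>t\<in>T. z i (int t)) * (\<Sum>t\<in>{m + 1..n} \<union> T. z i (int t))\<bar> \<le> real (card T) * (c ^ 4 / 16 * real n * D)"
        unfolding card U S \<epsilon>_def[symmetric] by (rule rightD(4)[OF k])
      show "\<bar>\<Sum>i<d. (\<Sum>t\<in>T. z i (int t)) * (\<Sum>t\<in>{1..m0}. z i (int t))\<bar> \<le> real (card T) * (c ^ 4 / 16 * real n * D)"
        unfolding card U S \<epsilon>_def[symmetric] by (rule rightD(3)[OF k])
      show "(\<Sum>i<d. (\<Sum>t\<in>{m + 1..n} \<union> T. z i (int t))\<^sup>2) \<le> real n * (c ^ 4 / 16 * real n * D)"
        unfolding S \<epsilon>_def[symmetric] by (rule R(2))
      show "(\<Sum>i<d. (\<mu>2 i - \<mu>1 i)\<^sup>2) = D" by (rule flip2)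
    qed (use c D in auto)
    then show ?thesis unfolding split_dispersion_def union by (simp only: add.commute)
  qed
qed

lemma split_time_candidate:
  assumes "b \<in> change_candidates c n" "0 < c"
  shows "real (split_time n b) = real n * b"
proof -
  have "0 \<le> real n * b" using assms by (simp add: change_candidates_def)
  moreover have "of_int \<lfloor>real n * b\<rfloor> = real n * b"
    using assms(1) by (auto simp: change_candidates_def elim: Ints_cases)
  ultimately show ?thesis by (simp add: split_time_def)
qed

lemma ls_criterion_candidate:
  assumes b: "b \<in> change_candidates c n" and "0 < c" and n: "1 \<le> n"
  shows "ls_criterion n d x b = split_dispersion n d x (split_time n b) / real n"
    and "split_time n b \<le> n" "c * real n \<le> real (split_time n b)" "c * real n \<le> real (n - split_time n b)"
proof -
  note m = split_time_candidate[OF b \<open>0 < c\<close>]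
  have b': "c < b" "b < 1 - c" using b by (auto simp: change_candidates_def)
  have "real n * b \<le> real n * 1" using b' \<open>0 < c\<close> by (intro mult_left_mono) auto
  then show le: "split_time n b \<le> n" using m by simp
  show "c * real n \<le> real (split_time n b)" unfolding m using b' n by (simp add: mult.commute)
  have "real n * b \<le> real n * (1 - c)" using b' by (intro mult_left_mono) auto
  then show "c * real n \<le> real (n - split_time n b)" using le m by (simp add: of_nat_diff algebra_simps)
  have "mean_before n y b = average {1..split_time n b} y" for y
    using m by (simp add: mean_before_def average_def)
  moreover have "mean_after n y b = average {split_time n b + 1..n} y" for y
    using le m by (simp add: mean_after_def average_def of_nat_diff algebra_simps)
  ultimately show "ls_criterion n d x b = split_dispersion n d x (split_time n b) / real n"
    by (simp add: ls_criterion_def split_dispersion_def dispersion_def)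
qed

section \<open>Rate of the change point estimator\<close>

lemma (in iid_noise) controlled_measurable [measurable]:
  assumes "finite Ws"
  shows "Measurable.pred M (\<lambda>\<omega>. controlled d \<theta> (\<lambda>c t. linear_process d A \<eta> c t \<omega>) t {k0..N} Ws b1 b2)"
proof -
  have [measurable]: "countable Ws" using assms by (rule countable_finite)
  show ?thesis unfolding controlled_def by measurable
qed

lemma (in iid_noise) prob_not_controlled:
  assumes A: "summable (\<lambda>j. spectral_norm d (A j))" and t: "inj_on t {..<N}" and k0: "1 \<le> k0"
    and n: "N \<le> n" "1 \<le> n" and W: "finite W1" "card W1 \<le> n" "finite W2" "card W2 \<le> n"
    and b1: "0 < b1" and r: "0 < r"
  shows "prob {\<omega> \<in> space M. \<not> controlled d \<theta> (\<lambda>c t. linear_process d A \<eta> c t \<omega>) t {k0..N} {W1, W2}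
        b1 ((coeff_norm_sum d A)\<^sup>2 * real d + r)}
    \<le> (coeff_norm_sum d A)\<^sup>2 * (192 * (\<Sum>c<d. (\<theta> c)\<^sup>2) / real k0) / b1\<^sup>2
      + 3 * ((coeff_norm_sum d A)^4 * (2000 * \<kappa> * real n * real d / real k0) / r\<^sup>2)"
proof -
  define z where "z \<omega> c v = linear_process d A \<eta> c v \<omega>" for \<omega> c v
  have [measurable]: "(\<lambda>\<omega>. z \<omega> c v) \<in> borel_measurable M" for c v unfolding z_def by measurable
  define b2 where "b2 = (coeff_norm_sum d A)\<^sup>2 * real d + r"
  define E1 where "E1 = {\<omega> \<in> space M. \<exists>k\<in>{k0..N}. \<bar>\<Sum>c<d. \<theta> c * (\<Sum>i<k. z \<omega> c (t i))\<bar> > real k * (0 + b1)}"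
  define E2 where "E2 = {\<omega> \<in> space M. \<exists>k\<in>{k0..N}. \<bar>\<Sum>c<d. (\<Sum>i<k. z \<omega> c (t i))\<^sup>2\<bar> > real k * b2}"
  define E3 where "E3 W = {\<omega> \<in> space M. \<exists>k\<in>{k0..N}.
      \<bar>\<Sum>c<d. (\<Sum>i<k. z \<omega> c (t i)) * (\<Sum>v\<in>W. z \<omega> c v)\<bar> > real k * b2}" for W
  have [measurable]: "E1 \<in> sets M" "E2 \<in> sets M" "E3 W \<in> sets M" for W
    unfolding E1_def E2_def E3_def by measurable
  have "{\<omega> \<in> space M. \<not> controlled d \<theta> (z \<omega>) t {k0..N} {W1, W2} b1 b2} \<subseteq> (E1 \<union> E2) \<union> (E3 W1 \<union> E3 W2)"
    by (fastforce simp: controlled_def E1_def E2_def E3_def not_le abs_of_nonneg sum_nonneg)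
  then have "prob {\<omega> \<in> space M. \<not> controlled d \<theta> (z \<omega>) t {k0..N} {W1, W2} b1 b2}
      \<le> prob ((E1 \<union> E2) \<union> (E3 W1 \<union> E3 W2))"
    by (intro finite_measure_mono) measurable
  also have "\<dots> \<le> (prob E1 + prob E2) + (prob (E3 W1) + prob (E3 W2))"
    by (intro order_trans[OF measure_Un_le] add_mono measure_Un_le) measurable
  also have "\<dots> \<le> (coeff_norm_sum d A)\<^sup>2 * (192 * (\<Sum>c<d. (\<theta> c)\<^sup>2) / real k0) / b1\<^sup>2
      + 3 * ((coeff_norm_sum d A)^4 * (2000 * \<kappa> * real n * real d / real k0) / r\<^sup>2)"
  proof -
    have "prob E1 \<le> (coeff_norm_sum d A)\<^sup>2 * (192 * (\<Sum>c<d. (\<theta> c)\<^sup>2) / real k0) / b1\<^sup>2"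
      unfolding E1_def z_def by (rule linear_process_tail_linear[OF A t k0 b1])
    moreover have "prob E2 \<le> (coeff_norm_sum d A)^4 * (2000 * \<kappa> * real n * real d / real k0) / r\<^sup>2"
      unfolding E2_def z_def b2_def by (rule linear_process_tail_square[OF A t k0 n r])
    moreover have "prob (E3 W1) \<le> (coeff_norm_sum d A)^4 * (2000 * \<kappa> * real n * real d / real k0) / r\<^sup>2"
      unfolding E3_def z_def b2_def by (rule linear_process_tail_cross[OF A t k0 n(2) W(1,2) r])
    moreover have "prob (E3 W2) \<le> (coeff_norm_sum d A)^4 * (2000 * \<kappa> * real n * real d / real k0) / r\<^sup>2"
      unfolding E3_def z_def b2_def by (rule linear_process_tail_cross[OF A t k0 n(2) W(3,4) r])
    moreover have "p1 + p2 + (p3 + p4) \<le> a + 3 * b" if "p1 \<le> a" "p2 \<le> b" "p3 \<le> b" "p4 \<le> b"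
      for p1 p2 p3 p4 a b :: real using that by linarith
    ultimately show ?thesis by blast
  qed
  finally show ?thesis unfolding z_def b2_def .
qed

text \<open>Both terms contain the factor \<open>u = g\<^sup>2 / (D k0)\<close>, which is at most \<open>1 / K\<close>; the second one has in
  addition the inverse of the signal-to-noise ratio, which is at most 1.\<close>

lemma deviation_rate:
  fixes g D K \<epsilon> n d \<kappa> k0 r :: real
  assumes pos: "0 < g" "0 < D" "0 < K" "0 < \<epsilon>" "0 < n" "0 \<le> d" "0 \<le> \<kappa>"
    and k0: "K * g\<^sup>2 / D \<le> k0" and x: "g\<^sup>2 * d \<le> n * D" and r: "\<epsilon> * n * D / 2 \<le> r"
  shows "g\<^sup>2 * (192 * D / k0) / (\<epsilon> * D)\<^sup>2 + 3 * (g ^ 4 * (2000 * \<kappa> * n * d / k0) / r\<^sup>2)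
    \<le> (192 + 24000 * \<kappa>) / (\<epsilon>\<^sup>2 * K)"
proof -
  define u where "u = g\<^sup>2 / (D * k0)"
  have k0': "0 < k0" using less_le_trans[OF _ k0, of 0] pos by simp
  have u: "0 \<le> u" "u \<le> 1 / K" using k0 k0' pos by (simp_all add: u_def field_simps)
  have "g\<^sup>2 * (192 * D / k0) / (\<epsilon> * D)\<^sup>2 = 192 / \<epsilon>\<^sup>2 * u"
    using pos k0' by (simp add: u_def power2_eq_square field_simps)
  also have "\<dots> \<le> 192 / \<epsilon>\<^sup>2 * (1 / K)" using u by (intro mult_left_mono) auto
  finally have 1: "g\<^sup>2 * (192 * D / k0) / (\<epsilon> * D)\<^sup>2 \<le> 192 / (\<epsilon>\<^sup>2 * K)" by simp
  have "0 < \<epsilon> * n * D / 2" using pos by simp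
  then have r2: "(\<epsilon> * n * D / 2)\<^sup>2 \<le> r\<^sup>2" "0 < (\<epsilon> * n * D / 2)\<^sup>2 * r\<^sup>2" using r by (auto intro!: power_mono mult_pos_pos zero_less_power)
  then have "g ^ 4 * (2000 * \<kappa> * n * d / k0) / r\<^sup>2 \<le> g ^ 4 * (2000 * \<kappa> * n * d / k0) / (\<epsilon> * n * D / 2)\<^sup>2"
    using pos k0' r2 by (intro divide_left_mono) (auto simp: mult.commute)
  also have "\<dots> = 8000 * \<kappa> / \<epsilon>\<^sup>2 * (u * (g\<^sup>2 * d / (n * D)))"
    using pos k0' by (simp add: u_def power2_eq_square field_simps eval_nat_numeral)
  also have "\<dots> \<le> 8000 * \<kappa> / \<epsilon>\<^sup>2 * (1 / K * 1)"
    using u x pos by (intro mult_left_mono mult_mono) auto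
  finally have 2: "g ^ 4 * (2000 * \<kappa> * n * d / k0) / r\<^sup>2 \<le> 8000 * \<kappa> / (\<epsilon>\<^sup>2 * K)" by simp
  have "(192 + 24000 * \<kappa>) / (\<epsilon>\<^sup>2 * K) = 192 / (\<epsilon>\<^sup>2 * K) + 3 * (8000 * \<kappa> / (\<epsilon>\<^sup>2 * K))"
    by (simp add: add_divide_distrib)
  then show ?thesis using 1 2 by linarith
qed

theorem theorem2p1:
  fixes M :: "'a measure"
    and \<eta> :: "nat \<Rightarrow> int \<Rightarrow> 'a \<Rightarrow> real"
    and p :: "nat \<Rightarrow> nat"
    and A :: "nat \<Rightarrow> nat \<Rightarrow> nat \<Rightarrow> nat \<Rightarrow> real"
    and \<mu>1 \<mu>2 :: "nat \<Rightarrow> nat \<Rightarrow> real"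
    and \<tau> :: "nat \<Rightarrow> real"
    and c :: real
    and \<tau>hat :: "nat \<Rightarrow> 'a \<Rightarrow> real"
  defines "\<gamma> \<equiv> \<lambda>n. coeff_norm_sum (p n) (A n)"
    and "\<delta> \<equiv> \<lambda>n. vnorm (p n) (\<lambda>k. \<mu>1 n k - \<mu>2 n k)"
    and "X \<equiv> \<lambda>n. observation n (p n) (\<mu>1 n) (\<mu>2 n) (\<tau> n) (A n) \<eta>"
  assumes "prob_space M"
    and "prob_space.indep_vars M (\<lambda>_. borel) (\<lambda>(k, t). \<eta> k t) UNIV"
    and "\<And>k t. distr M borel (\<eta> k t) = distr M borel (\<eta> 0 0)"
    and "\<And>k t. prob_space.expectation M (\<eta> k t) = 0"
    and "\<And>k t. prob_space.variance M (\<eta> k t) = 1"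
    and "\<And>k t. integrable M (\<lambda>\<omega>. \<eta> k t \<omega> ^ 4)"
    and "filterlim p at_top sequentially"
    and "\<And>n. n \<ge> 1 \<Longrightarrow> summable (\<lambda>j. spectral_norm (p n) (A n j))"
    and "\<And>n. n \<ge> 1 \<Longrightarrow> \<gamma> n > 0"
    and "0 < c" "c < 1/2"
    and "\<forall>\<^sub>F n in sequentially. \<tau> n \<in> change_candidates c n"
    and "\<And>n. \<tau>hat n \<in> borel_measurable M"
    and "\<forall>\<^sub>F n in sequentially. \<forall>\<omega>\<in>space M.
           is_arg_min (ls_criterion n (p n) (X n \<omega>)) (\<lambda>b. b \<in> change_candidates c n) (\<tau>hat n \<omega>)"
    and "filterlim (\<lambda>n. real n * inverse ((\<gamma> n)\<^sup>2) / real (p n) * (\<delta> n)\<^sup>2) at_top sequentially"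
  shows "bounded_in_prob M (\<lambda>n \<omega>. real n * inverse ((\<gamma> n)\<^sup>2) * (\<delta> n)\<^sup>2 * (\<tau>hat n \<omega> - \<tau> n))"
proof -
  interpret prob_space M by fact
  define \<kappa> where "\<kappa> = expectation (\<lambda>\<omega>. \<eta> 0 0 \<omega> ^ 4)"
  have \<eta>_measurable [measurable]: "\<eta> k t \<in> borel_measurable M" for k t
    using assms(5) unfolding indep_vars_def2 by auto
  interpret iid_noise M \<eta> \<kappa>
  proof
    show "indep_vars (\<lambda>_. borel) (\<lambda>(k, t). \<eta> k t) UNIV" by fact
    show "expectation (\<eta> k t) = 0" "integrable M (\<lambda>\<omega>. \<eta> k t \<omega> ^ 4)" for k t by fact+
    show "expectation (\<lambda>\<omega>. (\<eta> k t \<omega>)\<^sup>2) = 1" for k t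
      using assms(8)[of k t] assms(7)[of k t] by simp
    have as_law: "expectation (\<lambda>\<omega>. \<eta> k t \<omega> ^ 4) = (\<integral>x. x ^ 4 \<partial>distr M borel (\<eta> k t))" for k t
      by (subst integral_distr) auto
    show "expectation (\<lambda>\<omega>. \<eta> k t \<omega> ^ 4) \<le> \<kappa>" for k t
      unfolding \<kappa>_def as_law assms(6)[of k t] by simp
  qed
  define \<epsilon> where "\<epsilon> = c ^ 4 / 16"
  have \<epsilon>: "0 < \<epsilon>" using assms(13) by (simp add: \<epsilon>_def)
  define \<xi> where "\<xi> n = real n * inverse ((\<gamma> n)\<^sup>2) / real (p n) * (\<delta> n)\<^sup>2" for n
  have tail: "\<exists>C. \<forall>\<^sub>F n in sequentially.
      prob {\<omega> \<in> space M. \<bar>real n * inverse ((\<gamma> n)\<^sup>2) * (\<delta> n)\<^sup>2 * (\<tau>hat n \<omega> - \<tau> n)\<bar> > C} < e" if e: "0 < e" for e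
  proof (intro exI)
    \<comment> \<open>each of the two directions then fails with probability at most \<open>e / 4\<close>\<close>
    define K where "K = 4 * (192 + 24000 * \<kappa>) / (\<epsilon>\<^sup>2 * e)"
    have K: "0 < K" using \<epsilon> e kurtosis_ge_1 by (simp add: K_def)
    \<comment> \<open>\<open>2 / \<epsilon>\<close> makes the diagonal offset harmless, \<open>2 K / c\<close> keeps \<open>k0\<close> below the sizes of both sides\<close>
    have "\<forall>\<^sub>F n in sequentially. max 1 (max (2 / \<epsilon>) (2 * K / c)) \<le> \<xi> n"
      using assms(18) unfolding \<xi>_def filterlim_at_top by blast
    moreover have "\<forall>\<^sub>F n in sequentially. 1 \<le> p n"
      using assms(10) unfolding filterlim_at_top by blast
    moreover have "\<forall>\<^sub>F n in sequentially. max 1 (2 / c) \<le> real n"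
      using filterlim_real_sequentially unfolding filterlim_at_top by blast
    ultimately show "\<forall>\<^sub>F n in sequentially.
      prob {\<omega> \<in> space M. \<bar>real n * inverse ((\<gamma> n)\<^sup>2) * (\<delta> n)\<^sup>2 * (\<tau>hat n \<omega> - \<tau> n)\<bar> > K} < e"
      using assms(15) assms(17)
    proof eventually_elim
      fix n
      assume \<xi>: "max 1 (max (2 / \<epsilon>) (2 * K / c)) \<le> \<xi> n" and pn: "1 \<le> p n" and n: "max 1 (2 / c) \<le> real n"
        and \<tau>: "\<tau> n \<in> change_candidates c n"
        and arg_min: "\<forall>\<omega>\<in>space M.
           is_arg_min (ls_criterion n (p n) (X n \<omega>)) (\<lambda>b. b \<in> change_candidates c n) (\<tau>hat n \<omega>)"
      define d where "d = p n"
      define g where "g = \<gamma> n"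
      define D where "D = (\<delta> n)\<^sup>2"
      define \<theta> where "\<theta> i = \<mu>1 n i - \<mu>2 n i" for i
      define z where "z \<omega> i t = linear_process d (A n) \<eta> i t \<omega>" for \<omega> i t
      define m0 where "m0 = split_time n (\<tau> n)"
      define k0 where "k0 = nat \<lceil>K * g\<^sup>2 / D\<rceil>"
      define Ws where "Ws = {{int 1..int m0}, {int (m0 + 1)..int n}}"
      \<comment> \<open>what the budget for quadratic terms leaves after the diagonal offset\<close>
      define r where "r = \<epsilon> * real n * D - g\<^sup>2 * real d"
      have n1: "1 \<le> n" using n by simp
      have g: "0 < g" using assms(12)[OF n1] by (simp add: g_def)
      have A: "summable (\<lambda>j. spectral_norm d (A n j))" using assms(11)[OF n1] by (simp add: d_def)
      have \<theta>D: "(\<Sum>i<d. (\<theta> i)\<^sup>2) = D" by (simp add: D_def \<delta>_def vnorm_square d_def \<theta>_def)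
      have \<xi>_eq: "\<xi> n = real n * D / (g\<^sup>2 * real d)"
        by (simp add: \<xi>_def D_def g_def d_def divide_inverse mult_ac)
      have D: "0 < D"
      proof (rule ccontr)
        assume "\<not> 0 < D"
        then have "D = 0" by (simp add: D_def)
        then show False using \<xi> by (simp add: \<xi>_eq)
      qed
      have d: "1 \<le> real d" using pn by (simp add: d_def)
      have gd: "0 < g\<^sup>2 * real d" using g d by simp
      have scaled: "y * (g\<^sup>2 * real d) \<le> real n * D" if "y \<le> \<xi> n" for y
        using that gd unfolding \<xi>_eq by (simp add: pos_le_divide_eq)
      have snr: "g\<^sup>2 * real d \<le> real n * D" using scaled[of 1] \<xi> by simp
      have r: "\<epsilon> * real n * D / 2 \<le> r"
      proof -
        have "\<epsilon> / 2 * (2 / \<epsilon> * (g\<^sup>2 * real d)) \<le> \<epsilon> / 2 * (real n * D)"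
          using scaled[of "2 / \<epsilon>"] \<xi> \<epsilon> by (intro mult_left_mono) auto
        then have "g\<^sup>2 * real d \<le> \<epsilon> / 2 * (real n * D)" using \<epsilon> by simp
        then show ?thesis by (simp add: r_def mult_ac)
      qed
      have "0 < \<epsilon> * real n * D" using \<epsilon> D n1 by simp
      then have r_pos: "0 < r" using r by linarith
      have \<kappa>0: "0 < K * g\<^sup>2 / D" using K g D by simp
      have k0: "1 \<le> k0" "K * g\<^sup>2 / D \<le> real k0" "real k0 < K * g\<^sup>2 / D + 1"
        using \<kappa>0 unfolding k0_def by linarith+
      note cand = ls_criterion_candidate[OF \<tau> assms(13) n1, folded m0_def]
      have "real k0 \<le> c * real n"
      proof -
        have "2 * K / c * (g\<^sup>2 * 1) \<le> 2 * K / c * (g\<^sup>2 * real d)"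
          using K assms(13) d by (intro mult_left_mono) auto
        also have "\<dots> \<le> real n * D" using scaled[of "2 * K / c"] \<xi> by simp
        finally have "K * g\<^sup>2 / D \<le> c * real n / 2"
          using D assms(13) by (simp add: field_simps)
        moreover have "1 \<le> c * real n / 2" using n assms(13) by (simp add: field_simps)
        ultimately show ?thesis using k0(3) by linarith
      qed
      then have k0_le: "k0 \<le> m0" "k0 \<le> n - m0" using cand(3,4) by linarith+
      define left where "left \<omega> \<longleftrightarrow> controlled d \<theta> (z \<omega>) (\<lambda>i. int m0 - int i) {k0..m0} Ws (\<epsilon> * D) (g\<^sup>2 * real d + r)" for \<omega>
      define right where "right \<omega> \<longleftrightarrow> controlled d \<theta> (z \<omega>) (\<lambda>i. int m0 + 1 + int i) {k0..n - m0} Ws (\<epsilon> * D) (g\<^sup>2 * real d + r)" for \<omega>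
      have [measurable]: "Measurable.pred M left" "Measurable.pred M right"
        unfolding left_def right_def z_def by (intro controlled_measurable; simp add: Ws_def)+
      have good: "\<bar>real n * inverse (g\<^sup>2) * D * (\<tau>hat n \<omega> - \<tau> n)\<bar> \<le> K"
        if \<omega>: "\<omega> \<in> space M" "left \<omega>" "right \<omega>" for \<omega>
      proof (rule ccontr)
        assume large: "\<not> \<bar>real n * inverse (g\<^sup>2) * D * (\<tau>hat n \<omega> - \<tau> n)\<bar> \<le> K"
        define m where "m = split_time n (\<tau>hat n \<omega>)"
        have hat: "\<tau>hat n \<omega> \<in> change_candidates c n"
          and minimal: "\<not> ls_criterion n d (X n \<omega>) (\<tau> n) < ls_criterion n d (X n \<omega>) (\<tau>hat n \<omega>)"
          using arg_min \<omega>(1) \<tau> unfolding is_arg_min_def d_def by blast+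
        note cand' = ls_criterion_candidate[OF hat assms(13) n1, folded m_def]
        have times: "real m = real n * \<tau>hat n \<omega>" "real m0 = real n * \<tau> n"
          using split_time_candidate[OF hat assms(13)] split_time_candidate[OF \<tau> assms(13)]
          by (simp_all add: m_def m0_def)
        have "real n * inverse (g\<^sup>2) * D * (\<tau>hat n \<omega> - \<tau> n) = D / g\<^sup>2 * (real m - real m0)"
          unfolding times by (simp add: divide_inverse algebra_simps)
        then have "K < D / g\<^sup>2 * \<bar>real m - real m0\<bar>" using large D g by (simp add: abs_mult)
        then have "K * g\<^sup>2 / D < \<bar>real m - real m0\<bar>" using D g by (simp add: field_simps)
        then have "K * g\<^sup>2 / D \<le> of_int \<bar>int m - int m0\<bar>" by simp
        then have "\<lceil>K * g\<^sup>2 / D\<rceil> \<le> \<bar>int m - int m0\<bar>" by (rule ceiling_le)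
        then have "int k0 \<le> \<bar>int m - int m0\<bar>" by (simp add: k0_def)
        then have far: "real k0 \<le> \<bar>real m - real m0\<bar>" by linarith
        have "split_dispersion n d (X n \<omega>) m0 < split_dispersion n d (X n \<omega>) m"
        proof (rule distant_split_is_worse[where c = c and ?k0.0 = k0 and D = D and z = "z \<omega>" and ?\<mu>1.0 = "\<mu>1 n" and ?\<mu>2.0 = "\<mu>2 n"])
          show "X n \<omega> i t = (if t \<le> m0 then \<mu>1 n i else \<mu>2 n i) + z \<omega> i (int t)" for i t
            unfolding X_def observation_def z_def d_def times(2)[symmetric] by simp
          have quad: "g\<^sup>2 * real d + r = \<epsilon> * real n * D" by (simp add: r_def)
          show "controlled d (\<lambda>i. \<mu>1 n i - \<mu>2 n i) (z \<omega>) (\<lambda>i. int m0 - int i) {k0..m0}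
              {{int 1..int m0}, {int (m0 + 1)..int n}} (c ^ 4 / 16 * D) (c ^ 4 / 16 * real n * D)"
            using \<omega>(2) unfolding left_def quad Ws_def \<epsilon>_def \<theta>_def .
          show "controlled d (\<lambda>i. \<mu>1 n i - \<mu>2 n i) (z \<omega>) (\<lambda>i. int m0 + 1 + int i) {k0..n - m0}
              {{int 1..int m0}, {int (m0 + 1)..int n}} (c ^ 4 / 16 * D) (c ^ 4 / 16 * real n * D)"
            using \<omega>(3) unfolding right_def quad Ws_def \<epsilon>_def \<theta>_def .
          show "(\<Sum>i<d. (\<mu>1 n i - \<mu>2 n i)\<^sup>2) = D" using \<theta>D by (simp add: \<theta>_def)
        qed (use assms(13,14) cand cand' k0 k0_le far D in auto)
        then show False
          using minimal n1 unfolding cand(1) cand'(1) by (simp add: divide_strict_right_mono)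
      qed
      have "prob {\<omega> \<in> space M. \<bar>real n * inverse ((\<gamma> n)\<^sup>2) * (\<delta> n)\<^sup>2 * (\<tau>hat n \<omega> - \<tau> n)\<bar> > K}
          \<le> prob ({\<omega> \<in> space M. \<not> left \<omega>} \<union> {\<omega> \<in> space M. \<not> right \<omega>})"
        using good unfolding g_def[symmetric] D_def[symmetric]
        by (intro finite_measure_mono) (auto simp: not_le[symmetric])
      also have "\<dots> \<le> prob {\<omega> \<in> space M. \<not> left \<omega>} + prob {\<omega> \<in> space M. \<not> right \<omega>}"
        by (rule measure_Un_le) measurable
      also have "\<dots> \<le> (192 + 24000 * \<kappa>) / (\<epsilon>\<^sup>2 * K) + (192 + 24000 * \<kappa>) / (\<epsilon>\<^sup>2 * K)"
      proof -
        have rate: "g\<^sup>2 * (192 * D / real k0) / (\<epsilon> * D)\<^sup>2 + 3 * (g ^ 4 * (2000 * \<kappa> * real n * real d / real k0) / r\<^sup>2)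
            \<le> (192 + 24000 * \<kappa>) / (\<epsilon>\<^sup>2 * K)"
          using g D K \<epsilon> n1 kurtosis_ge_1 k0(2) snr r by (intro deviation_rate) auto
        have g_eq: "coeff_norm_sum d (A n) = g" by (simp add: g_def \<gamma>_def d_def)
        have W: "finite {int 1..int m0}" "card {int 1..int m0} \<le> n"
          "finite {int (m0 + 1)..int n}" "card {int (m0 + 1)..int n} \<le> n"
          using cand(2) by auto
        have inj: "inj_on (\<lambda>i. int m0 - int i) {..<m0}" "inj_on (\<lambda>i. int m0 + 1 + int i) {..<n - m0}"
          by (simp_all add: inj_on_def)
        have \<epsilon>D: "0 < \<epsilon> * D" using \<epsilon> D by simp
        have "prob {\<omega> \<in> space M. \<not> left \<omega>} \<le> (192 + 24000 * \<kappa>) / (\<epsilon>\<^sup>2 * K)"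
          unfolding left_def z_def Ws_def
          by (rule order_trans[OF prob_not_controlled[where A = "A n" and d = d and \<theta> = \<theta>, unfolded g_eq \<theta>D,
                  OF A inj(1) k0(1) cand(2) n1 W \<epsilon>D r_pos] rate])
        moreover have "prob {\<omega> \<in> space M. \<not> right \<omega>} \<le> (192 + 24000 * \<kappa>) / (\<epsilon>\<^sup>2 * K)"
          unfolding right_def z_def Ws_def
          by (rule order_trans[OF prob_not_controlled[where A = "A n" and d = d and \<theta> = \<theta>, unfolded g_eq \<theta>D,
                  OF A inj(2) k0(1) diff_le_self n1 W \<epsilon>D r_pos] rate])
        ultimately show ?thesis by (rule add_mono)
      qed
      also have "\<dots> = e / 2"
      proof -
        have cancel: "B / (\<epsilon>\<^sup>2 * (4 * B / (\<epsilon>\<^sup>2 * e))) = e / 4" if "0 < B" for B :: real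
          using that \<epsilon> e by (simp add: field_simps)
        have quarter: "(192 + 24000 * \<kappa>) / (\<epsilon>\<^sup>2 * K) = e / 4"
          unfolding K_def by (rule cancel) (use kurtosis_ge_1 in simp)
        show ?thesis unfolding quarter by simp
      qed
      also have "\<dots> < e" using e by simp
      finally show "prob {\<omega> \<in> space M. \<bar>real n * inverse ((\<gamma> n)\<^sup>2) * (\<delta> n)\<^sup>2 * (\<tau>hat n \<omega> - \<tau> n)\<bar> > K} < e" .
    qed
  qed
  have "(\<lambda>\<omega>. real n * inverse ((\<gamma> n)\<^sup>2) * (\<delta> n)\<^sup>2 * (\<tau>hat n \<omega> - \<tau> n)) \<in> borel_measurable M" for n
    using assms(16)[of n] by measurable
  then show ?thesis using tail unfolding bounded_in_prob_def by blast
qed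

end
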